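(* Let $\bullet$ be the empty superscript, "$\le 1$", or "$1$", and let $X$ be an $\mathsf{AP}_\bullet$-friendly topological space. Then $r_{\mathsf{AP}}$ restricts to a homeomorphism from $\mathcal{H}^{cvx}_{\mathcal V}(\mathbb{P}^\bullet_{\mathsf{P},wk}(X))$ onto $\mathbb{P}^\bullet_{\mathsf{AP},wk}(X)$, with inverse $s^\bullet_{\mathsf{AP}}$, and an order-isomorphism between $\mathcal{H}^{cvx}(\mathbb{P}^\bullet_{\mathsf{P},wk}(X))$ (ordered by inclusion) and $\mathbb{P}^\bullet_{\mathsf{AP}}(X)$ (ordered pointwise).
   Context: $\overline{\mathbb{R}}_+=[0,+\infty]$ carries the Scott topology (nontrivial opens $(r,+\infty]$, $r\ge 0$). For a topological space $X$, $\mathcal{L}X$ is the set of continuous maps $X\to\overline{\mathbb{R}}_+$, ordered pointwise, a cone under pointwise addition and multiplication by nonnegative reals, equipped with the Scott topology of the pointwise order; $\mathbf{1}$ is the constant map with value $1$. A prevision on $X$ is a Scott-continuous map $F:\mathcal{L}X\to\overline{\mathbb{R}}_+$ with $F(a h)=aF(h)$ for all $a\in\mathbb{R}_+$. It is linear if additive, and Hoare if sublinear ($F(h+h')\le F(h)+F(h')$). It is subnormalized if $F(\mathbf{1}+h)\le 1+F(h)$ for all $h$, normalized if equality holds for all $h$. For $\bullet$ empty / "$\le1$" / "$1$", $\mathbb{P}^\bullet_{\mathsf{P}}(X)$ (resp. $\mathbb{P}^\bullet_{\mathsf{AP}}(X)$) is the set of linear (resp. Hoare) previsions with no extra condition / subnormalized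 / normalized. The subscript $wk$ denotes the weak topology, generated by the sets $[h>r]=\{F\mid F(h)>r\}$, $h\in\mathcal{L}X$, $r\in\mathbb{R}_+$; its specialization order is the pointwise order. For a space $Y$, $\mathcal{H}_{\mathcal V}(Y)$ is the set of nonempty closed subsets of $Y$ with the lower Vietoris topology (subbase $\Diamond V=\{C\mid C\cap V\neq\emptyset\}$, $V$ open), $\mathcal{H}(Y)$ the same set ordered by inclusion; a superscript $cvx$ restricts to convex sets, where $E\subseteq\mathbb{P}^\bullet_{\mathsf P}(X)$ is convex iff $aG+(1-a)G'\in E$ for all $G,G'\in E$, $a\in[0,1]$. For a nonempty set $E$ of linear previsions, $r_{\mathsf{AP}}(E)(h)=\sup_{G\in E}G(h)$; for a Hoare prevision $F$, $s^\bullet_{\mathsf{AP}}(F)=\{G\in\mathbb{P}^\bullet_{\mathsf P}(X)\mid G\le F\}$. A semitopological cone is locally convex if every point has a base of convex open neighbourhoods, locally convex-compact if every point has a base of convex compact neighbourhoods; a topological cone is one where addition and scalar multiplication (with $\mathbb{R}_+$ Scott-topologized) are jointly continuous. A space is LCS-complete if it is homeomorphic to a $G_\delta$ subspace (countable intersection of opens) of a locally compact sober space. $X$ is $\mathsf{AP}$-friendly (equivalently $\mathsf{AP}_{\le1}$-friendly) iff $\mathcal{L}X$ is a locally convex semitopological cone. $X$ is $\mathsf{AP}_1$-friendly iff either (1) $X$ is compact and $\mathsf{AP}$-friendly, or (2) $\mathcal{L}X$ is a locally convex-compact, locally convex topological cone whose topology is sober, or (3) $X$ is LCS-complete. $\mathsf{AP}_\bullet$-friendly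 means the notion matching $\bullet$. *)

theory Defs
  imports "HOL-Analysis.Analysis" "HOL-Library.Extended_Nonnegative_Real"
begin

definition directed_in :: "'c::order set \<Rightarrow> 'c set \<Rightarrow> bool" where
  "directed_in P D \<longleftrightarrow> D \<subseteq> P \<and> D \<noteq> {} \<and>
     (\<forall>x\<in>D. \<forall>y\<in>D. \<exists>z\<in>D. x \<le> z \<and> y \<le> z)"

definition is_lub_in :: "'c::order set \<Rightarrow> 'c set \<Rightarrow> 'c \<Rightarrow> bool" where
  "is_lub_in P D s \<longleftrightarrow> s \<in> P \<and> (\<forall>d\<in>D. d \<le> s) \<and>
     (\<forall>u\<in>P. (\<forall>d\<in>D. d \<le> u) \<longrightarrow> s \<le> u)"

definition scott_open :: "'c::order set \<Rightarrow> 'c set \<Rightarrow> bool" where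
  "scott_open P U \<longleftrightarrow> U \<subseteq> P \<and>
     (\<forall>x\<in>U. \<forall>y\<in>P. x \<le> y \<longrightarrow> y \<in> U) \<and>
     (\<forall>D s. directed_in P D \<longrightarrow> is_lub_in P D s \<longrightarrow> s \<in> U \<longrightarrow> D \<inter> U \<noteq> {})"

lemma istopology_scott_open: "istopology (scott_open P)"
  unfolding istopology_def
proof (intro conjI allI impI)
  fix S T assume S: "scott_open P S" and T: "scott_open P T"
  show "scott_open P (S \<inter> T)"
    unfolding scott_open_def
  proof (intro conjI allI impI ballI)
    show "S \<inter> T \<subseteq> P" using S unfolding scott_open_def by blast
  next
    fix x y assume "x \<in> S \<inter> T" "y \<in> P" "x \<le> y"
    then show "y \<in> S \<inter> T" using S T unfolding scott_open_def by blast
  next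
    fix D s assume D: "directed_in P D" and s: "is_lub_in P D s" and sST: "s \<in> S \<inter> T"
    obtain d1 where d1: "d1 \<in> D" "d1 \<in> S" using S D s sST unfolding scott_open_def by blast
    obtain d2 where d2: "d2 \<in> D" "d2 \<in> T" using T D s sST unfolding scott_open_def by blast
    obtain d3 where d3: "d3 \<in> D" "d1 \<le> d3" "d2 \<le> d3" using D d1 d2 unfolding directed_in_def by blast
    have "d3 \<in> P" using D d3 unfolding directed_in_def by blast
    then have "d3 \<in> S \<inter> T" using S T d1 d2 d3 unfolding scott_open_def by blast
    then show "D \<inter> (S \<inter> T) \<noteq> {}" using d3 by blast
  qed
next
  fix K assume K: "\<forall>S\<in>K. scott_open P S"
  show "scott_open P (\<Union>K)"
    unfolding scott_open_def
  proof (intro conjI allI impI ballI)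
    show "\<Union>K \<subseteq> P" using K unfolding scott_open_def by blast
  next
    fix x y assume "x \<in> \<Union>K" "y \<in> P" "x \<le> y"
    then obtain S where "S \<in> K" "x \<in> S" by blast
    then have "y \<in> S" using K \<open>y \<in> P\<close> \<open>x \<le> y\<close> unfolding scott_open_def by blast
    then show "y \<in> \<Union>K" using \<open>S \<in> K\<close> by blast
  next
    fix D s assume D: "directed_in P D" "is_lub_in P D s" "s \<in> \<Union>K"
    then obtain S where "S \<in> K" "s \<in> S" by blast
    moreover have "scott_open P S" using K \<open>S \<in> K\<close> by blast
    ultimately have "D \<inter> S \<noteq> {}" using D unfolding scott_open_def by metis
    then show "D \<inter> \<Union>K \<noteq> {}" using \<open>S \<in> K\<close> by blast
  qed
qed

definition scott_topology :: "'c::order set \<Rightarrow> 'c topology" where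
  "scott_topology P = topology (scott_open P)"

lemma openin_scott_topology: "openin (scott_topology P) U \<longleftrightarrow> scott_open P U"
  unfolding scott_topology_def by (simp add: istopology_scott_open)

definition Rplus_scott :: "real topology" where
  "Rplus_scott = scott_topology {0..}"

text \<open>Maps are represented extensionally: value 0 outside the topspace of X.
  Continuity into [0,+oo] with the Scott topology: preimages of (r,+oo] are open.\<close>

definition LX :: "'a topology \<Rightarrow> ('a \<Rightarrow> ennreal) set" where
  "LX X = {h. (\<forall>x. x \<notin> topspace X \<longrightarrow> h x = 0) \<and>
               continuous_map X (scott_topology (UNIV :: ennreal set)) h}"

definition LX_add :: "('a \<Rightarrow> ennreal) \<Rightarrow> ('a \<Rightarrow> ennreal) \<Rightarrow> ('a \<Rightarrow> ennreal)" where
  "LX_add h h' = (\<lambda>x. h x + h' x)"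

definition LX_smul :: "real \<Rightarrow> ('a \<Rightarrow> ennreal) \<Rightarrow> ('a \<Rightarrow> ennreal)" where
  "LX_smul a h = (\<lambda>x. ennreal a * h x)"

definition LX_one :: "'a topology \<Rightarrow> ('a \<Rightarrow> ennreal)" where
  "LX_one X = (\<lambda>x. if x \<in> topspace X then 1 else 0)"

definition LX_scott :: "'a topology \<Rightarrow> ('a \<Rightarrow> ennreal) topology" where
  "LX_scott X = scott_topology (LX X)"

text \<open>Previsions are represented extensionally: value 0 outside LX.\<close>

definition prevision :: "'a topology \<Rightarrow> (('a \<Rightarrow> ennreal) \<Rightarrow> ennreal) \<Rightarrow> bool" where
  "prevision X F \<longleftrightarrow> (\<forall>h. h \<notin> LX X \<longrightarrow> F h = 0) \<and>
     continuous_map (LX_scott X) (scott_topology (UNIV :: ennreal set)) F \<and>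
     (\<forall>a::real. a \<ge> 0 \<longrightarrow> (\<forall>h\<in>LX X. F (LX_smul a h) = ennreal a * F h))"

definition linear_prevision :: "'a topology \<Rightarrow> (('a \<Rightarrow> ennreal) \<Rightarrow> ennreal) \<Rightarrow> bool" where
  "linear_prevision X F \<longleftrightarrow> prevision X F \<and>
     (\<forall>h\<in>LX X. \<forall>h'\<in>LX X. F (LX_add h h') = F h + F h')"

definition hoare_prevision :: "'a topology \<Rightarrow> (('a \<Rightarrow> ennreal) \<Rightarrow> ennreal) \<Rightarrow> bool" where
  "hoare_prevision X F \<longleftrightarrow> prevision X F \<and>
     (\<forall>h\<in>LX X. \<forall>h'\<in>LX X. F (LX_add h h') \<le> F h + F h')"

datatype variant = NoCond | SubNorm | Norm

definition norm_cond :: "variant \<Rightarrow> 'a topology \<Rightarrow> (('a \<Rightarrow> ennreal) \<Rightarrow> ennreal) \<Rightarrow> bool" where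
  "norm_cond v X F = (case v of
      NoCond \<Rightarrow> True
    | SubNorm \<Rightarrow> (\<forall>h\<in>LX X. F (LX_add (LX_one X) h) \<le> 1 + F h)
    | Norm \<Rightarrow> (\<forall>h\<in>LX X. F (LX_add (LX_one X) h) = 1 + F h))"

definition PP :: "variant \<Rightarrow> 'a topology \<Rightarrow> (('a \<Rightarrow> ennreal) \<Rightarrow> ennreal) set" where
  "PP v X = {F. linear_prevision X F \<and> norm_cond v X F}"

definition PAP :: "variant \<Rightarrow> 'a topology \<Rightarrow> (('a \<Rightarrow> ennreal) \<Rightarrow> ennreal) set" where
  "PAP v X = {F. hoare_prevision X F \<and> norm_cond v X F}"

definition weak_topology :: "'a topology \<Rightarrow> (('a \<Rightarrow> ennreal) \<Rightarrow> ennreal) set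
    \<Rightarrow> (('a \<Rightarrow> ennreal) \<Rightarrow> ennreal) topology" where
  "weak_topology X E = topology_generated_by
     (insert E {{F \<in> E. ennreal r < F h} | h r. h \<in> LX X \<and> r \<ge> 0})"

definition Hset :: "'b topology \<Rightarrow> 'b set set" where
  "Hset Y = {C. closedin Y C \<and> C \<noteq> {}}"

definition lower_vietoris :: "'b topology \<Rightarrow> 'b set topology" where
  "lower_vietoris Y = topology_generated_by
     (insert (Hset Y) {{C \<in> Hset Y. C \<inter> V \<noteq> {}} | V. openin Y V})"

definition convex_prev_set :: "(('a \<Rightarrow> ennreal) \<Rightarrow> ennreal) set \<Rightarrow> bool" where
  "convex_prev_set E \<longleftrightarrow> (\<forall>G\<in>E. \<forall>G'\<in>E. \<forall>a::real. 0 \<le> a \<and> a \<le> 1 \<longrightarrow>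
       (\<lambda>h. ennreal a * G h + ennreal (1 - a) * G' h) \<in> E)"

definition Hcvx :: "variant \<Rightarrow> 'a topology \<Rightarrow> (('a \<Rightarrow> ennreal) \<Rightarrow> ennreal) set set" where
  "Hcvx v X = {E \<in> Hset (weak_topology X (PP v X)). convex_prev_set E}"

definition r_AP :: "(('a \<Rightarrow> ennreal) \<Rightarrow> ennreal) set \<Rightarrow> (('a \<Rightarrow> ennreal) \<Rightarrow> ennreal)" where
  "r_AP E = (\<lambda>h. SUP G\<in>E. G h)"

definition s_AP :: "variant \<Rightarrow> 'a topology \<Rightarrow> (('a \<Rightarrow> ennreal) \<Rightarrow> ennreal)
    \<Rightarrow> (('a \<Rightarrow> ennreal) \<Rightarrow> ennreal) set" where
  "s_AP v X F = {G \<in> PP v X. G \<le> F}"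

text \<open>A cone is given by a topology T (carrier = topspace T), an addition and a
  scalar multiplication by nonnegative reals.\<close>

definition cone_convex :: "'c topology \<Rightarrow> ('c \<Rightarrow> 'c \<Rightarrow> 'c) \<Rightarrow> (real \<Rightarrow> 'c \<Rightarrow> 'c) \<Rightarrow> 'c set \<Rightarrow> bool" where
  "cone_convex T add smul S \<longleftrightarrow> S \<subseteq> topspace T \<and>
     (\<forall>x\<in>S. \<forall>y\<in>S. \<forall>a::real. 0 \<le> a \<and> a \<le> 1 \<longrightarrow> add (smul a x) (smul (1 - a) y) \<in> S)"

definition semitopological_cone :: "'c topology \<Rightarrow> ('c \<Rightarrow> 'c \<Rightarrow> 'c) \<Rightarrow> (real \<Rightarrow> 'c \<Rightarrow> 'c) \<Rightarrow> bool" where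
  "semitopological_cone T add smul \<longleftrightarrow> t0_space T \<and>
     (\<forall>x\<in>topspace T. continuous_map T T (add x)) \<and>
     (\<forall>y\<in>topspace T. continuous_map T T (\<lambda>x. add x y)) \<and>
     (\<forall>a::real. a \<ge> 0 \<longrightarrow> continuous_map T T (smul a)) \<and>
     (\<forall>x\<in>topspace T. continuous_map Rplus_scott T (\<lambda>a. smul a x))"

definition topological_cone :: "'c topology \<Rightarrow> ('c \<Rightarrow> 'c \<Rightarrow> 'c) \<Rightarrow> (real \<Rightarrow> 'c \<Rightarrow> 'c) \<Rightarrow> bool" where
  "topological_cone T add smul \<longleftrightarrow> t0_space T \<and>
     continuous_map (prod_topology T T) T (\<lambda>(x, y). add x y) \<and>
     continuous_map (prod_topology Rplus_scott T) T (\<lambda>(a, x). smul a x)"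

definition locally_convex_cone :: "'c topology \<Rightarrow> ('c \<Rightarrow> 'c \<Rightarrow> 'c) \<Rightarrow> (real \<Rightarrow> 'c \<Rightarrow> 'c) \<Rightarrow> bool" where
  "locally_convex_cone T add smul \<longleftrightarrow>
     (\<forall>x\<in>topspace T. \<forall>U. openin T U \<and> x \<in> U \<longrightarrow>
        (\<exists>V. openin T V \<and> cone_convex T add smul V \<and> x \<in> V \<and> V \<subseteq> U))"

definition locally_convex_compact_cone :: "'c topology \<Rightarrow> ('c \<Rightarrow> 'c \<Rightarrow> 'c) \<Rightarrow> (real \<Rightarrow> 'c \<Rightarrow> 'c) \<Rightarrow> bool" where
  "locally_convex_compact_cone T add smul \<longleftrightarrow>
     (\<forall>x\<in>topspace T. \<forall>U. openin T U \<and> x \<in> U \<longrightarrow>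
        (\<exists>Q. compactin T Q \<and> cone_convex T add smul Q \<and> x \<in> T interior_of Q \<and> Q \<subseteq> U))"

definition irreducible_closed :: "'b topology \<Rightarrow> 'b set \<Rightarrow> bool" where
  "irreducible_closed Y C \<longleftrightarrow> closedin Y C \<and> C \<noteq> {} \<and>
     (\<forall>A B. closedin Y A \<and> closedin Y B \<and> C \<subseteq> A \<union> B \<longrightarrow> C \<subseteq> A \<or> C \<subseteq> B)"

definition sober_space :: "'b topology \<Rightarrow> bool" where
  "sober_space Y \<longleftrightarrow> (\<forall>C. irreducible_closed Y C \<longrightarrow>
     (\<exists>!x. x \<in> topspace Y \<and> Y closure_of {x} = C))"

definition locally_compact_base :: "'b topology \<Rightarrow> bool" where
  "locally_compact_base Y \<longleftrightarrow> (\<forall>x\<in>topspace Y. \<forall>U. openin Y U \<and> x \<in> U \<longrightarrow>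
     (\<exists>V K. openin Y V \<and> compactin Y K \<and> x \<in> V \<and> V \<subseteq> K \<and> K \<subseteq> U))"

definition lcs_complete :: "'b itself \<Rightarrow> 'a topology \<Rightarrow> bool" where
  "lcs_complete (_ :: 'b itself) X \<longleftrightarrow> (\<exists>(Y :: 'b topology) S.
     locally_compact_base Y \<and> sober_space Y \<and> gdelta_in Y S \<and>
     X homeomorphic_space subtopology Y S)"

definition AP_friendly :: "'a topology \<Rightarrow> bool" where
  "AP_friendly X \<longleftrightarrow> semitopological_cone (LX_scott X) LX_add LX_smul \<and>
                      locally_convex_cone (LX_scott X) LX_add LX_smul"

definition AP1_friendly :: "'b itself \<Rightarrow> 'a topology \<Rightarrow> bool" where
  "AP1_friendly B X \<longleftrightarrow>
     (compact_space X \<and> AP_friendly X) \<or>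
     (locally_convex_compact_cone (LX_scott X) LX_add LX_smul \<and>
      locally_convex_cone (LX_scott X) LX_add LX_smul \<and>
      topological_cone (LX_scott X) LX_add LX_smul \<and>
      sober_space (LX_scott X)) \<or>
     lcs_complete B X"

definition friendly :: "'b itself \<Rightarrow> variant \<Rightarrow> 'a topology \<Rightarrow> bool" where
  "friendly B v X = (case v of NoCond \<Rightarrow> AP_friendly X | SubNorm \<Rightarrow> AP_friendly X
                             | Norm \<Rightarrow> AP1_friendly B X)"

end

theory Submission
  imports Defs
begin

text \<open>
  Everything follows once each Hoare prevision \<open>F\<close> is the pointwise supremum of the linear previsions
  of the right kind below it. For \<open>E\<close> convex and closed, a linear prevision outside \<open>E\<close> is then
  separated from \<open>E\<close> by a single map, because finitely many half-spaces with empty common trace on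
  a convex set can be averaged to one half-space (a two-dimensional separation argument, iterated).
  The same averaging, on a finite grid of weights, gives continuity of the inverse.

  To find a linear prevision below \<open>F\<close> that is large at \<open>h\<close>, take a convex Scott-open \<open>U\<close> containing
  \<open>h\<close> on which \<open>F > 1\<close>, and a minimal sublinear functional below \<open>F\<close> that is at least \<open>1\<close> on \<open>U\<close>:
  minimality forces it to be additive and equal to its own Scott-continuous hull.

  The normalized case needs in addition mass \<open>1\<close> on the whole space. If \<open>X\<close> is compact, the identity
  \<open>P (x + a 1) = P x + a\<close> survives the passage to the Scott-continuous hull. If the cone of maps is
  locally convex-compact, \<open>U\<close> is built as an increasing union of convex compact sets that also
  contains \<open>(1 + \<epsilon>) 1\<close> for arbitrarily small \<open>\<epsilon>\<close>. If \<open>X\<close> is a \<open>G\<^sub>\<delta>\<close> set \<open>\<Inter>n. A n\<close> in a locally compact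
  sober space \<open>Y\<close>, the same construction on \<open>Y\<close>, with the indicators of the \<open>A n\<close> in place of \<open>1\<close>,
  yields a linear prevision on \<open>Y\<close> with mass \<open>1\<close> on every \<open>A n\<close>; by soberness its values depend only
  on the restrictions of maps to \<open>X\<close>.
\<close>

section \<open>Lower semicontinuous maps and Scott-continuous functionals\<close>

text \<open>Minimality is exploited as in the Hahn-Banach theorem: if a minimal \<open>P\<close>
  violated \<open>P x + c \<le> P (x \<oplus> w)\<close>, the infimum of
  \<open>P (x \<oplus> w) - c\<close> over a suitable cone of pairs \<open>(w, c)\<close> would be a
  smaller member of the class. The cone spanned by \<open>U\<close>, and after it single rays, give
  superadditivity. Only finite \<open>c\<close> can be subtracted, so infinite values are treated
  apart.

  The obstacle in the normalized case is that passing to the Scott-continuous hull may lose mass: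
  the argument for shifts along the constant map needs the maps everywhere above \<open>c\<close> to
  form a Scott-open set, which compactness provides. Elsewhere the mass is put into \<open>U\<close>
  itself. Since \<open>F\<close> is 1 at the constant map 1 while \<open>U\<close> is kept inside
  the set \<open>F > 1\<close>, only multiples by \<open>1 + \<epsilon>\<close> fit, and
  \<open>\<epsilon>\<close> tends to 0 along the sequence. As \<open>F\<close> is merely sublinear,
  the set \<open>F > 1\<close> need not be convex, so each stage interposes a set
  \<open>L > 1\<close> with \<open>L\<close> linear; \<open>L\<close> may change from stage to
  stage, and compactness is what produces one \<open>L\<close> for a whole convex set.\<close>

notation LX_add (infixl "\<oplus>" 65)
notation LX_smul (infixr "\<odot>" 70)

lemma topspace_scott_topology [simp]: "topspace (scott_topology P) = P"
proof
  show "topspace (scott_topology P) \<subseteq> P"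
    by (auto simp: topspace_def openin_scott_topology scott_open_def)
  have "scott_open P P"
    by (auto simp: scott_open_def directed_in_def)
  then show "P \<subseteq> topspace (scott_topology P)"
    by (metis openin_scott_topology openin_subset)
qed

lemma scott_open_greaterThan: "scott_open UNIV {r<..}" for r :: ennreal
proof -
  have "D \<inter> {r<..} \<noteq> {}" if "is_lub_in UNIV D s" "r < s" for D s
  proof -
    have "s \<le> Sup D"
      using that(1) by (simp add: is_lub_in_def Sup_upper)
    with that(2) have "r < Sup D" by order
    then show ?thesis by (auto simp: less_Sup_iff)
  qed
  moreover have "y \<in> {r<..}" if "x \<in> {r<..}" "x \<le> y" for x y
    using that by (auto intro: less_le_trans)
  ultimately show ?thesis
    unfolding scott_open_def by blast
qed

text \<open>The infimum \<open>r\<close> of a proper nonempty open set does not belong to it: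
  \<open>r\<close> is the supremum of the directed set \<open>{..<r}\<close>, which is disjoint from
  the open set.\<close>

lemma scott_open_ennreal_cases:
  assumes U: "scott_open UNIV (U :: ennreal set)"
  shows "U = {} \<or> U = UNIV \<or> (\<exists>r. U = {r<..})"
proof (cases "U = {} \<or> U = UNIV")
  case False
  define r where "r = Inf U"
  have up: "y \<in> U" if "x \<in> U" "x \<le> y" for x y
    using U that unfolding scott_open_def by blast
  have gt: "{r<..} \<subseteq> U"
    unfolding r_def by (meson Inf_less_iff greaterThan_iff less_imp_le subsetI up)
  have "r \<notin> U"
  proof
    assume "r \<in> U"
    moreover have "r \<noteq> 0" using \<open>r \<in> U\<close> up False by (metis UNIV_eq_I zero_le)
    ultimately have pos: "0 < r" by (simp add: zero_less_iff_neq_zero)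
    have "\<exists>z\<in>{..<r}. x \<le> z \<and> y \<le> z" if "x \<in> {..<r}" "y \<in> {..<r}" for x y
      using that by (intro bexI[of _ "max x y"]) auto
    then have "directed_in UNIV {..<r}"
      using pos by (auto simp: directed_in_def)
    moreover have "is_lub_in UNIV {..<r} r"
      unfolding is_lub_in_def by (auto intro: dense_le)
    ultimately have "{..<r} \<inter> U \<noteq> {}"
      using U \<open>r \<in> U\<close> unfolding scott_open_def by blast
    then obtain s where "s < r" "s \<in> U" by blast
    then show False by (auto simp: r_def not_less[symmetric] dest: Inf_lower)
  qed
  moreover have "U \<subseteq> {r..}" by (auto simp: r_def Inf_lower)
  ultimately have "U = {r<..}" using gt by (auto simp: less_le)
  then show ?thesis by blast
qed auto

lemma continuous_map_scott_ennreal: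
  "continuous_map T (scott_topology (UNIV :: ennreal set)) f \<longleftrightarrow> (\<forall>r. openin T {x \<in> topspace T. r < f x})"
proof
  assume f: "continuous_map T (scott_topology (UNIV :: ennreal set)) f"
  show "\<forall>r. openin T {x \<in> topspace T. r < f x}"
  proof
    fix r :: ennreal
    have "openin (scott_topology UNIV) {(r::ennreal)<..}"
      by (simp add: openin_scott_topology scott_open_greaterThan)
    from openin_continuous_map_preimage[OF f this] show "openin T {x \<in> topspace T. r < f x}" by simp
  qed
next
  assume *: "\<forall>r. openin T {x \<in> topspace T. r < f x}"
  have "openin T {x \<in> topspace T. f x \<in> U}" if "scott_open UNIV U" for U
    using scott_open_ennreal_cases[OF that] * by auto
  then show "continuous_map T (scott_topology (UNIV :: ennreal set)) f"
    by (auto simp: continuous_map_def openin_scott_topology)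
qed

text \<open>Vanishing outside \<open>topspace X\<close> is encoded by the case \<open>r = 0\<close>:
  the open set where \<open>h\<close> is positive lies inside \<open>topspace X\<close>.\<close>

lemma LX_iff: "h \<in> LX X \<longleftrightarrow> (\<forall>r. openin X {x. r < h x})"
proof
  assume h: "h \<in> LX X"
  have "{x \<in> topspace X. r < h x} = {x. r < h x}" for r
    using h by (fastforce simp: LX_def)
  with h show "\<forall>r. openin X {x. r < h x}"
    by (simp add: LX_def continuous_map_scott_ennreal)
next
  assume *: "\<forall>r. openin X {x. r < h x}"
  then have "{x. r < h x} \<subseteq> topspace X" for r
    using openin_subset by blast
  then have sub: "x \<in> topspace X" if "r < h x" for r x
    using that by blast
  have "{x \<in> topspace X. r < h x} = {x. r < h x}" for r
    using sub by blast
  moreover have "h x = 0" if "x \<notin> topspace X" for x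
    using sub[of 0 x] that by (auto simp: zero_less_iff_neq_zero)
  ultimately show "h \<in> LX X"
    using * by (simp add: LX_def continuous_map_scott_ennreal)
qed

lemma LX_outside: "h \<in> LX X \<Longrightarrow> x \<notin> topspace X \<Longrightarrow> h x = 0"
  by (simp add: LX_def)

lemma LX_Sup: "D \<subseteq> LX X \<Longrightarrow> Sup D \<in> LX X"
proof -
  assume D: "D \<subseteq> LX X"
  have "{x. r < Sup D x} = (\<Union>d\<in>D. {x. r < d x})" for r
    unfolding Sup_apply less_SUP_iff by blast
  moreover have "openin X (\<Union>d\<in>D. {x. r < d x})" for r
    using D by (intro openin_Union) (auto simp: LX_iff)
  ultimately show ?thesis unfolding LX_iff by simp
qed

lemma LX_sup: "h \<in> LX X \<Longrightarrow> h' \<in> LX X \<Longrightarrow> sup h h' \<in> LX X"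
  using LX_Sup[of "{h, h'}" X] by simp

text \<open>Writes the superlevel sets of a sum through those of the summands. The first two
  disjuncts cover a summand 0, which has nothing strictly below it.\<close>

lemma ennreal_less_add_iff:
  fixes a b r :: ennreal
  shows "r < a + b \<longleftrightarrow> r < a \<or> r < b \<or> (\<exists>s t. s < a \<and> t < b \<and> r < s + t)"
proof
  assume r: "r < a + b"
  show "r < a \<or> r < b \<or> (\<exists>s t. s < a \<and> t < b \<and> r < s + t)"
  proof (cases "a = 0 \<or> b = 0")
    case False
    have Sup_lt: "c = (SUP s\<in>{..<c}. s)" for c :: ennreal
      by (metis Sup_lessThan image_ident)
    from False have "0 \<in> {..<a}" "0 \<in> {..<b}" by (auto simp: zero_less_iff_neq_zero)
    then have ne: "{..<a} \<noteq> {}" "{..<b} \<noteq> {}" by blast+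
    have "a + b = (SUP s\<in>{..<a}. s + b)"
      by (subst Sup_lt) (simp add: ennreal_SUP_add_left ne)
    with r obtain s where s: "s < a" "r < s + b" by (auto simp: less_SUP_iff)
    have "s + b = (SUP t\<in>{..<b}. s + t)"
      using ennreal_SUP_add_right[OF ne(2), of s "\<lambda>t. t"] Sup_lt[of b] by metis
    with s obtain t where "t < b" "r < s + t" by (auto simp: less_SUP_iff)
    with s show ?thesis by blast
  qed (use r in auto)
next
  have le: "a \<le> a + b" "b \<le> a + b" by auto
  assume "r < a \<or> r < b \<or> (\<exists>s t. s < a \<and> t < b \<and> r < s + t)"
  then show "r < a + b"
    using le add_mono[of _ a _ b] by (meson less_le_trans less_imp_le)
qed

lemma LX_add: "h \<in> LX X \<Longrightarrow> h' \<in> LX X \<Longrightarrow> h \<oplus> h' \<in> LX X"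
proof -
  assume *: "h \<in> LX X" "h' \<in> LX X"
  have "{x. r < (h \<oplus> h') x} = {x. r < h x} \<union> {x. r < h' x} \<union>
      (\<Union>(s,t)\<in>{(s,t). r < s + t}. {x. s < h x} \<inter> {x. t < h' x})" for r
  proof (rule set_eqI)
    fix x show "x \<in> {x. r < (h \<oplus> h') x} \<longleftrightarrow> x \<in> {x. r < h x} \<union> {x. r < h' x} \<union>
      (\<Union>(s,t)\<in>{(s,t). r < s + t}. {x. s < h x} \<inter> {x. t < h' x})"
      using ennreal_less_add_iff[of r "h x" "h' x"] unfolding LX_add_def by blast
  qed
  moreover have "openin X ({x. r < h x} \<union> {x. r < h' x} \<union>
      (\<Union>(s,t)\<in>{(s,t). r < s + t}. {x. s < h x} \<inter> {x. t < h' x}))" for r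
    using * unfolding LX_iff by (intro openin_Un openin_Union) (auto intro: openin_Int)
  ultimately show ?thesis unfolding LX_iff by simp
qed

lemma LX_smul: "h \<in> LX X \<Longrightarrow> a \<odot> h \<in> LX X"
proof (cases "a > 0")
  case True
  assume h: "h \<in> LX X"
  have "r < ennreal a * y \<longleftrightarrow> r / ennreal a < y" for r y
    using True by (simp add: divide_less_ennreal mult.commute)
  with h show ?thesis by (simp add: LX_iff LX_smul_def)
next
  case False
  assume h: "h \<in> LX X"
  show ?thesis using False by (simp add: LX_iff LX_smul_def ennreal_neg)
qed

lemma LX_diff: "h \<in> LX X \<Longrightarrow> c \<noteq> top \<Longrightarrow> (\<lambda>x. h x - c) \<in> LX X"
  by (simp add: LX_iff less_diff_eq_ennreal less_top)

definition chi :: "'a set \<Rightarrow> 'a \<Rightarrow> ennreal" where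
  "chi U = (\<lambda>x. if x \<in> U then 1 else 0)"

lemma LX_chi: "openin X U \<Longrightarrow> chi U \<in> LX X"
proof -
  assume "openin X U"
  moreover have "{x. r < chi U x} = (if r < 1 then U else {})" for r
    by (auto simp: chi_def)
  ultimately show ?thesis by (simp add: LX_iff)
qed

lemma LX_one_eq_chi: "LX_one X = chi (topspace X)"
  by (simp add: LX_one_def chi_def)

lemma LX_one: "LX_one X \<in> LX X"
  by (simp add: LX_one_eq_chi LX_chi)

section \<open>The Scott topology on the cone of maps\<close>

lemma topspace_LX_scott [simp]: "topspace (LX_scott X) = LX X"
  by (simp add: LX_scott_def)

lemma is_lub_in_LX:
  assumes "D \<subseteq> LX X"
  shows "is_lub_in (LX X) D s \<longleftrightarrow> s = Sup D"
proof
  assume s: "is_lub_in (LX X) D s"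
  then have "s \<le> Sup D"
    unfolding is_lub_in_def by (meson LX_Sup Sup_upper assms)
  moreover have "Sup D \<le> s"
    using s unfolding is_lub_in_def by (intro Sup_least) blast
  ultimately show "s = Sup D" by (rule antisym)
next
  assume "s = Sup D"
  then show "is_lub_in (LX X) D s"
    unfolding is_lub_in_def by (metis LX_Sup Sup_least Sup_upper assms)
qed

text \<open>Pointwise suprema of lower semicontinuous maps are lower semicontinuous, so the least
  upper bounds in the definition of the Scott topology are pointwise suprema.\<close>

lemma openin_LX_scott:
  "openin (LX_scott X) U \<longleftrightarrow> U \<subseteq> LX X \<and> (\<forall>x\<in>U. \<forall>y\<in>LX X. x \<le> y \<longrightarrow> y \<in> U) \<and>
     (\<forall>D. directed_in (LX X) D \<longrightarrow> Sup D \<in> U \<longrightarrow> (\<exists>d\<in>D. d \<in> U))"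
proof -
  have lub: "is_lub_in (LX X) D s \<longleftrightarrow> s = Sup D" if "directed_in (LX X) D" for D s
    using that by (simp add: is_lub_in_LX directed_in_def)
  have "(\<forall>D s. directed_in (LX X) D \<longrightarrow> is_lub_in (LX X) D s \<longrightarrow> s \<in> U \<longrightarrow> D \<inter> U \<noteq> {}) \<longleftrightarrow>
      (\<forall>D. directed_in (LX X) D \<longrightarrow> Sup D \<in> U \<longrightarrow> (\<exists>d\<in>D. d \<in> U))"
    by (metis (no_types, lifting) lub disjoint_iff)
  then show ?thesis
    unfolding LX_scott_def openin_scott_topology scott_open_def by simp
qed

text \<open>Scott continuity in order form; the opposite inequality for suprema follows from
  monotonicity. Values outside \<open>LX X\<close> are left free, so that candidates for the hull
  can be written down without case distinctions.\<close>

definition sc :: "'a topology \<Rightarrow> (('a \<Rightarrow> ennreal) \<Rightarrow> ennreal) \<Rightarrow> bool" where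
  "sc X \<phi> \<longleftrightarrow> (\<forall>x\<in>LX X. \<forall>y\<in>LX X. x \<le> y \<longrightarrow> \<phi> x \<le> \<phi> y) \<and>
     (\<forall>D. directed_in (LX X) D \<longrightarrow> \<phi> (Sup D) \<le> (SUP d\<in>D. \<phi> d))"

lemma sc_mono: "sc X \<phi> \<Longrightarrow> x \<in> LX X \<Longrightarrow> y \<in> LX X \<Longrightarrow> x \<le> y \<Longrightarrow> \<phi> x \<le> \<phi> y"
  by (simp add: sc_def)

lemma sc_Sup:
  assumes "sc X \<phi>" "directed_in (LX X) D"
  shows "\<phi> (Sup D) = (SUP d\<in>D. \<phi> d)"
proof (rule antisym)
  have D: "D \<subseteq> LX X" using assms(2) by (simp add: directed_in_def)
  show "(SUP d\<in>D. \<phi> d) \<le> \<phi> (Sup D)"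
  proof (rule SUP_least)
    fix d assume "d \<in> D"
    with D show "\<phi> d \<le> \<phi> (Sup D)"
      by (intro sc_mono[OF assms(1)] LX_Sup Sup_upper) auto
  qed
qed (use assms in \<open>simp add: sc_def\<close>)

lemma sc_iff_openin: "sc X \<phi> \<longleftrightarrow> (\<forall>r. openin (LX_scott X) {h \<in> LX X. r < \<phi> h})"
proof
  assume sc: "sc X \<phi>"
  show "\<forall>r. openin (LX_scott X) {h \<in> LX X. r < \<phi> h}"
    unfolding openin_LX_scott
  proof (intro allI conjI ballI impI)
    fix r x y assume "x \<in> {h \<in> LX X. r < \<phi> h}" "y \<in> LX X" "x \<le> y"
    then show "y \<in> {h \<in> LX X. r < \<phi> h}"
      using sc_mono[OF sc, of x y] by auto
  next
    fix r D assume D: "directed_in (LX X) D" "Sup D \<in> {h \<in> LX X. r < \<phi> h}"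
    then obtain d where "d \<in> D" "r < \<phi> d"
      unfolding sc_Sup[OF sc D(1), symmetric] mem_Collect_eq by (auto simp: sc_Sup[OF sc D(1)] less_SUP_iff)
    with D(1) show "\<exists>d\<in>D. d \<in> {h \<in> LX X. r < \<phi> h}"
      by (auto simp: directed_in_def)
  qed auto
next
  assume *: "\<forall>r. openin (LX_scott X) {h \<in> LX X. r < \<phi> h}"
  show "sc X \<phi>"
    unfolding sc_def
  proof (intro conjI ballI allI impI)
    fix x y assume "x \<in> LX X" "y \<in> LX X" "x \<le> y"
    then show "\<phi> x \<le> \<phi> y"
      using *[rule_format, of "\<phi> y", unfolded openin_LX_scott]
      by (metis (no_types, lifting) less_irrefl mem_Collect_eq not_le)
  next
    fix D assume D: "directed_in (LX X) D"
    show "\<phi> (Sup D) \<le> (SUP d\<in>D. \<phi> d)"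
    proof (rule ccontr)
      assume "\<not> ?thesis"
      moreover have "Sup D \<in> LX X" using D by (simp add: LX_Sup directed_in_def)
      ultimately obtain d where "d \<in> D" "(SUP d\<in>D. \<phi> d) < \<phi> d"
        using *[rule_format, of "SUP d\<in>D. \<phi> d", unfolded openin_LX_scott] D
        by (metis (no_types, lifting) mem_Collect_eq not_le)
      then show False by (metis SUP_upper leD)
    qed
  qed
qed

lemma sc_iff_continuous:
  "continuous_map (LX_scott X) (scott_topology (UNIV :: ennreal set)) \<phi> \<longleftrightarrow> sc X \<phi>"
  by (simp add: continuous_map_scott_ennreal sc_iff_openin)

section \<open>Cone arithmetic and closure properties of Scott-continuous functionals\<close>

lemma LX_smul_add: "a \<odot> (x \<oplus> y) = a \<odot> x \<oplus> a \<odot> y"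
  by (simp add: LX_add_def LX_smul_def distrib_left)

lemma LX_add_smul: "0 \<le> a \<Longrightarrow> 0 \<le> b \<Longrightarrow> (a + b) \<odot> x = a \<odot> x \<oplus> b \<odot> x"
  by (simp add: LX_add_def LX_smul_def distrib_right)

lemma LX_smul_smul: "0 \<le> a \<Longrightarrow> a \<odot> b \<odot> x = (a * b) \<odot> x"
  by (cases "0 \<le> b") (simp_all add: LX_smul_def ennreal_mult mult.assoc ennreal_neg mult_nonneg_nonpos)

lemma LX_one_smul [simp]: "1 \<odot> x = x"
  by (simp add: LX_smul_def)

lemma LX_zero_smul [simp]: "0 \<odot> x = (\<lambda>_. 0)"
  by (simp add: LX_smul_def)

lemma LX_smul_zero [simp]: "a \<odot> (\<lambda>_. 0) = (\<lambda>_. 0)"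
  by (simp add: LX_smul_def)

lemma LX_add_zero [simp]: "x \<oplus> (\<lambda>_. 0) = x" "(\<lambda>_. 0) \<oplus> x = x"
  by (simp_all add: LX_add_def)

lemma LX_add_commute: "x \<oplus> y = y \<oplus> x"
  by (simp add: LX_add_def add.commute)

lemma LX_add_assoc: "(x \<oplus> y) \<oplus> z = x \<oplus> (y \<oplus> z)"
  by (simp add: LX_add_def add.assoc)

lemma LX_add_left_commute: "x \<oplus> (y \<oplus> z) = y \<oplus> (x \<oplus> z)"
  by (simp add: LX_add_def add.left_commute)

lemmas LX_add_ac = LX_add_commute LX_add_assoc LX_add_left_commute

lemma LX_zero [simp]: "(\<lambda>_. 0) \<in> LX X"
  by (simp add: LX_iff)

lemma LX_add_mono: "x \<le> x' \<Longrightarrow> y \<le> y' \<Longrightarrow> x \<oplus> y \<le> x' \<oplus> y'"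
  by (simp add: LX_add_def le_fun_def add_mono)

lemma LX_smul_mono: "x \<le> x' \<Longrightarrow> a \<odot> x \<le> a \<odot> x'"
  by (simp add: LX_smul_def le_fun_def mult_left_mono)

lemma LX_smul_mono_left: "a \<le> b \<Longrightarrow> a \<odot> x \<le> b \<odot> x"
  by (simp add: LX_smul_def le_fun_def mult_right_mono ennreal_leI)

lemma LX_le_add: "x \<le> x \<oplus> y" "y \<le> x \<oplus> y"
  by (simp_all add: LX_add_def le_fun_def)

text \<open>The common reason why translation, scaling, truncated subtraction of a constant and
  pulling back along a map preserve Scott continuity.\<close>

lemma sc_compose:
  assumes sc: "sc Z \<phi>"
    and T: "\<And>x. x \<in> LX X \<Longrightarrow> T x \<in> LX Z"
    and mono: "\<And>x y. x \<in> LX X \<Longrightarrow> y \<in> LX X \<Longrightarrow> x \<le> y \<Longrightarrow> T x \<le> T y"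
    and sup: "\<And>D. directed_in (LX X) D \<Longrightarrow> T (Sup D) = (SUP d\<in>D. T d)"
  shows "sc X (\<lambda>x. \<phi> (T x))"
  unfolding sc_def
proof (intro conjI ballI allI impI)
  fix x y assume "x \<in> LX X" "y \<in> LX X" "x \<le> y"
  then show "\<phi> (T x) \<le> \<phi> (T y)"
    by (intro sc_mono[OF sc] T mono)
next
  fix D assume D: "directed_in (LX X) D"
  have "directed_in (LX Z) (T ` D)"
    unfolding directed_in_def
  proof (intro conjI ballI)
    fix a b assume "a \<in> T ` D" "b \<in> T ` D"
    then obtain x y where xy: "x \<in> D" "y \<in> D" "a = T x" "b = T y" by blast
    with D obtain z where z: "z \<in> D" "x \<le> z" "y \<le> z" unfolding directed_in_def by blast
    with xy D have "T x \<le> T z" "T y \<le> T z" unfolding directed_in_def by (auto intro: mono)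
    with z xy show "\<exists>z\<in>T ` D. a \<le> z \<and> b \<le> z" by blast
  qed (use D T in \<open>auto simp: directed_in_def\<close>)
  from sc_Sup[OF sc this] show "\<phi> (T (Sup D)) \<le> (SUP d\<in>D. \<phi> (T d))"
    by (simp add: sup[OF D] image_image)
qed

lemma sc_translate:
  assumes "sc X \<phi>" "y \<in> LX X"
  shows "sc X (\<lambda>x. \<phi> (x \<oplus> y))"
proof (rule sc_compose[OF assms(1)])
  fix D assume "directed_in (LX X) D"
  then have "D \<noteq> {}" by (simp add: directed_in_def)
  then show "Sup D \<oplus> y = (SUP d\<in>D. d \<oplus> y)"
    by (intro ext) (simp add: LX_add_def image_image ennreal_SUP_add_left)
qed (use assms in \<open>auto intro: LX_add LX_add_mono\<close>)

lemma sc_scale: "sc X \<phi> \<Longrightarrow> sc X (\<lambda>x. \<phi> (a \<odot> x))"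
proof (erule sc_compose)
  show "a \<odot> Sup D = (SUP d\<in>D. a \<odot> d)" for D
    by (simp add: LX_smul_def image_image SUP_mult_left_ennreal fun_eq_iff)
qed (auto intro: LX_smul LX_smul_mono)

text \<open>Suprema commute, whatever the family \<open>\<Phi>\<close>. Hence there is a largest
  Scott-continuous function below a given one.\<close>

lemma sc_SUP: "(\<And>\<phi>. \<phi> \<in> \<Phi> \<Longrightarrow> sc X \<phi>) \<Longrightarrow> sc X (\<lambda>x. SUP \<phi>\<in>\<Phi>. \<phi> x)"
proof -
  assume *: "\<And>\<phi>. \<phi> \<in> \<Phi> \<Longrightarrow> sc X \<phi>"
  show ?thesis
    unfolding sc_def
  proof (intro conjI ballI allI impI)
    fix x y assume "x \<in> LX X" "y \<in> LX X" "x \<le> y"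
    then show "(SUP \<phi>\<in>\<Phi>. \<phi> x) \<le> (SUP \<phi>\<in>\<Phi>. \<phi> y)"
      by (intro SUP_mono) (metis * sc_mono)
  next
    fix D assume "directed_in (LX X) D"
    have "\<phi> (Sup D) \<le> (SUP d\<in>D. SUP \<phi>\<in>\<Phi>. \<phi> d)" if "\<phi> \<in> \<Phi>" for \<phi>
    proof -
      have "\<phi> (Sup D) \<le> (SUP d\<in>D. \<phi> d)"
        using *[OF that] \<open>directed_in (LX X) D\<close> by (simp add: sc_def)
      also have "\<dots> \<le> (SUP d\<in>D. SUP \<phi>\<in>\<Phi>. \<phi> d)"
        by (intro SUP_mono' SUP_upper[OF that])
      finally show ?thesis .
    qed
    then show "(SUP \<phi>\<in>\<Phi>. \<phi> (Sup D)) \<le> (SUP d\<in>D. SUP \<phi>\<in>\<Phi>. \<phi> d)"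
      by (rule SUP_least)
  qed
qed

lemma sc_diff: "sc X \<phi> \<Longrightarrow> c \<noteq> top \<Longrightarrow> sc X (\<lambda>x. \<phi> x - c)"
  by (simp add: sc_iff_openin less_diff_eq_ennreal less_top)

lemma sc_cmult: "sc X \<phi> \<Longrightarrow> sc X (\<lambda>x. c * \<phi> x)"
  unfolding sc_def by (simp add: mult_left_mono SUP_mult_left_ennreal[symmetric])

lemma sc_add:
  assumes "sc X \<phi>" "sc X \<psi>"
  shows "sc X (\<lambda>x. \<phi> x + \<psi> x)"
  unfolding sc_def
proof (intro conjI ballI allI impI)
  fix x y assume "x \<in> LX X" "y \<in> LX X" "x \<le> y"
  with assms show "\<phi> x + \<psi> x \<le> \<phi> y + \<psi> y"
    by (intro add_mono) (auto intro: sc_mono)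
next
  fix D assume D: "directed_in (LX X) D"
  have "(SUP d\<in>D. \<phi> d + \<psi> d) = (SUP d\<in>D. \<phi> d) + (SUP d\<in>D. \<psi> d)"
  proof (rule SUP_add_directed_ennreal)
    fix i j assume ij: "i \<in> D" "j \<in> D"
    with D obtain k where k: "k \<in> D" "i \<le> k" "j \<le> k" unfolding directed_in_def by blast
    with ij D have "\<phi> i \<le> \<phi> k" "\<psi> j \<le> \<psi> k"
      by (auto simp: directed_in_def intro!: sc_mono[OF assms(1)] sc_mono[OF assms(2)])
    with k show "\<exists>k\<in>D. \<phi> i + \<psi> j \<le> \<phi> k + \<psi> k" by (auto intro: add_mono)
  qed
  then show "\<phi> (Sup D) + \<psi> (Sup D) \<le> (SUP d\<in>D. \<phi> d + \<psi> d)"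
    by (simp add: sc_Sup[OF assms(1) D] sc_Sup[OF assms(2) D])
qed

lemma sc_chi: "openin (LX_scott X) U \<Longrightarrow> sc X (chi U)"
proof -
  assume U: "openin (LX_scott X) U"
  then have "U \<subseteq> LX X" by (simp add: openin_LX_scott)
  then have "{h \<in> LX X. r < chi U h} = (if r < 1 then U else {})" for r
    by (auto simp: chi_def)
  with U show ?thesis by (simp add: sc_iff_openin)
qed

lemma sc_cong: "(\<And>x. x \<in> LX X \<Longrightarrow> \<phi> x = \<psi> x) \<Longrightarrow> sc X \<phi> \<longleftrightarrow> sc X \<psi>"
  unfolding sc_iff_openin by (simp cong: conj_cong)

text \<open>Hoare previsions minus Scott continuity, which infima of chains do not preserve in
  general. Vanishing outside \<open>LX X\<close> makes the order of functions the pointwise order on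
  \<open>LX X\<close>.\<close>

definition sublin :: "'a topology \<Rightarrow> (('a \<Rightarrow> ennreal) \<Rightarrow> ennreal) \<Rightarrow> bool" where
  "sublin X P \<longleftrightarrow> (\<forall>h. h \<notin> LX X \<longrightarrow> P h = 0) \<and>
     (\<forall>x\<in>LX X. \<forall>y\<in>LX X. x \<le> y \<longrightarrow> P x \<le> P y) \<and>
     (\<forall>a\<ge>0. \<forall>x\<in>LX X. P (a \<odot> x) = ennreal a * P x) \<and>
     (\<forall>x\<in>LX X. \<forall>y\<in>LX X. P (x \<oplus> y) \<le> P x + P y)"

text \<open>One inequality for homogeneity suffices: applied to \<open>1 / a\<close> and
  \<open>a \<odot> x\<close> it gives the other. The factor 0 is covered by the value at the zero
  map.\<close>

lemma sublinI:
  assumes "\<And>h. h \<notin> LX X \<Longrightarrow> P h = 0"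
    and "\<And>x y. x \<in> LX X \<Longrightarrow> y \<in> LX X \<Longrightarrow> x \<le> y \<Longrightarrow> P x \<le> P y"
    and hom: "\<And>a x. 0 < a \<Longrightarrow> x \<in> LX X \<Longrightarrow> ennreal a * P x \<le> P (a \<odot> x)"
    and zero: "P (\<lambda>_. 0) = 0"
    and "\<And>x y. x \<in> LX X \<Longrightarrow> y \<in> LX X \<Longrightarrow> P (x \<oplus> y) \<le> P x + P y"
  shows "sublin X P"
proof -
  have "P (a \<odot> x) = ennreal a * P x" if "0 \<le> a" "x \<in> LX X" for a x
  proof (cases "a = 0")
    case False
    with that have a: "0 < a" by simp
    then have "ennreal (1 / a) * P (a \<odot> x) \<le> P ((1 / a) \<odot> a \<odot> x)"
      using that by (intro hom LX_smul) auto
    also have "(1 / a) \<odot> a \<odot> x = x" using a by (simp add: LX_smul_smul)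
    finally have "ennreal a * (ennreal (1 / a) * P (a \<odot> x)) \<le> ennreal a * P x"
      by (rule mult_left_mono) simp
    moreover have "ennreal a * (ennreal (1 / a) * z) = z" for z
      using a by (simp add: mult.assoc[symmetric] ennreal_mult[symmetric])
    ultimately have "P (a \<odot> x) \<le> ennreal a * P x" by simp
    with hom[OF a \<open>x \<in> LX X\<close>] show ?thesis by (rule antisym[rotated])
  qed (simp add: zero)
  with assms show ?thesis by (simp add: sublin_def)
qed

lemma
  assumes "sublin X P"
  shows sublin_outside: "h \<notin> LX X \<Longrightarrow> P h = 0"
    and sublin_mono: "x \<in> LX X \<Longrightarrow> y \<in> LX X \<Longrightarrow> x \<le> y \<Longrightarrow> P x \<le> P y"
    and sublin_smul: "0 \<le> a \<Longrightarrow> x \<in> LX X \<Longrightarrow> P (a \<odot> x) = ennreal a * P x"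
    and sublin_add: "x \<in> LX X \<Longrightarrow> y \<in> LX X \<Longrightarrow> P (x \<oplus> y) \<le> P x + P y"
  using assms by (simp_all add: sublin_def)

lemma sublin_zero: "sublin X P \<Longrightarrow> P (\<lambda>_. 0) = 0"
  using sublin_smul[of X P 0 "\<lambda>_. 0"] by simp

lemma prevision_altdef:
  "prevision X F \<longleftrightarrow> (\<forall>h. h \<notin> LX X \<longrightarrow> F h = 0) \<and> sc X F \<and> (\<forall>a\<ge>0. \<forall>h\<in>LX X. F (a \<odot> h) = ennreal a * F h)"
  by (simp add: prevision_def sc_iff_continuous)

lemma hoare_prevision_iff: "hoare_prevision X F \<longleftrightarrow> sublin X F \<and> sc X F"
  unfolding hoare_prevision_def prevision_altdef sublin_def sc_def
  by (intro iffI conjI; elim conjE; assumption)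

lemma linear_prevision_iff:
  "linear_prevision X F \<longleftrightarrow> sublin X F \<and> sc X F \<and> (\<forall>x\<in>LX X. \<forall>y\<in>LX X. F (x \<oplus> y) = F x + F y)"
  unfolding linear_prevision_def prevision_altdef sublin_def sc_def
  by (intro iffI conjI; (elim conjE; assumption)?) simp

text \<open>Freezing one index leaves a single infimum, and a finite frozen term can be moved to the
  other side; an infinite one makes the bound trivial.\<close>

lemma add_INF_bound:
  fixes f :: "'i \<Rightarrow> ennreal" and g :: "'j \<Rightarrow> ennreal"
  assumes "\<And>i j. i \<in> I \<Longrightarrow> j \<in> J \<Longrightarrow> z \<le> f i + g j"
  shows "z \<le> (INF i\<in>I. f i) + (INF j\<in>J. g j)"
proof -
  have 1: "z \<le> c + (INF i\<in>K. h i)" if "\<And>i. i \<in> K \<Longrightarrow> z \<le> c + h i" for c and h :: "'k \<Rightarrow> ennreal" and K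
  proof (cases "c = top")
    case False
    then have "z - c \<le> (INF i\<in>K. h i)"
      using that by (intro INF_greatest) (simp add: ennreal_minus_le_iff)
    with False show ?thesis by (simp add: ennreal_minus_le_iff)
  qed simp
  have "z \<le> (INF j\<in>J. g j) + f i" if "i \<in> I" for i
    using 1[of J "f i" g] assms[OF that] by (simp add: add.commute)
  then have "z \<le> (INF j\<in>J. g j) + (INF i\<in>I. f i)" by (rule 1)
  then show ?thesis by (simp only: add.commute)
qed

text \<open>The lower half of the normalization identity. If moreover \<open>P \<le> F\<close> with
  \<open>F e \<le> 1\<close> and \<open>P\<close> is sublinear, the upper half is automatic; the
  lower half is stable under infima of chains.\<close>

definition shifts :: "'a topology \<Rightarrow> ('a \<Rightarrow> ennreal) set \<Rightarrow> (('a \<Rightarrow> ennreal) \<Rightarrow> ennreal) \<Rightarrow> bool" where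
  "shifts X E P \<longleftrightarrow> (\<forall>e\<in>E. \<forall>x\<in>LX X. \<forall>a\<ge>0. P x + ennreal a \<le> P (x \<oplus> a \<odot> e))"

text \<open>The supremum ranges over all Scott-continuous functions below \<open>P\<close>, not just
  sublinear ones, so that any ad hoc candidate bounds the hull from below; sublinearity is proved
  afterwards.\<close>

definition sc_hull :: "'a topology \<Rightarrow> (('a \<Rightarrow> ennreal) \<Rightarrow> ennreal) \<Rightarrow> ('a \<Rightarrow> ennreal) \<Rightarrow> ennreal" where
  "sc_hull X P = (\<lambda>x. if x \<in> LX X then SUP \<phi>\<in>{\<phi>. sc X \<phi> \<and> (\<forall>y\<in>LX X. \<phi> y \<le> P y)}. \<phi> x else 0)"

lemma sc_sc_hull: "sc X (sc_hull X P)"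
proof -
  have "sc X (\<lambda>x. SUP \<phi>\<in>{\<phi>. sc X \<phi> \<and> (\<forall>y\<in>LX X. \<phi> y \<le> P y)}. \<phi> x)"
    by (rule sc_SUP) simp
  then show ?thesis
    by (rule sc_cong[THEN iffD1, rotated]) (simp add: sc_hull_def)
qed

lemma sc_hull_le: "sc_hull X P \<le> P"
  by (auto simp: sc_hull_def le_fun_def intro: SUP_least)

lemma sc_hull_greatest:
  "sc X \<phi> \<Longrightarrow> (\<And>y. y \<in> LX X \<Longrightarrow> \<phi> y \<le> P y) \<Longrightarrow> x \<in> LX X \<Longrightarrow> \<phi> x \<le> sc_hull X P x"
  by (auto simp: sc_hull_def intro!: SUP_upper)

text \<open>The hull is the largest Scott-continuous function below \<open>P\<close>. A rescaled or
  translated copy of it that is Scott-continuous and below \<open>P\<close> is therefore below it,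
  and each such copy gives one of the required inequalities.\<close>

lemma sublin_sc_hull:
  assumes P: "sublin X P"
  shows "sublin X (sc_hull X P)"
proof (rule sublinI)
  let ?Q = "sc_hull X P"
  note sc = sc_sc_hull[of X P]
  have le: "?Q x \<le> P x" for x using sc_hull_le[of X P] by (simp add: le_fun_def)
  show "?Q h = 0" if "h \<notin> LX X" for h using that by (simp add: sc_hull_def)
  show "?Q x \<le> ?Q y" if "x \<in> LX X" "y \<in> LX X" "x \<le> y" for x y
    using sc that by (rule sc_mono)
  show "?Q (\<lambda>_. 0) = 0"
    using le[of "\<lambda>_. 0"] sublin_zero[OF P] by simp
  show "ennreal a * ?Q x \<le> ?Q (a \<odot> x)" if a: "0 < a" and x: "x \<in> LX X" for a x
  proof -
    have "ennreal a * ?Q ((1/a) \<odot> (a \<odot> x)) \<le> ?Q (a \<odot> x)"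
    proof (rule sc_hull_greatest)
      show "sc X (\<lambda>y. ennreal a * ?Q ((1/a) \<odot> y))"
        by (intro sc_cmult sc_scale sc)
      fix y assume y: "y \<in> LX X"
      have "ennreal a * ?Q ((1/a) \<odot> y) \<le> ennreal a * P ((1/a) \<odot> y)"
        by (intro mult_left_mono le) simp
      also have "\<dots> = P (a \<odot> (1/a) \<odot> y)"
        using sublin_smul[OF P, of a "(1/a) \<odot> y"] a y by (simp add: LX_smul)
      also have "a \<odot> (1/a) \<odot> y = y" using a by (simp add: LX_smul_smul)
      finally show "ennreal a * ?Q ((1/a) \<odot> y) \<le> P y" .
    qed (use x in \<open>simp add: LX_smul\<close>)
    also have "(1/a) \<odot> (a \<odot> x) = x" using a by (simp add: LX_smul_smul)
    finally show ?thesis .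
  qed
  (* Freezing one argument at a time gives ?Q (x + y) <= ?Q x + P y, and then ?Q (x + y) <= ?Q x + ?Q y. *)
  have half: "?Q (x \<oplus> y) \<le> ?Q x + P y" if "x \<in> LX X" "y \<in> LX X" for x y
  proof (cases "P y = top")
    case False
    have "?Q (x \<oplus> y) - P y \<le> ?Q x"
    proof (rule sc_hull_greatest)
      show "sc X (\<lambda>x. ?Q (x \<oplus> y) - P y)"
        using that False by (intro sc_diff sc_translate sc)
      fix z assume "z \<in> LX X"
      with sublin_add[OF P, of z y] that le[of "z \<oplus> y"] False show "?Q (z \<oplus> y) - P y \<le> P z"
        by (simp add: ennreal_minus_le_iff add.commute)
    qed (use that in simp)
    with False show ?thesis by (simp add: ennreal_minus_le_iff add.commute)
  qed simp
  show "?Q (x \<oplus> y) \<le> ?Q x + ?Q y" if "x \<in> LX X" "y \<in> LX X" for x y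
  proof (cases "?Q x = top")
    case False
    have "?Q (y \<oplus> x) - ?Q x \<le> ?Q y"
    proof (rule sc_hull_greatest)
      show "sc X (\<lambda>y. ?Q (y \<oplus> x) - ?Q x)"
        using that False by (intro sc_diff sc_translate sc)
      fix z assume "z \<in> LX X"
      with half[of x z] that False show "?Q (z \<oplus> x) - ?Q x \<le> P z"
        by (simp add: ennreal_minus_le_iff LX_add_commute)
    qed (use that in simp)
    with False show ?thesis by (simp add: ennreal_minus_le_iff LX_add_commute)
  qed simp
qed

section \<open>A separation theorem\<close>

abbreviation LX_convex :: "'a topology \<Rightarrow> ('a \<Rightarrow> ennreal) set \<Rightarrow> bool" where
  "LX_convex X \<equiv> cone_convex (LX_scott X) LX_add LX_smul"

abbreviation LX_locally_convex :: "'a topology \<Rightarrow> bool" where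
  "LX_locally_convex X \<equiv> locally_convex_cone (LX_scott X) LX_add LX_smul"

abbreviation LX_locally_convex_compact :: "'a topology \<Rightarrow> bool" where
  "LX_locally_convex_compact X \<equiv> locally_convex_compact_cone (LX_scott X) LX_add LX_smul"

abbreviation LX_topological_cone :: "'a topology \<Rightarrow> bool" where
  "LX_topological_cone X \<equiv> topological_cone (LX_scott X) LX_add LX_smul"

lemma cone_convexD:
  assumes "LX_convex X U" "u \<in> U" "v \<in> U" "0 \<le> a" "0 \<le> b" "a + b = 1"
  shows "a \<odot> u \<oplus> b \<odot> v \<in> U"
proof -
  have b: "b = 1 - a" "a \<le> 1" using assms(4-6) by simp_all
  show ?thesis
    using assms(1-4) b(2) unfolding cone_convex_def b(1) by blast
qed

text \<open>The nonnegative multiples of a convex set are closed under addition; this is how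
  convexity of \<open>U\<close> enters the separation theorem.\<close>

lemma cone_convex_combine:
  assumes U: "LX_convex X U"
    and "u \<in> U" "u' \<in> U" "0 \<le> b" "0 \<le> b'"
  shows "\<exists>u''\<in>U. b \<odot> u \<oplus> b' \<odot> u' = (b + b') \<odot> u''"
proof (cases "b + b' = 0")
  case False
  with assms have pos: "0 < b + b'" by linarith
  have "(b / (b + b')) \<odot> u \<oplus> (b' / (b + b')) \<odot> u' \<in> U"
    using assms pos by (intro cone_convexD[OF U]) (auto simp: add_divide_distrib[symmetric])
  moreover have "(b + b') \<odot> ((b / (b + b')) \<odot> u \<oplus> (b' / (b + b')) \<odot> u') = b \<odot> u \<oplus> b' \<odot> u'"
    using pos assms by (simp add: LX_smul_add LX_smul_smul)
  ultimately show ?thesis by metis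
next
  case True
  with assms have "b = 0" "b' = 0" by linarith+
  with assms show ?thesis by auto
qed

(* The minimal elements turn out to be additive and Scott-continuous. *)
definition above :: "'a topology \<Rightarrow> ('a \<Rightarrow> ennreal) set \<Rightarrow> ('a \<Rightarrow> ennreal) set
    \<Rightarrow> (('a \<Rightarrow> ennreal) \<Rightarrow> ennreal) \<Rightarrow> (('a \<Rightarrow> ennreal) \<Rightarrow> ennreal) set" where
  "above X E U F = {P. sublin X P \<and> P \<le> F \<and> (\<forall>u\<in>U. 1 \<le> P u) \<and> shifts X E P}"

lemma above_minimal_exists:
  assumes "F \<in> above X E U F"
  obtains P where "P \<in> above X E U F" "\<And>Q. Q \<in> above X E U F \<Longrightarrow> Q \<le> P \<Longrightarrow> Q = P"
proof -
  let ?A = "above X E U F"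
  have "\<exists>P\<in>?A. \<forall>Q\<in>?A. Q \<le> P \<longrightarrow> Q = P"
  proof (rule predicate_Zorn)
    show "partial_order_on ?A (relation_of (\<lambda>a b. b \<le> a) ?A)"
      by (rule partial_order_on_relation_ofI) auto
  next
    fix C assume "C \<in> Chains (relation_of (\<lambda>a b. b \<le> a) ?A)"
    then have C: "C \<subseteq> ?A" and tot: "\<And>P Q. P \<in> C \<Longrightarrow> Q \<in> C \<Longrightarrow> P \<le> Q \<or> Q \<le> P"
      unfolding Chains_def relation_of_def by blast+
    show "\<exists>u\<in>?A. \<forall>a\<in>C. u \<le> a"
    proof (cases "C = {}")
      case False
      from False obtain P0 where P0: "P0 \<in> C" by blast
      have mem: "sublin X P" "P \<le> F" "\<And>u. u \<in> U \<Longrightarrow> 1 \<le> P u" "shifts X E P" if "P \<in> C" for P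
        using C that by (auto simp: above_def)
      have zero: "Inf C h = 0" if "P0 h = 0" for h
        using INF_lower[OF P0, of "\<lambda>P. P h"] that by simp
      have "sublin X (Inf C)"
      proof (rule sublinI)
        show "Inf C h = 0" if "h \<notin> LX X" for h
          using that sublin_outside[OF mem(1)[OF P0]] by (intro zero) simp
        show "Inf C (\<lambda>_. 0) = 0"
          using sublin_zero[OF mem(1)[OF P0]] by (intro zero)
        show "Inf C x \<le> Inf C y" if "x \<in> LX X" "y \<in> LX X" "x \<le> y" for x y
          unfolding Inf_apply by (intro INF_mono) (meson mem(1) sublin_mono that)
        show "ennreal a * Inf C x \<le> Inf C (a \<odot> x)" if "0 < a" "x \<in> LX X" for a x
          unfolding Inf_apply
        proof (rule INF_greatest)
          fix P assume P: "P \<in> C"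
          have "ennreal a * (INF P\<in>C. P x) \<le> ennreal a * P x"
            using P by (intro mult_left_mono INF_lower) auto
          with sublin_smul[OF mem(1)[OF P], of a x] that
          show "ennreal a * (INF P\<in>C. P x) \<le> P (a \<odot> x)" by simp
        qed
        show "Inf C (x \<oplus> y) \<le> Inf C x + Inf C y" if "x \<in> LX X" "y \<in> LX X" for x y
          unfolding Inf_apply
        proof (rule add_INF_bound)
          fix P Q assume PQ: "P \<in> C" "Q \<in> C"
          \<comment> \<open>Totality of the chain supplies one member below both, and subadditivity
            of that member bounds the mixed sum.\<close>
          obtain R where R: "R \<in> C" "R \<le> P" "R \<le> Q" using tot[OF PQ] PQ by blast
          have "(INF P\<in>C. P (x \<oplus> y)) \<le> R (x \<oplus> y)" by (rule INF_lower[OF R(1)])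
          also have "\<dots> \<le> R x + R y" using sublin_add[OF mem(1)[OF R(1)] that] .
          also have "\<dots> \<le> P x + Q y" using R by (intro add_mono) (auto simp: le_fun_def)
          finally show "(INF P\<in>C. P (x \<oplus> y)) \<le> P x + Q y" .
        qed
      qed
      moreover have "Inf C \<le> F"
        by (rule Inf_lower2[OF P0 mem(2)[OF P0]])
      moreover have "1 \<le> Inf C u" if "u \<in> U" for u
        unfolding Inf_apply by (intro INF_greatest mem(3) that)
      moreover have "shifts X E (Inf C)"
        unfolding shifts_def Inf_apply
      proof (intro ballI allI impI INF_greatest)
        fix e x P and a :: real assume h: "e \<in> E" "x \<in> LX X" "0 \<le> a" "P \<in> C"
        have "(INF P\<in>C. P x) + ennreal a \<le> P x + ennreal a"
          by (intro add_right_mono INF_lower h)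
        also have "\<dots> \<le> P (x \<oplus> a \<odot> e)"
          using mem(4)[OF h(4)] h by (simp add: shifts_def)
        finally show "(INF P\<in>C. P x) + ennreal a \<le> P (x \<oplus> a \<odot> e)" .
      qed
      ultimately have "Inf C \<in> ?A" by (simp add: above_def)
      then show ?thesis by (intro bexI[of _ "Inf C"] ballI Inf_lower)
    qed (use assms in blast)
  qed
  with that show ?thesis by blast
qed

text \<open>\<open>Q\<close> below is a Hahn-Banach auxiliary functional: closure of
  \<open>W\<close> under sums and multiples makes it sublinear, \<open>Wle\<close> keeps the
  subtractions from truncating, \<open>WU\<close> keeps it at least 1 on \<open>U\<close>, and the
  zero pair puts it below \<open>P\<close>. Minimality gives \<open>Q = P\<close>, and the claim is
  then one of the bounds defining \<open>Q\<close>.\<close>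

lemma above_minimal_superadd:
  assumes P: "P \<in> above X E U F" and min: "\<And>Q. Q \<in> above X E U F \<Longrightarrow> Q \<le> P \<Longrightarrow> Q = P"
    and U: "U \<subseteq> LX X" and E: "E \<subseteq> LX X"
    and W: "W \<subseteq> LX X \<times> {..<top}" and W0: "((\<lambda>_. 0), 0) \<in> W"
    and Wadd: "\<And>w c w' c'. (w, c) \<in> W \<Longrightarrow> (w', c') \<in> W \<Longrightarrow> (w \<oplus> w', c + c') \<in> W"
    and Wsmul: "\<And>w c a. (w, c) \<in> W \<Longrightarrow> 0 < a \<Longrightarrow> (a \<odot> w, ennreal a * c) \<in> W"
    and Wle: "\<And>w c. (w, c) \<in> W \<Longrightarrow> c \<le> P w"
    and WU: "\<And>w c u. (w, c) \<in> W \<Longrightarrow> u \<in> U \<Longrightarrow> 1 + c \<le> P (u \<oplus> w)"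
    and w: "(w, c) \<in> W" and x: "x \<in> LX X"
  shows "P x + c \<le> P (x \<oplus> w)"
proof -
  have sub: "sublin X P" and PF: "P \<le> F" and P1: "\<And>u. u \<in> U \<Longrightarrow> 1 \<le> P u" and sh: "shifts X E P"
    using P by (auto simp: above_def)
  have WD: "w \<in> LX X" "c \<noteq> top" if "(w, c) \<in> W" for w c
    using W that by auto
  have cle: "c \<le> P (x \<oplus> w)" if "(w, c) \<in> W" "x \<in> LX X" for w c x
  proof -
    have "c \<le> P w" by (rule Wle[OF that(1)])
    also have "\<dots> \<le> P (x \<oplus> w)"
      using that WD(1)[OF that(1)] by (intro sublin_mono[OF sub] LX_add LX_le_add)
    finally show ?thesis .
  qed
  define Q where "Q = (\<lambda>x. if x \<in> LX X then INF (w,c)\<in>W. P (x \<oplus> w) - c else 0)"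
  have Qle: "Q x \<le> P (x \<oplus> w) - c" if "(w, c) \<in> W" "x \<in> LX X" for x w c
    using INF_lower[OF that(1), of "\<lambda>(w,c). P (x \<oplus> w) - c"] that(2) by (simp add: Q_def)
  have Qge: "z \<le> Q x" if "x \<in> LX X" "\<And>w c. (w, c) \<in> W \<Longrightarrow> z + c \<le> P (x \<oplus> w)" for z x
  proof -
    have "z \<le> (INF (w,c)\<in>W. P (x \<oplus> w) - c)"
    proof (rule INF_greatest, clarify)
      fix w c assume "(w, c) \<in> W"
      then have "z + c \<le> P (x \<oplus> w)" by (rule that(2))
      then show "z \<le> P (x \<oplus> w) - c" unfolding ennreal_le_minus_iff by blast
    qed
    with that(1) show ?thesis by (simp add: Q_def)
  qed
  have QaddP: "Q x + c \<le> P (x \<oplus> w)" if "(w, c) \<in> W" "x \<in> LX X" for x w c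
  proof -
    have "Q x + c \<le> (P (x \<oplus> w) - c) + c"
      by (intro add_right_mono Qle that)
    also have "\<dots> = P (x \<oplus> w)" by (rule diff_add_cancel_ennreal[OF cle[OF that]])
    finally show ?thesis .
  qed
  have QP: "Q x \<le> P x" for x
    using Qle[OF W0, of x] by (cases "x \<in> LX X") (auto simp: Q_def)
  have "sublin X Q"
  proof (rule sublinI)
    show "Q h = 0" if "h \<notin> LX X" for h using that by (simp add: Q_def)
    show "Q (\<lambda>_. 0) = 0" using QP[of "\<lambda>_. 0"] sublin_zero[OF sub] by simp
    show "Q y \<le> Q z" if yz: "y \<in> LX X" "z \<in> LX X" "y \<le> z" for y z
    proof (rule Qge[OF yz(2)])
      fix w c assume w: "(w, c) \<in> W"
      have "Q y + c \<le> P (y \<oplus> w)" by (rule QaddP[OF w yz(1)])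
      also have "\<dots> \<le> P (z \<oplus> w)"
        using yz WD[OF w] by (intro sublin_mono[OF sub] LX_add LX_add_mono) auto
      finally show "Q y + c \<le> P (z \<oplus> w)" .
    qed
    show "ennreal a * Q y \<le> Q (a \<odot> y)" if a: "0 < a" and y: "y \<in> LX X" for a y
    proof (rule Qge[OF LX_smul[OF y]])
      fix w c assume w: "(w, c) \<in> W"
      have inv: "ennreal a * (ennreal (1/a) * t) = t" "a \<odot> (1/a) \<odot> w = w" for t
        using a by (simp_all add: mult.assoc[symmetric] ennreal_mult[symmetric] LX_smul_smul)
      have "Q y + ennreal (1/a) * c \<le> P (y \<oplus> (1/a) \<odot> w)"
        using a by (intro QaddP Wsmul w y) auto
      then have "ennreal a * (Q y + ennreal (1/a) * c) \<le> ennreal a * P (y \<oplus> (1/a) \<odot> w)"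
        by (rule mult_left_mono) simp
      also have "\<dots> = P (a \<odot> (y \<oplus> (1/a) \<odot> w))"
        using sublin_smul[OF sub, of a "y \<oplus> (1/a) \<odot> w"] a y WD[OF w] by (simp add: LX_add LX_smul)
      finally show "ennreal a * Q y + c \<le> P (a \<odot> y \<oplus> w)"
        by (simp add: distrib_left inv LX_smul_add)
    qed
    show "Q (y \<oplus> z) \<le> Q y + Q z" if yz: "y \<in> LX X" "z \<in> LX X" for y z
    proof -
      have "Q (y \<oplus> z) \<le> (INF (w,c)\<in>W. P (y \<oplus> w) - c) + (INF (w,c)\<in>W. P (z \<oplus> w) - c)"
      proof (rule add_INF_bound, clarify)
        fix w c w' c' assume ww: "(w, c) \<in> W" "(w', c') \<in> W"
        \<comment> \<open>Splitting off \<open>c\<close> and \<open>c'\<close> avoids truncated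
          subtraction: the differences become the remainders \<open>p\<close> and
          \<open>q\<close>.\<close>
        obtain p where p: "P (y \<oplus> w) = c + p" using cle[OF ww(1) yz(1)] by (auto simp: le_iff_add)
        obtain q where q: "P (z \<oplus> w') = c' + q" using cle[OF ww(2) yz(2)] by (auto simp: le_iff_add)
        have "Q (y \<oplus> z) \<le> P ((y \<oplus> z) \<oplus> (w \<oplus> w')) - (c + c')"
          by (intro Qle Wadd ww LX_add yz)
        also have "(y \<oplus> z) \<oplus> (w \<oplus> w') = (y \<oplus> w) \<oplus> (z \<oplus> w')"
          by (simp add: LX_add_ac)
        also have "P \<dots> - (c + c') \<le> (P (y \<oplus> w) + P (z \<oplus> w')) - (c + c')"
          using yz WD[OF ww(1)] WD[OF ww(2)] by (intro ennreal_minus_mono sublin_add[OF sub] LX_add) auto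
        also have "\<dots> = ((c + c') + (p + q)) - (c + c')" by (simp add: p q add_ac)
        also have "\<dots> = p + q"
          using WD[OF ww(1)] WD[OF ww(2)] by (intro ennreal_add_diff_cancel_left) auto
        also have "\<dots> = (P (y \<oplus> w) - c) + (P (z \<oplus> w') - c')"
          using WD[OF ww(1)] WD[OF ww(2)] by (simp add: p q)
        finally show "Q (y \<oplus> z) \<le> P (y \<oplus> w) - c + (P (z \<oplus> w') - c')" .
      qed
      with yz show ?thesis by (simp add: Q_def)
    qed
  qed
  moreover have "Q \<le> F"
    using QP PF by (meson le_fun_def order_trans)
  moreover have "1 \<le> Q u" if "u \<in> U" for u
    using that U by (intro Qge WU) auto
  moreover have "shifts X E Q"
    unfolding shifts_def
  proof (intro ballI allI impI)
    fix e y and a :: real assume h: "e \<in> E" "y \<in> LX X" "0 \<le> a"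
    show "Q y + ennreal a \<le> Q (y \<oplus> a \<odot> e)"
    proof (rule Qge)
      fix w c assume w: "(w, c) \<in> W"
      have "Q y + ennreal a + c = (Q y + c) + ennreal a" by (simp add: add_ac)
      also have "\<dots> \<le> P (y \<oplus> w) + ennreal a"
        by (intro add_right_mono QaddP w h)
      also have "\<dots> \<le> P ((y \<oplus> w) \<oplus> a \<odot> e)"
        using sh h WD[OF w] by (simp add: shifts_def LX_add)
      finally show "Q y + ennreal a + c \<le> P ((y \<oplus> a \<odot> e) \<oplus> w)" by (simp add: LX_add_ac)
    qed (use h E in \<open>auto intro: LX_add LX_smul\<close>)
  qed
  ultimately have "Q \<in> above X E U F" by (simp add: above_def)
  moreover have "Q \<le> P" using QP by (simp add: le_fun_def)
  ultimately have "Q = P" by (rule min)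
  with QaddP[OF w x] show ?thesis by simp
qed

text \<open>Superadditivity comes in two rounds. The cone over \<open>U\<close> gives
  \<open>P x + 1 \<le> P (x \<oplus> u)\<close>, and this is what keeps the auxiliary functional at
  least 1 on \<open>U\<close> when the ray through an arbitrary \<open>y\<close> is used next.
  Openness of \<open>U\<close> makes \<open>chi U\<close> Scott-continuous, so the hull stays at
  least 1 on \<open>U\<close> and minimality makes \<open>P\<close> equal to its hull.\<close>

theorem separation:
  assumes F: "sublin X F" and U: "openin (LX_scott X) U" "LX_convex X U"
    and ne: "U \<noteq> {}" and UF: "\<And>u. u \<in> U \<Longrightarrow> 1 \<le> F u"
    and E: "E \<subseteq> LX X" and FE: "shifts X E F"
    and hull: "\<And>P. sublin X P \<Longrightarrow> shifts X E P \<Longrightarrow> shifts X E (sc_hull X P)"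
  obtains G where "linear_prevision X G" "G \<le> F" "\<And>u. u \<in> U \<Longrightarrow> 1 \<le> G u" "shifts X E G"
proof -
  have ULX: "U \<subseteq> LX X" using U(1) by (simp add: openin_LX_scott)
  have "F \<in> above X E U F" using F FE UF by (simp add: above_def)
  from above_minimal_exists[OF this] obtain P where P: "P \<in> above X E U F"
    and min: "\<And>Q. Q \<in> above X E U F \<Longrightarrow> Q \<le> P \<Longrightarrow> Q = P" by metis
  have sub: "sublin X P" and PF: "P \<le> F" and P1: "\<And>u. u \<in> U \<Longrightarrow> 1 \<le> P u" and sh: "shifts X E P"
    using P by (auto simp: above_def)
  note superadd = above_minimal_superadd[OF P min ULX E]
  have smul1: "ennreal b \<le> P (b \<odot> u)" if "u \<in> U" "0 \<le> b" for u b
  proof -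
    have "ennreal b * 1 \<le> ennreal b * P u" by (intro mult_left_mono P1 that) simp
    with that ULX sublin_smul[OF sub, of b u] show ?thesis by auto
  qed
  note combine = cone_convex_combine[OF U(2)]
  have addU: "P x + 1 \<le> P (x \<oplus> u)" if "u \<in> U" "x \<in> LX X" for x u
  proof (rule superadd[where W = "{(b \<odot> u, ennreal b) | b u. 0 \<le> b \<and> u \<in> U}"])
    let ?W = "{(b \<odot> u, ennreal b) | b u. 0 \<le> b \<and> u \<in> U}"
    show "?W \<subseteq> LX X \<times> {..<top}"
      using ULX by (auto intro: LX_smul simp: ennreal_less_top)
    obtain u0 where "u0 \<in> U" using ne by blast
    then show "(\<lambda>_. 0, 0) \<in> ?W"
      by (intro CollectI exI[of _ 0] exI[of _ u0]) simp
    show "(w \<oplus> w', c + c') \<in> ?W" if "(w, c) \<in> ?W" "(w', c') \<in> ?W" for w c w' c'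
    proof -
      from that obtain b u b' u' where *: "w = b \<odot> u" "c = ennreal b" "0 \<le> b" "u \<in> U"
        "w' = b' \<odot> u'" "c' = ennreal b'" "0 \<le> b'" "u' \<in> U" by blast
      then obtain u'' where "u'' \<in> U" "w \<oplus> w' = (b + b') \<odot> u''" using combine by metis
      with * show ?thesis
        by (intro CollectI exI[of _ "b + b'"] exI[of _ u'']) (simp add: ennreal_plus)
    qed
    show "(a \<odot> w, ennreal a * c) \<in> ?W" if "(w, c) \<in> ?W" "0 < a" for w c a
    proof -
      from that obtain b u where *: "w = b \<odot> u" "c = ennreal b" "0 \<le> b" "u \<in> U" by blast
      with that(2) show ?thesis
        by (intro CollectI exI[of _ "a * b"] exI[of _ u]) (simp add: LX_smul_smul ennreal_mult)
    qed
    show "c \<le> P w" if "(w, c) \<in> ?W" for w c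
      using that smul1 by auto
    show "1 + c \<le> P (u \<oplus> w)" if "(w, c) \<in> ?W" "u \<in> U" for w c u
    proof -
      from that obtain b u' where *: "w = b \<odot> u'" "c = ennreal b" "0 \<le> b" "u' \<in> U" by blast
      obtain u'' where "u'' \<in> U" "1 \<odot> u \<oplus> b \<odot> u' = (1 + b) \<odot> u''"
        using combine[OF \<open>u \<in> U\<close> *(4), of 1 b] *(3) by auto
      with smul1[of u'' "1 + b"] * show ?thesis by (simp add: ennreal_plus)
    qed
    show "(u, 1) \<in> ?W" using that(1)
      by (intro CollectI exI[of _ 1] exI[of _ u]) simp
  qed (use that in auto)
  have superadd': "P x + P y \<le> P (x \<oplus> y)" if x: "x \<in> LX X" and y: "y \<in> LX X" for x y
  \<comment> \<open>The second components of \<open>W\<close> must be finite; an infinite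
    \<open>P y\<close> is settled by monotonicity.\<close>
  proof (cases "P y = top")
    case False
    show ?thesis
    proof (rule superadd[where W = "{(b \<odot> y, ennreal b * P y) | b. 0 \<le> b}"])
      let ?W = "{(b \<odot> y, ennreal b * P y) | b. 0 \<le> b}"
      show "?W \<subseteq> LX X \<times> {..<top}"
        using y False by (auto intro: LX_smul simp: ennreal_mult_eq_top_iff less_top[symmetric])
      show "(\<lambda>_. 0, 0) \<in> ?W" by (intro CollectI exI[of _ 0]) simp
      show "(w \<oplus> w', c + c') \<in> ?W" if "(w, c) \<in> ?W" "(w', c') \<in> ?W" for w c w' c'
      proof -
        from that obtain b b' where *: "w = b \<odot> y" "c = ennreal b * P y" "0 \<le> b"
          "w' = b' \<odot> y" "c' = ennreal b' * P y" "0 \<le> b'" by blast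
        then show ?thesis
          by (intro CollectI exI[of _ "b + b'"]) (simp add: ennreal_plus LX_add_smul distrib_right)
      qed
      show "(a \<odot> w, ennreal a * c) \<in> ?W" if "(w, c) \<in> ?W" "0 < a" for w c a
      proof -
        from that obtain b where *: "w = b \<odot> y" "c = ennreal b * P y" "0 \<le> b" by blast
        with that(2) show ?thesis
          by (intro CollectI exI[of _ "a * b"]) (simp add: LX_smul_smul ennreal_mult mult.assoc)
      qed
      show "c \<le> P w" if "(w, c) \<in> ?W" for w c
        using that sublin_smul[OF sub _ y] by auto
      show "1 + c \<le> P (u \<oplus> w)" if "(w, c) \<in> ?W" "u \<in> U" for w c u
      proof -
        from that obtain b where *: "w = b \<odot> y" "c = ennreal b * P y" "0 \<le> b" by blast
        have "P w + 1 \<le> P (w \<oplus> u)" unfolding *(1) by (intro addU LX_smul y \<open>u \<in> U\<close>)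
        with * sublin_smul[OF sub _ y, of b] show ?thesis by (simp add: add.commute LX_add_commute)
      qed
      show "(y, P y) \<in> ?W" by (intro CollectI exI[of _ 1]) simp
    qed (use x in auto)
  next
    case True
    have "P y \<le> P (x \<oplus> y)" using x y by (intro sublin_mono[OF sub] LX_add LX_le_add) auto
    with True show ?thesis by (simp add: top_unique)
  qed
  have "sc_hull X P \<in> above X E U F"
    unfolding above_def
  proof (intro CollectI conjI ballI)
    show "sublin X (sc_hull X P)" by (rule sublin_sc_hull[OF sub])
    show "sc_hull X P \<le> F" using sc_hull_le PF by (rule order_trans)
    show "shifts X E (sc_hull X P)" by (rule hull[OF sub sh])
    fix u assume u: "u \<in> U"
    have "chi U u \<le> sc_hull X P u"
      using P1 u ULX by (intro sc_hull_greatest sc_chi U(1)) (auto simp: chi_def)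
    with u show "1 \<le> sc_hull X P u" by (simp add: chi_def)
  qed
  then have "sc_hull X P = P" by (rule min) (rule sc_hull_le)
  with sc_sc_hull have "sc X P" by metis
  with sub superadd' have "linear_prevision X P"
    by (auto simp: linear_prevision_iff intro: antisym sublin_add)
  with that PF P1 sh show thesis by blast
qed

section \<open>Two minimax lemmas\<close>

text \<open>\<open>convex_prev_set\<close> over an arbitrary index type, for sets of previsions as
  well as for sets of vectors of values.\<close>

definition fconv :: "('i \<Rightarrow> ennreal) set \<Rightarrow> bool" where
  "fconv S \<longleftrightarrow> (\<forall>f\<in>S. \<forall>g\<in>S. \<forall>t::real. 0 \<le> t \<and> t \<le> 1 \<longrightarrow> (\<lambda>i. ennreal t * f i + ennreal (1 - t) * g i) \<in> S)"

text \<open>The separating normal has nonnegative entries because the quadrant is unbounded in both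
  directions. Divided by the sum of its entries it becomes a weight \<open>c\<close>; points of the
  quadrant tending to the corner \<open>(1, 1)\<close> bound the level by that sum.\<close>

lemma separate_quadrant_gt:
  fixes S :: "(real \<times> real) set"
  assumes "convex S" and le: "\<And>x y. (x, y) \<in> S \<Longrightarrow> x \<le> 1 \<or> y \<le> 1"
  shows "\<exists>c. 0 \<le> c \<and> c \<le> 1 \<and> (\<forall>(x, y)\<in>S. c * x + (1 - c) * y \<le> 1)"
proof (cases "S = {}")
  case False
  let ?T = "{1<..} \<times> {1<..} :: (real \<times> real) set"
  have "convex ?T" by (intro convex_Times convex_real_interval)
  moreover have "(2, 2) \<in> ?T" by simp
  then have "?T \<noteq> {}" by blast
  moreover have "S \<inter> ?T = {}" using le by fastforce
  ultimately obtain v b where v: "v \<noteq> 0" "\<And>z. z \<in> S \<Longrightarrow> v \<bullet> z \<le> b" "\<And>z. z \<in> ?T \<Longrightarrow> b \<le> v \<bullet> z"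
    using separating_hyperplane_sets[OF assms(1)] False by metis
  obtain p q where pq: "v = (p, q)" by (cases v)
  have T: "b \<le> p * x + q * y" if "1 < x" "1 < y" for x y
    using v(3)[of "(x, y)"] that by (simp add: pq)
  have p: "0 \<le> p"
  proof (rule ccontr)
    assume "\<not> 0 \<le> p"
    \<comment> \<open>The first coordinate is so large that its negative term outweighs both
      \<open>b\<close> and the fixed second term.\<close>
    then have "b \<le> p * (2 + (\<bar>b\<bar> + \<bar>q * 2\<bar> + 1) / (-p)) + q * 2" by (intro T) auto
    also have "\<dots> = 2 * p - \<bar>b\<bar> - \<bar>q * 2\<bar> - 1 + q * 2" using \<open>\<not> 0 \<le> p\<close> by (simp add: field_simps)
    finally show False using \<open>\<not> 0 \<le> p\<close> by linarith
  qed
  have q: "0 \<le> q"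
  proof (rule ccontr)
    assume "\<not> 0 \<le> q"
    then have "b \<le> p * 2 + q * (2 + (\<bar>b\<bar> + \<bar>p * 2\<bar> + 1) / (-q))" by (intro T) auto
    also have "\<dots> = 2 * q - \<bar>b\<bar> - \<bar>p * 2\<bar> - 1 + p * 2" using \<open>\<not> 0 \<le> q\<close> by (simp add: field_simps)
    finally show False using \<open>\<not> 0 \<le> q\<close> by linarith
  qed
  have pos: "0 < p + q" using v(1) p q by (auto simp: pq zero_prod_def)
  have "b \<le> p + q"
  proof (rule field_le_epsilon)
    fix e :: real assume "0 < e"
    then have "b \<le> p * (1 + e / (p + q)) + q * (1 + e / (p + q))" using pos \<open>0 < e\<close> by (intro T) auto
    also have "\<dots> = p + q + (p + q) * (e / (p + q))" by (simp only: distrib_left distrib_right mult_1_right add_ac)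
    also have "\<dots> = p + q + e" using pos by simp
    finally show "b \<le> p + q + e" .
  qed
  have "p / (p + q) * x + (1 - p / (p + q)) * y \<le> 1" if "(x, y) \<in> S" for x y
  proof -
    have "1 - p / (p + q) = q / (p + q)" using pos by (simp add: field_simps)
    then have "p / (p + q) * x + (1 - p / (p + q)) * y = (p * x + q * y) / (p + q)"
      by (simp add: add_divide_distrib)
    also have "\<dots> \<le> 1" using v(2)[OF that] \<open>b \<le> p + q\<close> pos by (simp add: pq)
    finally show ?thesis .
  qed
  with p q pos show ?thesis by (intro exI[of _ "p / (p + q)"]) auto
next
  case True
  then show ?thesis by (intro exI[of _ 0]) simp
qed

text \<open>The point reflection \<open>?f\<close> carries the quadrant below \<open>(s, s)\<close>
  to the quadrant above \<open>(1, 1)\<close>.\<close>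

lemma separate_quadrant_lt:
  fixes S :: "(real \<times> real) set"
  assumes "convex S" and le: "\<And>x y. (x, y) \<in> S \<Longrightarrow> s \<le> x \<or> s \<le> y"
  shows "\<exists>c. 0 \<le> c \<and> c \<le> 1 \<and> (\<forall>(x, y)\<in>S. s \<le> c * x + (1 - c) * y)"
proof -
  let ?f = "\<lambda>z :: real \<times> real. (1 + s, 1 + s) - z"
  have "convex (?f ` S)"
  proof -
    have "?f ` S = (\<lambda>z. (1 + s, 1 + s) + z) ` ((\<lambda>z. -1 *\<^sub>R z) ` S)" by (auto simp: image_image)
    then show ?thesis using convex_translation[OF convex_scaling[OF assms(1), of "-1"], of "(1 + s, 1 + s)"] by simp
  qed
  moreover have "x \<le> 1 \<or> y \<le> 1" if "(x, y) \<in> ?f ` S" for x y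
    using that le by force
  ultimately obtain c where c: "0 \<le> c" "c \<le> 1" "\<And>x y. (x, y) \<in> ?f ` S \<Longrightarrow> c * x + (1 - c) * y \<le> 1"
    using separate_quadrant_gt[of "?f ` S"] by blast
  have "s \<le> c * x + (1 - c) * y" if "(x, y) \<in> S" for x y
  proof -
    have "c * (1 + s - x) + (1 - c) * (1 + s - y) \<le> 1" using that by (intro c) force
    then show ?thesis by (simp add: algebra_simps)
  qed
  with c show ?thesis by blast
qed

text \<open>An infinite \<open>A\<close> admits arbitrarily large \<open>x\<close>, which forces
  \<open>c = 0\<close>, and \<open>0 * top = 0\<close>; likewise for \<open>B\<close>. Finite values
  are themselves admissible real bounds.\<close>

lemma ennreal_combine_le_real:
  assumes "\<And>x y. 0 \<le> x \<Longrightarrow> 0 \<le> y \<Longrightarrow> ennreal x \<le> A \<Longrightarrow> ennreal y \<le> B \<Longrightarrow> c * x + d * y \<le> 1"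
    and c: "0 \<le> c" "0 \<le> d"
  shows "ennreal c * A + ennreal d * B \<le> 1"
proof -
  have fin: "ennreal c * ennreal x + ennreal d * ennreal y \<le> 1"
    if "0 \<le> x" "0 \<le> y" "ennreal x \<le> A" "ennreal y \<le> B" for x y
    using assms(1)[OF that] that c by (simp add: ennreal_mult[symmetric] ennreal_plus[symmetric] del: ennreal_plus)
  have top0: "e = 0" if "0 \<le> e" "\<And>x. 0 \<le> x \<Longrightarrow> e * x \<le> 1" for e :: real
  proof (rule ccontr)
    assume "e \<noteq> 0"
    with that(1) have "e * (2 / e) = 2" "0 \<le> 2 / e" by auto
    with that(2)[of "2 / e"] show False by simp
  qed
  have "c = 0" if "A = top"
    using assms(1)[of _ 0] that by (intro top0 c) simp
  moreover have "d = 0" if "B = top"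
    using assms(1)[of 0] that by (intro top0 c) simp
  ultimately show ?thesis
    by (cases A; cases B; use fin[of "enn2real A" "enn2real B"] fin[of "enn2real A" 0] fin[of 0 "enn2real B"] in auto)
qed

text \<open>Separation takes place in the real plane, so \<open>S\<close> is replaced by the set
  \<open>R\<close> of real points dominated by it; infinite coordinates then appear as unboundedness
  of \<open>R\<close>.\<close>

lemma minimax2_le:
  fixes S :: "(ennreal \<times> ennreal) set"
  assumes conv: "\<And>a b a' b' t. (a, b) \<in> S \<Longrightarrow> (a', b') \<in> S \<Longrightarrow> 0 \<le> t \<Longrightarrow> t \<le> 1 \<Longrightarrow>
      (ennreal t * a + ennreal (1 - t) * a', ennreal t * b + ennreal (1 - t) * b') \<in> S"
    and le: "\<And>a b. (a, b) \<in> S \<Longrightarrow> a \<le> 1 \<or> b \<le> 1"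
  shows "\<exists>c. 0 \<le> c \<and> c \<le> 1 \<and> (\<forall>(a, b)\<in>S. ennreal c * a + ennreal (1 - c) * b \<le> 1)"
proof -
  define R where "R = {(x, y). 0 \<le> x \<and> 0 \<le> y \<and> (\<exists>(a, b)\<in>S. ennreal x \<le> a \<and> ennreal y \<le> b)}"
  have R_iff: "(x, y) \<in> R \<longleftrightarrow> 0 \<le> x \<and> 0 \<le> y \<and> (\<exists>a b. (a, b) \<in> S \<and> ennreal x \<le> a \<and> ennreal y \<le> b)" for x y
    unfolding R_def by blast
  have convR: "convex R"
  proof (rule convexI)
    fix z z' and u v :: real assume z: "z \<in> R" "z' \<in> R" and uv: "0 \<le> u" "0 \<le> v" "u + v = 1"
    have v: "v = 1 - u" "u \<le> 1" using uv by linarith+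
    obtain x y a b where 1: "z = (x, y)" "0 \<le> x" "0 \<le> y" "(a, b) \<in> S" "ennreal x \<le> a" "ennreal y \<le> b"
      using z(1) by (cases z) (auto simp: R_iff)
    obtain x' y' a' b' where 2: "z' = (x', y')" "0 \<le> x'" "0 \<le> y'" "(a', b') \<in> S" "ennreal x' \<le> a'" "ennreal y' \<le> b'"
      using z(2) by (cases z') (auto simp: R_iff)
    have *: "ennreal (u * x + v * x') \<le> ennreal u * a + ennreal v * a'"
      if "0 \<le> x" "0 \<le> x'" "ennreal x \<le> a" "ennreal x' \<le> a'" for x x' a a'
    proof -
      have "ennreal (u * x + v * x') = ennreal u * ennreal x + ennreal v * ennreal x'"
        using that(1,2) uv(1,2) by (simp add: ennreal_mult)
      also have "\<dots> \<le> ennreal u * a + ennreal v * a'"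
        by (intro add_mono mult_left_mono that) simp_all
      finally show ?thesis .
    qed
    have "(ennreal u * a + ennreal v * a', ennreal u * b + ennreal v * b') \<in> S"
      unfolding v(1) by (intro conv 1 2 uv v)
    moreover have "ennreal (u * x + v * x') \<le> ennreal u * a + ennreal v * a'"
      "ennreal (u * y + v * y') \<le> ennreal u * b + ennreal v * b'"
      by (intro * 1 2)+
    moreover have "0 \<le> u * x + v * x'" "0 \<le> u * y + v * y'" using 1 2 uv by simp_all
    ultimately show "u *\<^sub>R z + v *\<^sub>R z' \<in> R"
      unfolding 1(1) 2(1) by (auto simp: R_iff)
  qed
  have leR: "x \<le> 1 \<or> y \<le> 1" if xy: "(x, y) \<in> R" for x y
  proof -
    obtain a b where *: "(a, b) \<in> S" "ennreal x \<le> a" "ennreal y \<le> b" using xy unfolding R_iff by blast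
    have "ennreal x \<le> 1 \<or> ennreal y \<le> 1"
      using le[OF *(1)] order_trans[OF *(2)] order_trans[OF *(3)] by blast
    then show ?thesis by simp
  qed
  obtain c where c: "0 \<le> c" "c \<le> 1" "\<And>x y. (x, y) \<in> R \<Longrightarrow> c * x + (1 - c) * y \<le> 1"
    using separate_quadrant_gt[OF convR leR] by blast
  have "ennreal c * a + ennreal (1 - c) * b \<le> 1" if "(a, b) \<in> S" for a b
  proof (rule ennreal_combine_le_real)
    fix x y :: real assume "0 \<le> x" "0 \<le> y" "ennreal x \<le> a" "ennreal y \<le> b"
    with that have "(x, y) \<in> R" unfolding R_iff by blast
    then show "c * x + (1 - c) * y \<le> 1" by (rule c(3))
  qed (use c(1,2) in auto)
  with c(1,2) show ?thesis by blast
qed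

text \<open>No real point dominates a point with an infinite coordinate, so \<open>R\<close> keeps
  the finite points only. The others require both weights to be positive, and the slack between
  \<open>r\<close> and \<open>s\<close> pays for moving the weight away from 0 and 1.\<close>

lemma minimax2_ge:
  fixes S :: "(ennreal \<times> ennreal) set"
  assumes conv: "\<And>a b a' b' t. (a, b) \<in> S \<Longrightarrow> (a', b') \<in> S \<Longrightarrow> 0 \<le> t \<Longrightarrow> t \<le> 1 \<Longrightarrow>
      (ennreal t * a + ennreal (1 - t) * a', ennreal t * b + ennreal (1 - t) * b') \<in> S"
    and ge: "\<And>a b. (a, b) \<in> S \<Longrightarrow> ennreal s \<le> a \<or> ennreal s \<le> b" and rs: "0 < r" "r < s"
  shows "\<exists>c. 0 \<le> c \<and> c \<le> 1 \<and> (\<forall>(a, b)\<in>S. ennreal r \<le> ennreal c * a + ennreal (1 - c) * b)"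
proof -
  define R where "R = {(x, y). 0 \<le> x \<and> 0 \<le> y \<and> (ennreal x, ennreal y) \<in> S}"
  have R_iff: "(x, y) \<in> R \<longleftrightarrow> 0 \<le> x \<and> 0 \<le> y \<and> (ennreal x, ennreal y) \<in> S" for x y
    unfolding R_def by blast
  have convR: "convex R"
  proof (rule convexI)
    fix z z' and u v :: real assume z: "z \<in> R" "z' \<in> R" and uv: "0 \<le> u" "0 \<le> v" "u + v = 1"
    have v: "v = 1 - u" "u \<le> 1" using uv by linarith+
    obtain x y where 1: "z = (x, y)" "0 \<le> x" "0 \<le> y" "(ennreal x, ennreal y) \<in> S"
      using z(1) by (cases z) (auto simp: R_iff)
    obtain x' y' where 2: "z' = (x', y')" "0 \<le> x'" "0 \<le> y'" "(ennreal x', ennreal y') \<in> S"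
      using z(2) by (cases z') (auto simp: R_iff)
    have "(ennreal u * ennreal x + ennreal v * ennreal x', ennreal u * ennreal y + ennreal v * ennreal y') \<in> S"
      unfolding v(1) by (intro conv 1 2 uv v)
    then show "u *\<^sub>R z + v *\<^sub>R z' \<in> R"
      using 1 2 uv by (simp add: R_iff ennreal_mult[symmetric] ennreal_plus[symmetric] del: ennreal_plus)
  qed
  have leR: "s \<le> x \<or> s \<le> y" if xy: "(x, y) \<in> R" for x y
    using ge[of "ennreal x" "ennreal y"] xy rs by (auto simp: R_iff)
  obtain c where c: "0 \<le> c" "c \<le> 1" "\<And>x y. (x, y) \<in> R \<Longrightarrow> s \<le> c * x + (1 - c) * y"
    using separate_quadrant_lt[OF convR leR] by blast
  (* Pushing c into the open interval (0, 1) makes the combination infinite at infinite points. *)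
  define e where "e = (1 - r / s) / 2"
  have e: "0 < e" "e < 1 / 2" and rse: "r = (1 - 2 * e) * s" using rs by (auto simp: e_def field_simps)
  define d where "d = (1 - 2 * e) * c + e"
  have d1: "1 - d = (1 - 2 * e) * (1 - c) + e" by (simp add: d_def algebra_simps)
  have pos: "0 < d" "0 < 1 - d"
    unfolding d1 unfolding d_def using c(1,2) e by (auto intro!: add_nonneg_pos)
  have "ennreal r \<le> ennreal d * a + ennreal (1 - d) * b" if ab: "(a, b) \<in> S" for a b
  proof (cases "a = top \<or> b = top")
    case True
    then show ?thesis using pos by (auto simp: ennreal_mult_top)
  next
    case False
    then obtain x y where xy: "a = ennreal x" "b = ennreal y" "0 \<le> x" "0 \<le> y"
      by (metis ennreal_enn2real_if enn2real_nonneg)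
    then have "s \<le> c * x + (1 - c) * y" using ab by (intro c(3)) (auto simp: R_iff)
    then have "r \<le> (1 - 2 * e) * (c * x + (1 - c) * y)"
      unfolding rse using e by (intro mult_left_mono) auto
    also have "\<dots> = d * x + (1 - d) * y - e * x - e * y"
      unfolding d1 unfolding d_def by (simp add: algebra_simps)
    also have "\<dots> \<le> d * x + (1 - d) * y"
      using mult_nonneg_nonneg[of e x] mult_nonneg_nonneg[of e y] xy e by linarith
    finally show ?thesis
      using xy pos rs by (simp add: ennreal_mult[symmetric] ennreal_plus[symmetric] ennreal_le_iff del: ennreal_plus)
  qed
  with pos show ?thesis by (intro exI[of _ d]) auto
qed

lemma sum_coeffs_insert:
  fixes f :: "'i \<Rightarrow> ennreal"
  assumes "finite I" "j \<notin> I" "0 \<le> t" "\<And>i. i \<in> I \<Longrightarrow> 0 \<le> c i"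
  shows "(\<Sum>i\<in>insert j I. ennreal (if i = j then 1 - t else t * c i) * f i) =
    ennreal t * (\<Sum>i\<in>I. ennreal (c i) * f i) + ennreal (1 - t) * f j"
proof -
  have "(\<Sum>i\<in>I. ennreal (if i = j then 1 - t else t * c i) * f i) = (\<Sum>i\<in>I. ennreal t * (ennreal (c i) * f i))"
    using assms by (intro sum.cong) (auto simp: ennreal_mult mult.assoc)
  with assms show ?thesis by (simp add: sum_distrib_left add.commute)
qed

lemma sum_weights_insert:
  assumes "finite I" "j \<notin> I" "sum c I = (1 :: real)"
  shows "(\<Sum>i\<in>insert j I. if i = j then 1 - t else t * c i) = 1"
proof -
  have "(\<Sum>i\<in>I. if i = j then 1 - t else t * c i) = (\<Sum>i\<in>I. t * c i)"
    using assms by (intro sum.cong) auto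
  with assms show ?thesis by (simp add: sum_distrib_left[symmetric])
qed

lemma fconv_sum:
  fixes f g :: "'i \<Rightarrow> ennreal"
  shows "(\<Sum>i\<in>I. ennreal (c i) * (ennreal t * f i + ennreal (1 - t) * g i)) =
    ennreal t * (\<Sum>i\<in>I. ennreal (c i) * f i) + ennreal (1 - t) * (\<Sum>i\<in>I. ennreal (c i) * g i)"
  by (simp add: sum_distrib_left sum.distrib[symmetric] distrib_left mult_ac)

lemma ennreal_convex_gt:
  fixes a b r :: ennreal and t :: real
  assumes "r < a" "r < b" "0 \<le> t" "t \<le> 1"
  shows "r < ennreal t * a + ennreal (1 - t) * b"
proof -
  have "ennreal t + ennreal (1 - t) = 1"
    using assms by (simp add: ennreal_plus[symmetric] del: ennreal_plus)
  then have "min a b = ennreal t * min a b + ennreal (1 - t) * min a b"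
    by (simp add: distrib_right[symmetric])
  also have "\<dots> \<le> ennreal t * a + ennreal (1 - t) * b"
    by (intro add_mono mult_left_mono) auto
  finally have "min a b \<le> ennreal t * a + ennreal (1 - t) * b" .
  moreover have "r < min a b" using assms by simp
  ultimately show ?thesis by order
qed

text \<open>The members with \<open>f j > 1\<close> form a convex, possibly empty, set on which some
  index in \<open>I\<close> works, so the induction hypothesis averages the coordinates in
  \<open>I\<close> into one. That average and \<open>f j\<close> are two coordinates to which the
  planar case applies.\<close>

lemma minimax_le:
  assumes "finite I" "I \<noteq> {}" "fconv S" "\<And>f. f \<in> S \<Longrightarrow> \<exists>i\<in>I. f i \<le> 1"
  shows "\<exists>c. (\<forall>i\<in>I. 0 \<le> c i) \<and> sum c I = 1 \<and> (\<forall>f\<in>S. (\<Sum>i\<in>I. ennreal (c i) * f i) \<le> 1)"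
  using assms
proof (induction I arbitrary: S rule: finite_ne_induct)
  case (singleton j)
  then show ?case by (intro exI[of _ "\<lambda>_. 1"]) simp
next
  case (insert j I)
  have "fconv {f \<in> S. 1 < f j}"
    using insert.prems(1) by (auto simp: fconv_def ennreal_convex_gt)
  moreover have "\<exists>i\<in>I. f i \<le> 1" if "f \<in> {f \<in> S. 1 < f j}" for f
    using insert.prems(2)[of f] that by (auto simp: not_le)
  ultimately obtain c where c: "\<And>i. i \<in> I \<Longrightarrow> 0 \<le> c i" "sum c I = 1"
    "\<And>f. f \<in> S \<Longrightarrow> 1 < f j \<Longrightarrow> (\<Sum>i\<in>I. ennreal (c i) * f i) \<le> 1"
    using insert.IH[of "{f \<in> S. 1 < f j}"] by auto
  let ?P = "(\<lambda>f. (\<Sum>i\<in>I. ennreal (c i) * f i, f j)) ` S"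
  have "\<exists>t. 0 \<le> t \<and> t \<le> 1 \<and> (\<forall>(a, b)\<in>?P. ennreal t * a + ennreal (1 - t) * b \<le> 1)"
  proof (rule minimax2_le)
    fix a b a' b' and t :: real assume "(a, b) \<in> ?P" "(a', b') \<in> ?P" and t: "0 \<le> t" "t \<le> 1"
    then obtain f g where fg: "f \<in> S" "g \<in> S" "a = (\<Sum>i\<in>I. ennreal (c i) * f i)" "b = f j"
      "a' = (\<Sum>i\<in>I. ennreal (c i) * g i)" "b' = g j" by auto
    with insert.prems(1) t have "(\<lambda>i. ennreal t * f i + ennreal (1 - t) * g i) \<in> S"
      unfolding fconv_def by blast
    then show "(ennreal t * a + ennreal (1 - t) * a', ennreal t * b + ennreal (1 - t) * b') \<in> ?P"
      by (rule rev_image_eqI) (simp add: fg fconv_sum)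
  next
    show "a \<le> 1 \<or> b \<le> 1" if "(a, b) \<in> ?P" for a b
      using that c(3) by (auto simp: not_le)
  qed
  then obtain t where t: "0 \<le> t" "t \<le> 1"
    "\<And>f. f \<in> S \<Longrightarrow> ennreal t * (\<Sum>i\<in>I. ennreal (c i) * f i) + ennreal (1 - t) * f j \<le> 1"
    by auto
  show ?case
  proof (intro exI[of _ "\<lambda>i. if i = j then 1 - t else t * c i"] conjI ballI)
    fix f assume "f \<in> S"
    with t(3) show "(\<Sum>i\<in>insert j I. ennreal (if i = j then 1 - t else t * c i) * f i) \<le> 1"
      by (simp only: sum_coeffs_insert[OF insert.hyps(1,3) t(1) c(1)])
  qed (use t c sum_weights_insert[OF insert.hyps(1,3) c(2), of t] in auto)
qed

lemma minimax_ge: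
  assumes "finite I" "I \<noteq> {}" "fconv S" "\<And>f. f \<in> S \<Longrightarrow> \<exists>i\<in>I. ennreal s \<le> f i" "0 < r" "r < s"
  shows "\<exists>c. (\<forall>i\<in>I. 0 \<le> c i) \<and> sum c I = 1 \<and> (\<forall>f\<in>S. ennreal r \<le> (\<Sum>i\<in>I. ennreal (c i) * f i))"
  using assms
proof (induction I arbitrary: S r rule: finite_ne_induct)
  case (singleton j)
  then have "ennreal r \<le> f j" if "f \<in> S" for f
    using that by (metis ennreal_leI less_imp_le order_trans singletonD)
  then show ?case by (intro exI[of _ "\<lambda>_. 1"]) simp
next
  case (insert j I)
  \<comment> \<open>Each induction step spends part of the slack: the members with
    \<open>f j < q\<close> are averaged to at least \<open>q\<close>, and the planar case descends
    from \<open>q\<close> to \<open>r\<close>.\<close>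
  define q where "q = (r + s) / 2"
  have q: "r < q" "q < s" "0 < q" using insert.prems by (auto simp: q_def)
  have lt: "ennreal t * a + ennreal (1 - t) * b < ennreal q"
    if ab: "a < ennreal q" "b < ennreal q" and t: "0 \<le> t" "t \<le> 1" for a b :: ennreal and t :: real
  proof -
    obtain x y where xy: "a = ennreal x" "b = ennreal y" "0 \<le> x" "0 \<le> y" "x < q" "y < q"
      using ab by (cases a; cases b) (auto simp: ennreal_less_iff)
    have "t * x + (1 - t) * y < q"
      using convex_bound_lt[OF xy(5,6), of t "1 - t"] t by simp
    with xy t show ?thesis
      by (simp add: ennreal_mult[symmetric] ennreal_plus[symmetric] ennreal_less_iff del: ennreal_plus)
  qed
  have "fconv {f \<in> S. f j < ennreal q}"
    using insert.prems(1) lt by (auto simp: fconv_def)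
  moreover have "\<exists>i\<in>I. ennreal s \<le> f i" if "f \<in> {f \<in> S. f j < ennreal q}" for f
  proof -
    have "\<not> ennreal s \<le> f j" using that q by (auto simp: not_le intro: less_trans ennreal_lessI)
    with insert.prems(2)[of f] that show ?thesis by auto
  qed
  ultimately obtain c where c: "\<And>i. i \<in> I \<Longrightarrow> 0 \<le> c i" "sum c I = 1"
    "\<And>f. f \<in> S \<Longrightarrow> f j < ennreal q \<Longrightarrow> ennreal q \<le> (\<Sum>i\<in>I. ennreal (c i) * f i)"
    using insert.IH[of "{f \<in> S. f j < ennreal q}" q] q by auto
  let ?P = "(\<lambda>f. (\<Sum>i\<in>I. ennreal (c i) * f i, f j)) ` S"
  have "\<exists>t. 0 \<le> t \<and> t \<le> 1 \<and> (\<forall>(a, b)\<in>?P. ennreal r \<le> ennreal t * a + ennreal (1 - t) * b)"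
  proof (rule minimax2_ge[OF _ _ insert.prems(3) q(1)])
    fix a b a' b' and t :: real assume "(a, b) \<in> ?P" "(a', b') \<in> ?P" and t: "0 \<le> t" "t \<le> 1"
    then obtain f g where fg: "f \<in> S" "g \<in> S" "a = (\<Sum>i\<in>I. ennreal (c i) * f i)" "b = f j"
      "a' = (\<Sum>i\<in>I. ennreal (c i) * g i)" "b' = g j" by auto
    with insert.prems(1) t have "(\<lambda>i. ennreal t * f i + ennreal (1 - t) * g i) \<in> S"
      unfolding fconv_def by blast
    then show "(ennreal t * a + ennreal (1 - t) * a', ennreal t * b + ennreal (1 - t) * b') \<in> ?P"
      by (rule rev_image_eqI) (simp add: fg fconv_sum)
  next
    show "ennreal q \<le> a \<or> ennreal q \<le> b" if "(a, b) \<in> ?P" for a b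
      using that c(3) by (auto simp: not_le)
  qed
  then obtain t where t: "0 \<le> t" "t \<le> 1"
    "\<And>f. f \<in> S \<Longrightarrow> ennreal r \<le> ennreal t * (\<Sum>i\<in>I. ennreal (c i) * f i) + ennreal (1 - t) * f j"
    by auto
  show ?case
  proof (intro exI[of _ "\<lambda>i. if i = j then 1 - t else t * c i"] conjI ballI)
    fix f assume "f \<in> S"
    with t(3) show "ennreal r \<le> (\<Sum>i\<in>insert j I. ennreal (if i = j then 1 - t else t * c i) * f i)"
      by (simp only: sum_coeffs_insert[OF insert.hyps(1,3) t(1) c(1)])
  qed (use t c sum_weights_insert[OF insert.hyps(1,3) c(2), of t] in auto)
qed

section \<open>The homeomorphism, given enough linear previsions\<close>

lemma
  assumes "linear_prevision X G"
  shows linear_sublin: "sublin X G"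
    and linear_sc: "sc X G"
    and linear_add: "x \<in> LX X \<Longrightarrow> y \<in> LX X \<Longrightarrow> G (x \<oplus> y) = G x + G y"
  using assms by (simp_all add: linear_prevision_iff)

lemma PP_linear: "G \<in> PP v X \<Longrightarrow> linear_prevision X G"
  by (simp add: PP_def)

lemma linear_zero: "linear_prevision X (\<lambda>_. 0)"
  by (simp add: linear_prevision_iff sublin_def sc_def)

lemma linear_combination:
  assumes "linear_prevision X G" "linear_prevision X G'"
  shows "linear_prevision X (\<lambda>h. c * G h + d * G' h)"
proof -
  note l = assms[THEN linear_sublin]
  have "sublin X (\<lambda>h. c * G h + d * G' h)"
    unfolding sublin_def
    using linear_add[OF assms(1)] linear_add[OF assms(2)]
    by (auto simp: sublin_outside[OF l(1)] sublin_outside[OF l(2)] sublin_smul[OF l(1)] sublin_smul[OF l(2)]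
        distrib_left mult_ac add_ac intro!: add_mono mult_left_mono sublin_mono[OF l(1)] sublin_mono[OF l(2)])
  moreover have "sc X (\<lambda>h. c * G h + d * G' h)"
    by (intro sc_add sc_cmult assms[THEN linear_sc])
  ultimately show ?thesis
    by (simp add: linear_prevision_iff linear_add[OF assms(1)] linear_add[OF assms(2)] distrib_left add_ac)
qed

lemma linear_sum:
  assumes "finite I" "\<And>i. i \<in> I \<Longrightarrow> linear_prevision X (G i)"
  shows "linear_prevision X (\<lambda>h. \<Sum>i\<in>I. c i * G i h)"
  using assms
proof (induction I rule: finite_induct)
  case (insert i I)
  then show ?case using linear_combination[of X "G i" "\<lambda>h. \<Sum>i\<in>I. c i * G i h" "c i" 1] by simp
qed (simp add: linear_zero)

lemma PP_convex: "convex_prev_set (PP v X)"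
  unfolding convex_prev_set_def
proof (intro ballI allI impI)
  fix G G' and a :: real assume G: "G \<in> PP v X" "G' \<in> PP v X" and a: "0 \<le> a \<and> a \<le> 1"
  have one: "ennreal a + ennreal (1 - a) = 1"
    using a by (simp add: ennreal_plus[symmetric] del: ennreal_plus)
  have eq: "ennreal a * (1 + x) + ennreal (1 - a) * (1 + y) = 1 + (ennreal a * x + ennreal (1 - a) * y)" for x y
  proof -
    have "ennreal a * (1 + x) + ennreal (1 - a) * (1 + y) = (ennreal a + ennreal (1 - a)) + (ennreal a * x + ennreal (1 - a) * y)"
      by (simp only: distrib_left mult_1_right add_ac)
    then show ?thesis by (simp only: one)
  qed
  have "norm_cond v X (\<lambda>h. ennreal a * G h + ennreal (1 - a) * G' h)"
  proof (cases v)
    case SubNorm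
    with G have "G (LX_one X \<oplus> h) \<le> 1 + G h" "G' (LX_one X \<oplus> h) \<le> 1 + G' h" if "h \<in> LX X" for h
      using that by (auto simp: PP_def norm_cond_def)
    then show ?thesis
      unfolding norm_cond_def SubNorm variant.case eq[symmetric]
      by (intro ballI add_mono mult_left_mono) auto
  next
    case Norm
    with G have "G (LX_one X \<oplus> h) = 1 + G h" "G' (LX_one X \<oplus> h) = 1 + G' h" if "h \<in> LX X" for h
      using that by (auto simp: PP_def norm_cond_def)
    then show ?thesis
      unfolding norm_cond_def Norm variant.case eq[symmetric] by simp
  qed (simp add: norm_cond_def)
  with G show "(\<lambda>h. ennreal a * G h + ennreal (1 - a) * G' h) \<in> PP v X"
    by (simp add: PP_def linear_combination)
qed

section \<open>The weak and lower Vietoris topologies\<close>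

lemma topspace_weak [simp]: "topspace (weak_topology X E) = E"
  by (auto simp: weak_topology_def)

lemma topspace_lower_vietoris [simp]: "topspace (lower_vietoris Y) = Hset Y"
  by (auto simp: lower_vietoris_def)

lemma openin_weak_subbase:
  assumes "h \<in> LX X"
  shows "openin (weak_topology X E) {F \<in> E. r < F h}"
proof (cases r)
  case (real s)
  then show ?thesis
    using assms unfolding weak_topology_def by (intro topology_generated_by_Basis) auto
qed simp

lemma one_less_scale_iff:
  fixes y :: ennreal
  assumes "0 < p"
  shows "1 < ennreal (1 / p) * y \<longleftrightarrow> ennreal p < y"
proof (cases y)
  case (real z)
  then have "ennreal (1 / p) * y = ennreal (z / p)"
    using assms by (simp add: ennreal_mult[symmetric])
  with real assms show ?thesis
    by (simp add: ennreal_less_iff field_simps flip: ennreal_1)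
qed (use assms in \<open>simp add: ennreal_mult_top\<close>)

text \<open>Thresholds are normalized to 1 by rescaling the map. Threshold 0 cannot be rescaled to
  1, so a positive \<open>p\<close> strictly between the threshold and the value at \<open>G\<close>
  replaces it.\<close>

lemma weak_open_half_spaces:
  assumes "openin (weak_topology X E) V" "G \<in> V" and E: "E \<subseteq> PP v X"
  shows "\<exists>H. finite H \<and> H \<subseteq> LX X \<and> (\<forall>k\<in>H. 1 < G k) \<and> (\<forall>G'\<in>E. (\<forall>k\<in>H. 1 < G' k) \<longrightarrow> G' \<in> V)"
proof -
  let ?B = "insert E {{F \<in> E. ennreal r < F h} | h r. h \<in> LX X \<and> r \<ge> 0}"
  have "generate_topology_on ?B V"
    using assms(1) by (simp add: weak_topology_def openin_topology_generated_by_iff)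
  then show ?thesis
    using assms(2)
  proof (induction arbitrary: G)
    case (Int a b)
    then have G: "G \<in> a" "G \<in> b" by auto
    obtain H1 where H1: "finite H1" "H1 \<subseteq> LX X" "\<forall>k\<in>H1. 1 < G k" "\<forall>G'\<in>E. (\<forall>k\<in>H1. 1 < G' k) \<longrightarrow> G' \<in> a"
      using Int.IH(1)[OF G(1)] by blast
    obtain H2 where H2: "finite H2" "H2 \<subseteq> LX X" "\<forall>k\<in>H2. 1 < G k" "\<forall>G'\<in>E. (\<forall>k\<in>H2. 1 < G' k) \<longrightarrow> G' \<in> b"
      using Int.IH(2)[OF G(2)] by blast
    from H1 H2 show ?case by (intro exI[of _ "H1 \<union> H2"]) auto
  next
    case (UN K)
    then obtain k where k: "k \<in> K" "G \<in> k" by blast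
    obtain H where "finite H" "H \<subseteq> LX X" "\<forall>k\<in>H. 1 < G k" "\<forall>G'\<in>E. (\<forall>k\<in>H. 1 < G' k) \<longrightarrow> G' \<in> k"
      using UN.IH[OF k] by blast
    with k(1) show ?case by (intro exI[of _ H]) blast
  next
    case (Basis s)
    show ?case
    proof (cases "s = E")
      case True
      then show ?thesis by (intro exI[of _ "{}"]) auto
    next
      case False
      with Basis obtain h r where h: "s = {F \<in> E. ennreal r < F h}" "h \<in> LX X" "0 \<le> r" by blast
      with Basis have G: "G \<in> E" "ennreal r < G h" by auto
      have lin: "sublin X G'" if "G' \<in> E" for G' using E that by (auto simp: PP_def linear_prevision_iff)
      obtain q where q: "ennreal r < q" "q < G h" using dense[OF G(2)] by blast
      then obtain p where p: "q = ennreal p" "0 \<le> p" by (cases q) (auto simp: top_unique less_top[symmetric])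
      have rp: "r < p" "0 < p" using q p h(3) by (auto simp: ennreal_less_iff)
      have iff: "1 < G' ((1 / p) \<odot> h) \<longleftrightarrow> q < G' h" if "G' \<in> E" for G'
      proof -
        have "G' ((1 / p) \<odot> h) = ennreal (1 / p) * G' h"
          using rp by (intro sublin_smul[OF lin[OF that]] h) auto
        then show ?thesis using one_less_scale_iff[OF rp(2)] p(1) by simp
      qed
      have "1 < G ((1 / p) \<odot> h)" using iff[OF G(1)] q by simp
      moreover have "G' \<in> s" if "G' \<in> E" "1 < G' ((1 / p) \<odot> h)" for G'
        using iff[OF that(1)] that q h by (auto intro: less_trans)
      ultimately show ?thesis using h LX_smul by (intro exI[of _ "{(1 / p) \<odot> h}"]) auto
    qed
  qed simp
qed

lemma LX_sum_arg:
  assumes "finite I" "\<And>i. i \<in> I \<Longrightarrow> f i \<in> LX X"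
  shows "(\<lambda>x. \<Sum>i\<in>I. ennreal (c i) * f i x) \<in> LX X"
  using assms
proof (induction I rule: finite_induct)
  case (insert j I)
  then have "c j \<odot> f j \<oplus> (\<lambda>x. \<Sum>i\<in>I. ennreal (c i) * f i x) \<in> LX X"
    by (intro LX_add LX_smul) auto
  with insert.hyps show ?case by (simp add: LX_add_def LX_smul_def)
qed simp

lemma linear_sum_arg:
  assumes G: "linear_prevision X G" and "finite I" "\<And>i. i \<in> I \<Longrightarrow> f i \<in> LX X" "\<And>i. i \<in> I \<Longrightarrow> 0 \<le> c i"
  shows "G (\<lambda>x. \<Sum>i\<in>I. ennreal (c i) * f i x) = (\<Sum>i\<in>I. ennreal (c i) * G (f i))"
  using assms(2-)
proof (induction I rule: finite_induct)
  case empty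
  then show ?case using sublin_zero[OF linear_sublin[OF G]] by simp
next
  case (insert j I)
  have eq: "(\<lambda>x. \<Sum>i\<in>insert j I. ennreal (c i) * f i x) = c j \<odot> f j \<oplus> (\<lambda>x. \<Sum>i\<in>I. ennreal (c i) * f i x)"
    using insert.hyps by (simp add: LX_add_def LX_smul_def)
  have "G (\<lambda>x. \<Sum>i\<in>insert j I. ennreal (c i) * f i x) = G (c j \<odot> f j) + G (\<lambda>x. \<Sum>i\<in>I. ennreal (c i) * f i x)"
    unfolding eq using insert by (intro linear_add[OF G] LX_smul LX_sum_arg) auto
  with insert show ?case by (simp add: sublin_smul[OF linear_sublin[OF G]])
qed

text \<open>A linear prevision takes the weighted sum of its values on \<open>H\<close> here, so
  weights found by a minimax lemma become a single map.\<close>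

definition comb :: "(('a \<Rightarrow> ennreal) \<Rightarrow> real) \<Rightarrow> ('a \<Rightarrow> ennreal) set \<Rightarrow> 'a \<Rightarrow> ennreal" where
  "comb c H = (\<lambda>x. \<Sum>k\<in>H. ennreal (c k) * k x)"

lemma LX_comb: "finite H \<Longrightarrow> H \<subseteq> LX X \<Longrightarrow> comb c H \<in> LX X"
  unfolding comb_def by (rule LX_sum_arg) auto

lemma linear_comb:
  assumes "linear_prevision X G" "finite H" "H \<subseteq> LX X" "\<And>k. k \<in> H \<Longrightarrow> 0 \<le> c k"
  shows "G (comb c H) = (\<Sum>k\<in>H. ennreal (c k) * G k)"
  unfolding comb_def using assms by (intro linear_sum_arg) auto

lemma comb_mono: "(\<And>k. k \<in> H \<Longrightarrow> c k \<le> d k) \<Longrightarrow> comb c H \<le> comb d H"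
  by (auto simp: comb_def le_fun_def intro!: sum_mono mult_right_mono ennreal_leI)

lemma sum_weights_ge:
  fixes f :: "'i \<Rightarrow> ennreal"
  assumes "\<And>i. i \<in> I \<Longrightarrow> 0 \<le> c i" "\<And>i. i \<in> I \<Longrightarrow> ennreal s \<le> f i" "0 \<le> s"
  shows "ennreal (s * sum c I) \<le> (\<Sum>i\<in>I. ennreal (c i) * f i)"
proof -
  have "ennreal (s * sum c I) = (\<Sum>i\<in>I. ennreal (c i * s))"
    using assms by (subst sum_ennreal) (auto simp: sum_distrib_left mult.commute)
  also have "\<dots> \<le> (\<Sum>i\<in>I. ennreal (c i) * f i)"
    using assms by (intro sum_mono) (auto simp: ennreal_mult intro!: mult_left_mono)
  finally show ?thesis .
qed

lemma finite_gt_one: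
  fixes f :: "'i \<Rightarrow> ennreal"
  assumes "finite I" "\<And>i. i \<in> I \<Longrightarrow> 1 < f i"
  obtains s :: real where "1 < s" "\<And>i. i \<in> I \<Longrightarrow> ennreal s \<le> f i"
proof -
  \<comment> \<open>The extra element 2 covers an empty \<open>I\<close> and keeps the intermediate
    value finite.\<close>
  have "1 < Min (insert 2 (f ` I))" using assms by (subst Min_gr_iff) auto
  then obtain q where q: "1 < q" "q < Min (insert 2 (f ` I))" using dense by blast
  then have "q < 2" "\<And>i. i \<in> I \<Longrightarrow> q < f i" using assms(1) by (auto simp: Min_gr_iff)
  moreover from this obtain s where "q = ennreal s" "0 \<le> s" by (cases q) auto
  ultimately show thesis using q(1) that[of s] by (auto intro: less_imp_le)
qed

text \<open>Says that \<open>F\<close> is the pointwise supremum of \<open>s_AP v X F\<close>.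
  Friendliness of \<open>X\<close> enters the final theorem through this property alone.\<close>

definition representable :: "variant \<Rightarrow> 'a topology \<Rightarrow> bool" where
  "representable v X \<longleftrightarrow> (\<forall>F\<in>PAP v X. \<forall>h\<in>LX X. \<forall>r. r < F h \<longrightarrow> (\<exists>G\<in>PP v X. G \<le> F \<and> r < G h))"

lemma Hcvx_iff: "E \<in> Hcvx v X \<longleftrightarrow> closedin (weak_topology X (PP v X)) E \<and> E \<noteq> {} \<and> fconv E"
  by (simp add: Hcvx_def Hset_def convex_prev_set_def fconv_def)

lemma Hcvx_subset: "E \<in> Hcvx v X \<Longrightarrow> E \<subseteq> PP v X"
  by (metis Hcvx_iff closedin_subset topspace_weak)

lemma s_AP_r_AP:
  assumes E: "E \<in> Hcvx v X"
  shows "s_AP v X (r_AP E) = E"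
proof
  show "E \<subseteq> s_AP v X (r_AP E)"
    using Hcvx_subset[OF E] by (auto simp: s_AP_def r_AP_def le_fun_def intro: SUP_upper)
  show "s_AP v X (r_AP E) \<subseteq> E"
  proof
    fix G assume "G \<in> s_AP v X (r_AP E)"
    then have G: "G \<in> PP v X" "G \<le> r_AP E" by (auto simp: s_AP_def)
    show "G \<in> E"
    proof (rule ccontr)
      assume "G \<notin> E"
      have "openin (weak_topology X (PP v X)) (PP v X - E)"
        using E by (metis Hcvx_iff closedin_def topspace_weak)
      moreover have "G \<in> PP v X - E" using G \<open>G \<notin> E\<close> by blast
      ultimately obtain H where H: "finite H" "H \<subseteq> LX X" "\<forall>k\<in>H. 1 < G k"
        "\<forall>G'\<in>PP v X. (\<forall>k\<in>H. 1 < G' k) \<longrightarrow> G' \<in> PP v X - E"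
        using weak_open_half_spaces[OF _ _ subset_refl] by metis
      have EH: "\<exists>k\<in>H. G' k \<le> 1" if "G' \<in> E" for G'
        using H(4) Hcvx_subset[OF E] that by (meson DiffD2 not_le subsetD)
      \<comment> \<open>An empty family of half-spaces would leave no room for the nonempty
        \<open>E\<close>.\<close>
      with E have "H \<noteq> {}" by (auto simp: Hcvx_iff)
      have "fconv E" using E by (simp add: Hcvx_iff)
      from minimax_le[OF H(1) \<open>H \<noteq> {}\<close> this EH] obtain c where c: "\<And>k. k \<in> H \<Longrightarrow> 0 \<le> c k" "sum c H = 1"
        "\<And>G'. G' \<in> E \<Longrightarrow> (\<Sum>k\<in>H. ennreal (c k) * G' k) \<le> 1" by blast
      have val: "G' (comb c H) = (\<Sum>k\<in>H. ennreal (c k) * G' k)" if "G' \<in> PP v X" for G'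
        using linear_comb[OF PP_linear[OF that] H(1,2) c(1)] .
      \<comment> \<open>A uniform margin \<open>s > 1\<close> survives the averaging because the
        weights sum to 1.\<close>
      obtain s where s: "1 < s" "\<And>k. k \<in> H \<Longrightarrow> ennreal s \<le> G k"
        using finite_gt_one[OF H(1), of G] H(3) by metis
      have "ennreal s \<le> G (comb c H)"
        using sum_weights_ge[of H c s G] c s val[OF G(1)] by simp
      also have "\<dots> \<le> r_AP E (comb c H)" using G(2) by (simp add: le_fun_def)
      also have "\<dots> \<le> 1"
        unfolding r_AP_def
      proof (rule SUP_least)
        fix G' assume "G' \<in> E"
        with c(3)[of G'] val[of G'] Hcvx_subset[OF E] show "G' (comb c H) \<le> 1" by auto
      qed
      finally show False using s(1) by simp
    qed
  qed
qed

lemma r_AP_PAP: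
  assumes E: "E \<subseteq> PP v X" "E \<noteq> {}"
  shows "r_AP E \<in> PAP v X"
proof -
  have lin: "linear_prevision X G" if "G \<in> E" for G using E that by (auto simp: PP_def)
  note sub = linear_sublin[OF lin]
  obtain G0 where G0: "G0 \<in> E" using E by blast
  have "sublin X (r_AP E)"
    unfolding r_AP_def
  proof (rule sublinI)
    show "(SUP G\<in>E. G h) = 0" if "h \<notin> LX X" for h
    proof -
      have "(SUP G\<in>E. G h) = (SUP G\<in>E. 0)" by (intro SUP_cong refl sublin_outside[OF sub] that)
      with E show ?thesis by simp
    qed
    have "(SUP G\<in>E. G (\<lambda>_. 0)) = (SUP G\<in>E. 0)" by (intro SUP_cong refl sublin_zero[OF sub])
    with E show "(SUP G\<in>E. G (\<lambda>_. 0)) = 0" by simp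
    show "(SUP G\<in>E. G x) \<le> (SUP G\<in>E. G y)" if "x \<in> LX X" "y \<in> LX X" "x \<le> y" for x y
      by (intro SUP_mono bexI) (rule sublin_mono[OF sub that])
    show "ennreal a * (SUP G\<in>E. G x) \<le> (SUP G\<in>E. G (a \<odot> x))" if "0 < a" "x \<in> LX X" for a x
    proof -
      have "ennreal a * (SUP G\<in>E. G x) = (SUP G\<in>E. ennreal a * G x)" by (rule SUP_mult_left_ennreal)
      also have "\<dots> = (SUP G\<in>E. G (a \<odot> x))"
        using that by (intro SUP_cong refl sublin_smul[OF sub, symmetric]) auto
      finally show ?thesis by simp
    qed
    show "(SUP G\<in>E. G (x \<oplus> y)) \<le> (SUP G\<in>E. G x) + (SUP G\<in>E. G y)" if "x \<in> LX X" "y \<in> LX X" for x y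
    proof (rule SUP_least)
      fix G assume "G \<in> E"
      then show "G (x \<oplus> y) \<le> (SUP G\<in>E. G x) + (SUP G\<in>E. G y)"
        using SUP_upper[of G E "\<lambda>G. G x"] SUP_upper[of G E "\<lambda>G. G y"]
        by (simp add: linear_add[OF lin that] add_mono)
    qed
  qed
  moreover have "sc X (r_AP E)"
    unfolding r_AP_def by (rule sc_SUP) (rule linear_sc[OF lin])
  moreover have "norm_cond v X (r_AP E)"
  proof (cases v)
    case SubNorm
    have "G (LX_one X \<oplus> h) \<le> 1 + (SUP G\<in>E. G h)" if "h \<in> LX X" "G \<in> E" for h G
    proof -
      have "G (LX_one X \<oplus> h) \<le> 1 + G h" using E that SubNorm by (auto simp: PP_def norm_cond_def)
      also have "\<dots> \<le> 1 + (SUP G\<in>E. G h)" using that by (intro add_left_mono SUP_upper)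
      finally show ?thesis .
    qed
    then show ?thesis by (auto simp: SubNorm norm_cond_def r_AP_def intro: SUP_least)
  next
    case Norm
    have "(SUP G\<in>E. G (LX_one X \<oplus> h)) = 1 + (SUP G\<in>E. G h)" if "h \<in> LX X" for h
    proof -
      have "(SUP G\<in>E. G (LX_one X \<oplus> h)) = (SUP G\<in>E. 1 + G h)"
        using E that Norm by (intro SUP_cong refl) (auto simp: PP_def norm_cond_def)
      also have "\<dots> = 1 + (SUP G\<in>E. G h)" using E by (simp add: ennreal_SUP_add_right)
      finally show ?thesis .
    qed
    then show ?thesis by (simp add: Norm norm_cond_def r_AP_def)
  qed (simp add: norm_cond_def)
  ultimately show ?thesis by (simp add: PAP_def hoare_prevision_iff)
qed

lemma Norm_one: "F \<in> PAP Norm X \<Longrightarrow> F (LX_one X) = 1"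
proof -
  assume F: "F \<in> PAP Norm X"
  then have "\<forall>h\<in>LX X. F (LX_one X \<oplus> h) = 1 + F h" by (simp add: PAP_def norm_cond_def)
  from bspec[OF this LX_zero] have "F (LX_one X \<oplus> (\<lambda>_. 0)) = 1 + F (\<lambda>_. 0)" .
  moreover have "F (\<lambda>_. 0) = 0" using F by (intro sublin_zero) (auto simp: PAP_def hoare_prevision_iff)
  ultimately show ?thesis by simp
qed

text \<open>In the normalized case representability is applied at the constant map 1, where
  \<open>F\<close> is positive; otherwise the zero prevision qualifies.\<close>

lemma s_AP_nonempty:
  assumes "representable v X" and F: "F \<in> PAP v X"
  shows "s_AP v X F \<noteq> {}"
proof (cases "v = Norm")
  case True
  with Norm_one[of F X] F have "0 < F (LX_one X)" by simp
  then obtain G where "G \<in> PP v X" "G \<le> F"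
    using assms LX_one unfolding representable_def by blast
  then show ?thesis by (auto simp: s_AP_def)
next
  case False
  then have "(\<lambda>_. 0) \<in> s_AP v X F"
    by (cases v) (simp_all add: s_AP_def PP_def linear_zero norm_cond_def le_fun_def)
  then show ?thesis by blast
qed

lemma s_AP_Hcvx:
  assumes R: "representable v X" and F: "F \<in> PAP v X"
  shows "s_AP v X F \<in> Hcvx v X"
  unfolding Hcvx_iff
proof (intro conjI)
  \<comment> \<open>Failing to lie below \<open>F\<close> is an open condition: a union of
    half-spaces with thresholds \<open>F h\<close>.\<close>
  have "PP v X - s_AP v X F = (\<Union>h\<in>LX X. {G \<in> PP v X. F h < G h})"
  proof -
    have "G \<le> F \<longleftrightarrow> (\<forall>h\<in>LX X. G h \<le> F h)" if "G \<in> PP v X" for G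
      using that F sublin_outside[OF linear_sublin[OF PP_linear[OF that]]] by (fastforce simp: le_fun_def)
    then show ?thesis by (auto simp: s_AP_def not_le[symmetric])
  qed
  moreover have "openin (weak_topology X (PP v X)) (\<Union>h\<in>LX X. {G \<in> PP v X. F h < G h})"
    by (intro openin_Union) (auto intro: openin_weak_subbase)
  ultimately show "closedin (weak_topology X (PP v X)) (s_AP v X F)"
    by (auto simp: closedin_def s_AP_def)
  show "s_AP v X F \<noteq> {}" by (rule s_AP_nonempty[OF R F])
  show "fconv (s_AP v X F)"
    unfolding fconv_def
  proof (intro ballI allI impI)
    fix G G' and t :: real assume G: "G \<in> s_AP v X F" "G' \<in> s_AP v X F" and t: "0 \<le> t \<and> t \<le> 1"
    have "ennreal t + ennreal (1 - t) = 1"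
      using t by (simp add: ennreal_plus[symmetric] del: ennreal_plus)
    then have eq: "F h = ennreal t * F h + ennreal (1 - t) * F h" for h
      by (simp add: distrib_right[symmetric])
    have "ennreal t * G h + ennreal (1 - t) * G' h \<le> F h" for h
      using G by (subst eq) (intro add_mono mult_left_mono; simp add: s_AP_def le_fun_def)
    moreover have "(\<lambda>h. ennreal t * G h + ennreal (1 - t) * G' h) \<in> PP v X"
      using PP_convex G t unfolding convex_prev_set_def s_AP_def by blast
    ultimately show "(\<lambda>h. ennreal t * G h + ennreal (1 - t) * G' h) \<in> s_AP v X F"
      by (simp add: s_AP_def le_fun_def)
  qed
qed

lemma r_AP_s_AP:
  assumes R: "representable v X" and F: "F \<in> PAP v X"
  shows "r_AP (s_AP v X F) = F"
proof (rule antisym)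
  show "r_AP (s_AP v X F) \<le> F"
    by (auto simp: r_AP_def s_AP_def le_fun_def intro: SUP_least)
  show "F \<le> r_AP (s_AP v X F)"
  proof (rule le_funI)
    fix h show "F h \<le> r_AP (s_AP v X F) h"
    proof (cases "h \<in> LX X")
      case True
      show ?thesis
      proof (rule dense_le)
        fix r assume "r < F h"
        then obtain G where "G \<in> PP v X" "G \<le> F" "r < G h"
          using R F True unfolding representable_def by blast
        then have "G \<in> s_AP v X F" "r < G h" by (simp_all add: s_AP_def)
        then show "r \<le> r_AP (s_AP v X F) h"
          by (auto simp: r_AP_def intro: SUP_upper2)
      qed
    next
      case False
      then have "F h = 0" using F by (auto simp: PAP_def hoare_prevision_iff intro: sublin_outside)
      then show ?thesis by simp
    qed
  qed
qed

section \<open>Continuity in both directions\<close>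

lemma continuous_r_AP:
  "continuous_map (subtopology (lower_vietoris (weak_topology X (PP v X))) (Hcvx v X)) (weak_topology X (PAP v X)) r_AP"
proof -
  let ?W = "weak_topology X (PP v X)"
  let ?T = "subtopology (lower_vietoris ?W) (Hcvx v X)"
  have top: "topspace ?T = Hcvx v X" by (auto simp: Hcvx_def)
  have PAP: "r_AP C \<in> PAP v X" if "C \<in> Hcvx v X" for C
    using that Hcvx_subset[OF that] by (intro r_AP_PAP) (auto simp: Hcvx_iff)
  have "openin ?T (r_AP -` U \<inter> topspace ?T)"
    if "U \<in> insert (PAP v X) {{F \<in> PAP v X. ennreal r < F h} | h r. h \<in> LX X \<and> r \<ge> 0}" for U
  proof (cases "U = PAP v X")
    case True
    then have "r_AP -` U \<inter> topspace ?T = topspace ?T" using PAP top by auto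
    then show ?thesis by (metis openin_topspace)
  next
    case False
    with that obtain h r where U: "U = {F \<in> PAP v X. ennreal r < F h}" "h \<in> LX X" "0 \<le> r" by blast
    let ?V = "{G \<in> PP v X. ennreal r < G h}"
    have "openin (lower_vietoris ?W) {C \<in> Hset ?W. C \<inter> ?V \<noteq> {}}"
      unfolding lower_vietoris_def using openin_weak_subbase[OF U(2)] by (intro topology_generated_by_Basis) blast
    moreover have "r_AP -` U \<inter> topspace ?T = {C \<in> Hset ?W. C \<inter> ?V \<noteq> {}} \<inter> Hcvx v X"
      unfolding top using PAP Hcvx_subset[of _ v X] by (auto simp: U r_AP_def less_SUP_iff Hcvx_def)
    ultimately show ?thesis by (auto simp: openin_subtopology)
  qed
  moreover have "r_AP ` topspace ?T \<subseteq> \<Union> (insert (PAP v X) {{F \<in> PAP v X. ennreal r < F h} | h r. h \<in> LX X \<and> r \<ge> 0})"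
    using PAP top by auto
  ultimately show ?thesis
    unfolding weak_topology_def[of X "PAP v X"] by (rule continuous_on_generated_topo)
qed

text \<open>If \<open>s_AP v X F\<close> missed \<open>V\<close>, averaging would give weights for
  which \<open>F\<close> is at most 1 on the corresponding combination of \<open>H\<close>. These
  weights depend on \<open>F\<close>, while a basic neighbourhood tests only finitely many maps;
  rounding the weights to a grid makes the list finite.\<close>

lemma s_AP_meets_open:
  assumes R: "representable v X" and F0: "F0 \<in> PAP v X"
    and V: "openin (weak_topology X (PP v X)) V" "s_AP v X F0 \<inter> V \<noteq> {}"
  shows "\<exists>N. openin (weak_topology X (PAP v X)) N \<and> F0 \<in> N \<and> (\<forall>F\<in>N. s_AP v X F \<inter> V \<noteq> {})"
proof -
  obtain G where G: "G \<in> PP v X" "G \<le> F0" "G \<in> V" using V(2) by (auto simp: s_AP_def)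
  obtain H where H: "finite H" "H \<subseteq> LX X" "\<forall>k\<in>H. 1 < G k"
    "\<forall>G'\<in>PP v X. (\<forall>k\<in>H. 1 < G' k) \<longrightarrow> G' \<in> V"
    using weak_open_half_spaces[OF V(1) G(3) subset_refl] by metis
  show ?thesis
  proof (cases "H = {}")
    case True
    then have "s_AP v X F \<inter> V \<noteq> {}" if "F \<in> PAP v X" for F
      using s_AP_nonempty[OF R that] H(4) by (auto simp: s_AP_def)
    with F0 show ?thesis by (metis openin_topspace topspace_weak)
  next
    case ne: False
    obtain s where s: "1 < s" "\<And>k. k \<in> H \<Longrightarrow> ennreal s \<le> G k"
      using finite_gt_one[OF H(1), of G] H(3) by metis
    (* It is enough to test finitely many grid points of the simplex of weights. *)
    define n where "n = real (card H)"
    \<comment> \<open>Rounding loses at most \<open>1 / N\<close> per weight, hence at most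
      \<open>n / N\<close> in total; \<open>N\<close> is so large that the margin \<open>s\<close>
      absorbs this loss.\<close>
    define N where "N = nat \<lceil>n * s / (s - 1)\<rceil> + 1"
    have N: "1 < s * (1 - n / real N)" "0 < real N"
    proof -
      have "n * s / (s - 1) < real N" unfolding N_def by linarith
      with s(1) have "n * s < real N * (s - 1)" by (simp add: field_simps)
      then show "1 < s * (1 - n / real N)" by (simp add: N_def field_simps)
      show "0 < real N" by (simp add: N_def)
    qed
    let ?c = "\<lambda>d k. real (d k) / real N"
    define D where "D = {d \<in> PiE H (\<lambda>_. {..N}). 1 < s * sum (?c d) H}"
    have finD: "finite D" unfolding D_def by (rule finite_subset[OF _ finite_PiE[OF H(1), of "\<lambda>_. {..N}"]]) auto
    define W where "W = {F \<in> PAP v X. \<forall>d\<in>D. 1 < F (comb (?c d) H)}"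
    have "W = (\<Inter>d\<in>D. {F \<in> PAP v X. 1 < F (comb (?c d) H)}) \<inter> PAP v X"
      by (auto simp: W_def)
    moreover have "openin (weak_topology X (PAP v X)) \<dots>"
    proof -
      have PAP: "openin (weak_topology X (PAP v X)) (PAP v X)" by (metis openin_topspace topspace_weak)
      show ?thesis
      proof (cases "D = {}")
        case False
        with finD PAP show ?thesis
          by (intro openin_Int openin_Inter) (auto intro!: openin_weak_subbase LX_comb H(1,2))
      qed (simp add: PAP)
    qed
    ultimately have "openin (weak_topology X (PAP v X)) W" by simp
    moreover have "F0 \<in> W"
      unfolding W_def
    proof (intro CollectI conjI ballI F0)
      fix d assume d: "d \<in> D"
      then have "1 < ennreal (s * sum (?c d) H)" by (simp add: D_def ennreal_less_iff flip: ennreal_1)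
      also have "\<dots> \<le> (\<Sum>k\<in>H. ennreal (?c d k) * G k)" using s by (intro sum_weights_ge) auto
      also have "\<dots> = G (comb (?c d) H)"
        using linear_comb[OF PP_linear[OF G(1)] H(1,2)] by simp
      also have "\<dots> \<le> F0 (comb (?c d) H)" using G(2) by (simp add: le_fun_def)
      finally show "1 < F0 (comb (?c d) H)" .
    qed
    moreover have "s_AP v X F \<inter> V \<noteq> {}" if "F \<in> W" for F
    proof
      assume empty: "s_AP v X F \<inter> V = {}"
      have F: "F \<in> PAP v X" using that by (simp add: W_def)
      have le: "\<exists>k\<in>H. G' k \<le> 1" if "G' \<in> s_AP v X F" for G'
        using H(4) that empty by (metis (no_types, lifting) disjoint_iff mem_Collect_eq not_le s_AP_def)
      have "fconv (s_AP v X F)" using s_AP_Hcvx[OF R F] by (simp add: Hcvx_iff)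
      from minimax_le[OF H(1) ne this le] obtain c where c: "\<And>k. k \<in> H \<Longrightarrow> 0 \<le> c k" "sum c H = 1"
        "\<And>G'. G' \<in> s_AP v X F \<Longrightarrow> (\<Sum>k\<in>H. ennreal (c k) * G' k) \<le> 1" by blast
      have c1: "c k \<le> 1" if "k \<in> H" for k
        using member_le_sum[OF that, of c] c(1,2) H(1) by auto
      have "F (comb c H) = r_AP (s_AP v X F) (comb c H)" by (simp add: r_AP_s_AP[OF R F])
      also have "\<dots> \<le> 1"
        unfolding r_AP_def
      proof (rule SUP_least)
        fix G' assume "G' \<in> s_AP v X F"
        then show "G' (comb c H) \<le> 1"
          using c linear_comb[OF PP_linear H(1,2) c(1), of G' v] by (simp add: s_AP_def)
      qed
      finally have Fc: "F (comb c H) \<le> 1" .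
      \<comment> \<open>Rounding down keeps the grid combination below the original one, so
        monotonicity of \<open>F\<close> applies.\<close>
      define d where "d = restrict (\<lambda>k. nat \<lfloor>real N * c k\<rfloor>) H"
      have fl: "real (d k) \<le> real N * c k" "real N * c k - 1 \<le> real (d k)" if "k \<in> H" for k
      proof -
        have "0 \<le> real N * c k" using c(1)[OF that] by simp
        then show "real (d k) \<le> real N * c k" "real N * c k - 1 \<le> real (d k)"
          using that by (simp_all add: d_def)
      qed
      have dle: "?c d k \<le> c k" if "k \<in> H" for k
        using fl(1)[OF that] N(2) by (simp add: field_simps)
      have "(\<Sum>k\<in>H. c k - 1 / real N) \<le> sum (?c d) H"
      proof (rule sum_mono)
        fix k assume "k \<in> H"
        from divide_right_mono[OF fl(2)[OF this], of "real N"] N(2)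
        show "c k - 1 / real N \<le> ?c d k" by (simp add: diff_divide_distrib)
      qed
      then have "1 - n / real N \<le> sum (?c d) H" by (simp add: sum_subtractf c(2) n_def)
      then have "1 < s * sum (?c d) H"
        using N(1) s(1) by (meson less_le_trans mult_left_mono less_imp_le less_trans zero_less_one)
      moreover have "d k \<le> N" if "k \<in> H" for k
      proof -
        have "real (d k) \<le> real N * 1"
          by (rule order_trans[OF fl(1)[OF that]]) (intro mult_left_mono c1 that; simp)
        then show ?thesis by simp
      qed
      ultimately have "d \<in> D" by (auto simp: D_def d_def)
      with that have "1 < F (comb (?c d) H)" by (simp add: W_def)
      also have "\<dots> \<le> F (comb c H)"
        using F dle by (intro sublin_mono[of X F] comb_mono LX_comb H(1,2)) (auto simp: PAP_def hoare_prevision_iff)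
      finally show False using Fc by simp
    qed
    ultimately show ?thesis by blast
  qed
qed

lemma continuous_s_AP:
  assumes R: "representable v X"
  shows "continuous_map (weak_topology X (PAP v X)) (subtopology (lower_vietoris (weak_topology X (PP v X))) (Hcvx v X)) (s_AP v X)"
proof -
  let ?W = "weak_topology X (PP v X)" and ?A = "weak_topology X (PAP v X)"
  let ?B = "insert (Hset ?W) {{C \<in> Hset ?W. C \<inter> V \<noteq> {}} | V. openin ?W V}"
  have mem: "s_AP v X F \<in> Hcvx v X" if "F \<in> PAP v X" for F using s_AP_Hcvx[OF R that] .
  have "openin ?A (s_AP v X -` U \<inter> topspace ?A)" if "U \<in> ?B" for U
  proof (cases "U = Hset ?W")
    case True
    then have "s_AP v X -` U \<inter> topspace ?A = topspace ?A" using mem by (auto simp: Hcvx_def)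
    then show ?thesis by (metis openin_topspace)
  next
    case False
    with that obtain V where V: "U = {C \<in> Hset ?W. C \<inter> V \<noteq> {}}" "openin ?W V" by blast
    have "\<exists>N. openin ?A N \<and> F \<in> N \<and> N \<subseteq> s_AP v X -` U \<inter> topspace ?A" if "F \<in> s_AP v X -` U \<inter> topspace ?A" for F
    proof -
      have F: "F \<in> PAP v X" "s_AP v X F \<inter> V \<noteq> {}" using that V(1) by auto
      obtain N where N: "openin ?A N" "F \<in> N" "\<And>F. F \<in> N \<Longrightarrow> s_AP v X F \<inter> V \<noteq> {}"
        using s_AP_meets_open[OF R F(1) V(2) F(2)] by blast
      have "N \<subseteq> PAP v X" using openin_subset[OF N(1)] by simp
      with N mem show ?thesis by (intro exI[of _ N]) (auto simp: V(1) Hcvx_def)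
    qed
    then show ?thesis by (subst openin_subopen) blast
  qed
  moreover have "s_AP v X ` topspace ?A \<subseteq> \<Union>?B" using mem by (auto simp: Hcvx_def)
  ultimately have "continuous_map ?A (lower_vietoris ?W) (s_AP v X)"
    unfolding lower_vietoris_def by (rule continuous_on_generated_topo)
  with mem show ?thesis by (auto simp: continuous_map_in_subtopology)
qed

theorem representable_imp_homeomorphic:
  assumes R: "representable v X"
  shows "homeomorphic_maps
           (subtopology (lower_vietoris (weak_topology X (PP v X))) (Hcvx v X))
           (weak_topology X (PAP v X)) r_AP (s_AP v X)
       \<and> bij_betw r_AP (Hcvx v X) (PAP v X)
       \<and> (\<forall>F\<in>PAP v X. r_AP (s_AP v X F) = F)
       \<and> (\<forall>E\<in>Hcvx v X. \<forall>E'\<in>Hcvx v X. E \<subseteq> E' \<longleftrightarrow> r_AP E \<le> r_AP E')"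
proof (intro conjI ballI)
  have PAP: "r_AP C \<in> PAP v X" if "C \<in> Hcvx v X" for C
    using that Hcvx_subset[OF that] by (intro r_AP_PAP) (auto simp: Hcvx_iff)
  show "homeomorphic_maps
           (subtopology (lower_vietoris (weak_topology X (PP v X))) (Hcvx v X))
           (weak_topology X (PAP v X)) r_AP (s_AP v X)"
    unfolding homeomorphic_maps_def
    by (simp add: continuous_r_AP continuous_s_AP[OF R] s_AP_r_AP r_AP_s_AP[OF R])
  show "bij_betw r_AP (Hcvx v X) (PAP v X)"
    by (rule bij_betw_byWitness[where f' = "s_AP v X"])
      (use s_AP_r_AP r_AP_s_AP[OF R] PAP s_AP_Hcvx[OF R] in auto)
  show "r_AP (s_AP v X F) = F" if "F \<in> PAP v X" for F using r_AP_s_AP[OF R that] .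
  show "E \<subseteq> E' \<longleftrightarrow> r_AP E \<le> r_AP E'" if E: "E \<in> Hcvx v X" "E' \<in> Hcvx v X" for E E'
  proof
    assume "E \<subseteq> E'"
    then show "r_AP E \<le> r_AP E'" by (auto simp: r_AP_def le_fun_def intro: SUP_subset_mono)
  next
    assume "r_AP E \<le> r_AP E'"
    then have "s_AP v X (r_AP E) \<subseteq> s_AP v X (r_AP E')" by (auto simp: s_AP_def)
    with s_AP_r_AP E show "E \<subseteq> E'" by metis
  qed
qed

section \<open>Linear previsions below a Hoare prevision\<close>

text \<open>The factor is \<open>1 / b\<close> with \<open>r < b < F h\<close>, so that the weak
  bound \<open>1 \<le> G (p \<odot> h)\<close> still returns a strict bound at
  \<open>h\<close>.\<close>

lemma scale_to_one:
  assumes F: "sublin X F" and h: "h \<in> LX X" and r: "r < F h"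
  shows "\<exists>p. p \<odot> h \<in> LX X \<and> 1 < F (p \<odot> h) \<and> (\<forall>G. sublin X G \<longrightarrow> 1 \<le> G (p \<odot> h) \<longrightarrow> r < G h)"
proof -
  obtain q where q: "r < q" "q < F h" using dense[OF r] by blast
  then obtain b where b: "q = ennreal b" "0 \<le> b" by (cases q) (auto simp: top_unique less_top[symmetric])
  have "b \<noteq> 0" using q b by auto
  with b have pos: "0 < b" by simp
  have eq: "G ((1 / b) \<odot> h) = ennreal (1 / b) * G h" if "sublin X G" for G
    using pos by (intro sublin_smul[OF that] h) auto
  show ?thesis
  proof (intro exI[of _ "1 / b"] conjI allI impI)
    show "(1 / b) \<odot> h \<in> LX X" by (rule LX_smul[OF h])
    show "1 < F ((1 / b) \<odot> h)" using q one_less_scale_iff[OF pos] b by (simp add: eq[OF F])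
    fix G assume G: "sublin X G" "1 \<le> G ((1 / b) \<odot> h)"
    have "ennreal b * 1 \<le> ennreal b * (ennreal (1 / b) * G h)"
      using G(2) unfolding eq[OF G(1)] by (rule mult_left_mono) simp
    also have "\<dots> = G h" using pos by (simp add: mult.assoc[symmetric] ennreal_mult[symmetric])
    finally show "r < G h" using q(1) b(1) by simp
  qed
qed

text \<open>The shift condition is a parameter: \<open>E\<close> is empty when no mass is prescribed
  and contains the constant map 1 when \<open>X\<close> is compact and \<open>F\<close>
  normalized.\<close>

lemma linear_below_of_nbhd:
  assumes F: "sublin X F" and lc: "LX_locally_convex X" and sc: "sc X F"
    and h: "h \<in> LX X" "1 < F h"
    and E: "E \<subseteq> LX X" "shifts X E F"
    and hull: "\<And>P. sublin X P \<Longrightarrow> shifts X E P \<Longrightarrow> shifts X E (sc_hull X P)"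
  shows "\<exists>G. linear_prevision X G \<and> G \<le> F \<and> 1 \<le> G h \<and> shifts X E G"
proof -
  have "openin (LX_scott X) {y \<in> LX X. 1 < F y}" using sc by (simp add: sc_iff_openin)
  with lc h obtain V where V: "openin (LX_scott X) V" "LX_convex X V"
      "h \<in> V" "V \<subseteq> {y \<in> LX X. 1 < F y}"
    unfolding locally_convex_cone_def topspace_LX_scott by (metis (no_types, lifting) mem_Collect_eq)
  have ne: "V \<noteq> {}" using V(3) by blast
  have VF: "1 \<le> F u" if "u \<in> V" for u using V(4) that by (auto intro: less_imp_le)
  show ?thesis
    by (rule separation[OF F V(1,2) ne VF E hull]) (use V(3) in blast)+
qed

lemma linear_below:
  assumes F: "hoare_prevision X F" and lc: "LX_locally_convex X"
    and h: "h \<in> LX X" "1 < F h"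
  shows "\<exists>G. linear_prevision X G \<and> G \<le> F \<and> 1 \<le> G h"
proof -
  have F: "sublin X F" "sc X F" using F by (simp_all add: hoare_prevision_iff)
  have "shifts X {} P" for P by (simp add: shifts_def)
  from linear_below_of_nbhd[OF F(1) lc F(2) h empty_subsetI this this] show ?thesis by blast
qed

lemma representableI:
  assumes "\<And>F h. F \<in> PAP v X \<Longrightarrow> h \<in> LX X \<Longrightarrow> 1 < F h \<Longrightarrow> \<exists>G\<in>PP v X. G \<le> F \<and> 1 \<le> G h"
  shows "representable v X"
  unfolding representable_def
proof (intro ballI allI impI)
  fix F h r assume F: "F \<in> PAP v X" and h: "h \<in> LX X" "r < F h"
  then have "sublin X F" by (simp add: PAP_def hoare_prevision_iff)
  from scale_to_one[OF this h] obtain p where p: "p \<odot> h \<in> LX X" "1 < F (p \<odot> h)"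
    "\<forall>G. sublin X G \<longrightarrow> 1 \<le> G (p \<odot> h) \<longrightarrow> r < G h" by blast
  from assms[OF F p(1,2)] obtain G where G: "G \<in> PP v X" "G \<le> F" "1 \<le> G (p \<odot> h)" by blast
  then have "r < G h" using p(3) linear_sublin[OF PP_linear] by blast
  with G show "\<exists>G\<in>PP v X. G \<le> F \<and> r < G h" by blast
qed

section \<open>Previsions without condition and subnormalized previsions\<close>

lemma representable_NoCond:
  assumes "LX_locally_convex X"
  shows "representable NoCond X"
proof (rule representableI)
  fix F h assume "F \<in> PAP NoCond X" "h \<in> LX X" "1 < F h"
  then show "\<exists>G\<in>PP NoCond X. G \<le> F \<and> 1 \<le> G h"
    using linear_below[OF _ assms, of F h] by (auto simp: PAP_def PP_def norm_cond_def)
qed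

text \<open>\<open>G \<le> F\<close> already bounds the total mass of \<open>G\<close> by 1, and for
  a linear prevision this bound is subnormalization.\<close>

lemma representable_SubNorm:
  assumes "LX_locally_convex X"
  shows "representable SubNorm X"
proof (rule representableI)
  fix F h assume F: "F \<in> PAP SubNorm X" and h: "h \<in> LX X" "1 < F h"
  then have FH: "hoare_prevision X F" by (simp add: PAP_def)
  have "\<forall>h\<in>LX X. F (LX_one X \<oplus> h) \<le> 1 + F h"
    using F by (simp add: PAP_def norm_cond_def)
  from bspec[OF this LX_zero] have "F (LX_one X \<oplus> (\<lambda>_. 0)) \<le> 1 + F (\<lambda>_. 0)" .
  then have F1: "F (LX_one X) \<le> 1"
    using sublin_zero[of X F] FH by (simp add: hoare_prevision_iff)
  obtain G where G: "linear_prevision X G" "G \<le> F" "1 \<le> G h"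
    using linear_below[OF FH assms h] by blast
  have "G (LX_one X) \<le> F (LX_one X)" using G(2) by (simp add: le_fun_def)
  then have "G (LX_one X) \<le> 1" using F1 by (rule order_trans)
  then have "norm_cond SubNorm X G"
    by (auto simp: norm_cond_def linear_add[OF G(1) LX_one] intro: add_right_mono)
  with G show "\<exists>G\<in>PP SubNorm X. G \<le> F \<and> 1 \<le> G h" by (auto simp: PP_def)
qed

section \<open>Normalized previsions on a compact space\<close>

lemma PP_NormI:
  assumes "linear_prevision X G" "G (LX_one X) = 1"
  shows "G \<in> PP Norm X"
  using assms by (simp add: PP_def norm_cond_def linear_add LX_one)

text \<open>Normalization speaks of adding the map 1 once; homogeneity extends it to every positive
  multiple.\<close>

lemma PAP_Norm_shifts:
  assumes F: "F \<in> PAP Norm X"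
  shows "shifts X {LX_one X} F"
  unfolding shifts_def
proof (intro ballI allI impI)
  fix e x and a :: real assume e: "e \<in> {LX_one X}" and x: "x \<in> LX X" and a: "0 \<le> a"
  have sub: "sublin X F" using F by (simp add: PAP_def hoare_prevision_iff)
  show "F x + ennreal a \<le> F (x \<oplus> a \<odot> e)"
  proof (cases "a = 0")
    case False
    with a have pos: "0 < a" by simp
    have eq: "x \<oplus> a \<odot> e = a \<odot> (LX_one X \<oplus> (1 / a) \<odot> x)"
      using pos e by (simp add: LX_smul_add LX_smul_smul LX_add_commute)
    have "F (x \<oplus> a \<odot> e) = ennreal a * F (LX_one X \<oplus> (1 / a) \<odot> x)"
      unfolding eq by (intro sublin_smul[OF sub] a LX_add LX_one LX_smul x)
    also have "F (LX_one X \<oplus> (1 / a) \<odot> x) = 1 + F ((1 / a) \<odot> x)"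
      using F LX_smul[OF x] by (simp add: PAP_def norm_cond_def)
    also have "F ((1 / a) \<odot> x) = ennreal (1 / a) * F x"
      using pos by (intro sublin_smul[OF sub] x) simp
    also have "ennreal a * (1 + ennreal (1 / a) * F x) = ennreal a + (ennreal a * ennreal (1 / a)) * F x"
      by (simp add: distrib_left mult.assoc)
    also have "ennreal a * ennreal (1 / a) = 1"
      using pos by (simp add: ennreal_mult[symmetric])
    finally show ?thesis by (simp add: add.commute)
  qed simp
qed

lemma directed_in_finite:
  assumes "directed_in P D" "finite A" "A \<subseteq> D"
  shows "\<exists>d\<in>D. \<forall>a\<in>A. a \<le> d"
  using assms(2,3)
proof (induction A rule: finite_induct)
  case (insert a A)
  then obtain d where d: "d \<in> D" "\<forall>a\<in>A. a \<le> d" by auto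
  moreover have "a \<in> D" using insert by simp
  ultimately obtain d' where "d' \<in> D" "d \<le> d'" "a \<le> d'"
    using assms(1) unfolding directed_in_def by blast
  with d(2) show ?case by (auto intro: order_trans)
qed (use assms(1) in \<open>auto simp: directed_in_def\<close>)

text \<open>If a directed supremum exceeds \<open>c\<close> on \<open>Q\<close>, the superlevel sets
  of its members cover \<open>Q\<close>; a finite subcover and directedness give one member
  exceeding \<open>c\<close> on all of \<open>Q\<close>.\<close>

lemma open_gt_on_compact:
  assumes Q: "compactin X Q"
  shows "openin (LX_scott X) {y \<in> LX X. \<forall>x\<in>Q. c < y x}"
  unfolding openin_LX_scott
proof (intro conjI allI impI ballI)
  fix y z assume "y \<in> {y \<in> LX X. \<forall>x\<in>Q. c < y x}" "z \<in> LX X" "y \<le> z"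
  then show "z \<in> {y \<in> LX X. \<forall>x\<in>Q. c < y x}" by (auto simp: le_fun_def intro: less_le_trans)
next
  fix D assume D: "directed_in (LX X) D" and S: "Sup D \<in> {y \<in> LX X. \<forall>x\<in>Q. c < y x}"
  have DL: "D \<subseteq> LX X" using D by (simp add: directed_in_def)
  let ?\<U> = "(\<lambda>d. {x. c < d x}) ` D"
  have "\<forall>U\<in>?\<U>. openin X U" using DL by (auto simp: LX_iff)
  moreover have "Q \<subseteq> \<Union>?\<U>"
  proof
    fix x assume "x \<in> Q"
    with S have "c < (SUP d\<in>D. d x)" by simp
    then show "x \<in> \<Union>?\<U>" by (auto simp: less_SUP_iff)
  qed
  ultimately obtain \<F> where \<F>: "finite \<F>" "\<F> \<subseteq> ?\<U>" "Q \<subseteq> \<Union>\<F>"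
    using Q unfolding compactin_def by meson
  then obtain A where A: "finite A" "A \<subseteq> D" "\<F> = (\<lambda>d. {x. c < d x}) ` A"
    by (metis finite_subset_image)
  obtain d where d: "d \<in> D" "\<forall>a\<in>A. a \<le> d" using directed_in_finite[OF D A(1,2)] by blast
  have "c < d x" if "x \<in> Q" for x
  proof -
    from that \<F>(3) have "x \<in> \<Union>\<F>" by blast
    then obtain a where "a \<in> A" "c < a x" unfolding A(3) by blast
    with d(2) show ?thesis by (auto simp: le_fun_def intro: less_le_trans)
  qed
  with d(1) DL show "\<exists>d\<in>D. d \<in> {y \<in> LX X. \<forall>x\<in>Q. c < y x}" by auto
qed auto

lemma sc_restrict:
  assumes U: "openin (LX_scott X) U" and sc: "sc X \<psi>"
  shows "sc X (\<lambda>y. if y \<in> U then \<psi> y else 0)"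
proof -
  have "{h \<in> LX X. r < (if h \<in> U then \<psi> h else 0)} = U \<inter> {h \<in> LX X. r < \<psi> h}" for r
    using openin_subset[OF U] by auto
  with U sc show ?thesis by (simp add: sc_iff_openin openin_Int)
qed

lemma sc_const: "sc X (\<lambda>_. c)"
  by (auto simp: sc_def directed_in_def)

lemma sc_diff_arg:
  assumes sc: "sc X \<psi>" and c: "c \<noteq> top"
  shows "sc X (\<lambda>y. \<psi> (\<lambda>x. y x - c))"
proof (rule sc_compose[OF sc])
  fix D :: "('a \<Rightarrow> ennreal) set"
  show "(\<lambda>x. Sup D x - c) = (SUP d\<in>D. (\<lambda>x. d x - c))"
  proof
    fix x
    have "(SUP d\<in>D. d x) - c \<le> (SUP d\<in>D. d x - c)"
    proof -
      have "d x \<le> c + (SUP d\<in>D. d x - c)" if "d \<in> D" for d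
        using SUP_upper[OF that, of "\<lambda>d. d x - c"] c by (simp add: ennreal_minus_le_iff)
      then show ?thesis using c by (simp add: ennreal_minus_le_iff SUP_least)
    qed
    moreover have "(SUP d\<in>D. d x - c) \<le> (SUP d\<in>D. d x) - c"
      by (intro SUP_least ennreal_minus_mono SUP_upper) auto
    ultimately show "Sup D x - c = (SUP d\<in>D. (\<lambda>x. d x - c)) x"
      by (simp add: image_image)
  qed
qed (use c in \<open>auto intro: LX_diff ennreal_minus_mono simp: le_fun_def\<close>)

text \<open>Compactness makes \<open>?U\<close>, the maps exceeding \<open>c\<close> everywhere,
  Scott-open. On it \<open>?\<phi>\<close> subtracts \<open>c\<close> from the argument and adds it
  to the value; this is Scott-continuous and, since \<open>P\<close> shifts, below \<open>P\<close>,
  hence below the hull. At \<open>x \<oplus> a \<odot> e\<close> the argument left after subtraction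
  is at least \<open>x\<close>.\<close>

lemma shifts_sc_hull:
  assumes X: "compact_space X" and P: "sublin X P" and sh: "shifts X {LX_one X} P"
  shows "shifts X {LX_one X} (sc_hull X P)"
  unfolding shifts_def
proof (intro ballI allI impI)
  fix e x and a :: real assume e: "e \<in> {LX_one X}" and x: "x \<in> LX X" and a: "0 \<le> a"
  let ?Q = "sc_hull X P" and ?y = "x \<oplus> a \<odot> e"
  have y: "?y \<in> LX X" using e x by (auto intro: LX_add LX_smul LX_one)
  \<comment> \<open>A strictly smaller \<open>c\<close> puts \<open>?y\<close> into the open set
    \<open>?U\<close>; the shift by \<open>a\<close> itself is recovered as a limit.\<close>
  have step: "?Q x + ennreal c \<le> ?Q ?y" if c: "0 \<le> c" "c < a" for c
  proof -
    let ?U = "{y \<in> LX X. \<forall>x\<in>topspace X. ennreal c < y x}"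
    let ?\<phi> = "\<lambda>y. if y \<in> ?U then ?Q (\<lambda>x. y x - ennreal c) + ennreal c else 0"
    have U: "openin (LX_scott X) ?U" using X by (intro open_gt_on_compact) (simp add: compact_space_def)
    have "?\<phi> ?y \<le> ?Q ?y"
    proof (rule sc_hull_greatest[OF _ _ y])
      show "sc X ?\<phi>"
        by (intro sc_restrict U sc_add sc_const sc_diff_arg sc_sc_hull) simp
      fix z assume z: "z \<in> LX X"
      have "?Q (\<lambda>x. z x - ennreal c) + ennreal c \<le> P z" if "z \<in> ?U"
      proof -
        have "?Q (\<lambda>x. z x - ennreal c) + ennreal c \<le> P (\<lambda>x. z x - ennreal c) + ennreal c"
          using sc_hull_le[of X P] by (intro add_right_mono) (simp add: le_fun_def)
        also have "\<dots> \<le> P ((\<lambda>x. z x - ennreal c) \<oplus> c \<odot> LX_one X)"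
          using sh c LX_diff[OF z, of "ennreal c"] by (simp add: shifts_def)
        also have "(\<lambda>x. z x - ennreal c) \<oplus> c \<odot> LX_one X = z"
        proof
          fix u
          show "((\<lambda>x. z x - ennreal c) \<oplus> c \<odot> LX_one X) u = z u"
          proof (cases "u \<in> topspace X")
            case True
            then have "ennreal c \<le> z u" using that by (auto intro: less_imp_le)
            then show ?thesis using True
              by (simp add: LX_add_def LX_smul_def LX_one_def diff_add_cancel_ennreal)
          next
            case False
            then show ?thesis using LX_outside[OF z] by (simp add: LX_add_def LX_smul_def LX_one_def)
          qed
        qed
        finally show ?thesis .
      qed
      then show "?\<phi> z \<le> P z" by auto
    qed
    moreover have "?y \<in> ?U"
    proof -
      have "ennreal c < ?y u" if "u \<in> topspace X" for u
      proof -
        have "ennreal c < ennreal a" using c by (simp add: ennreal_less_iff)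
        also have "\<dots> \<le> ?y u" using that e by (simp add: LX_add_def LX_smul_def LX_one_def)
        finally show ?thesis .
      qed
      with y show ?thesis by blast
    qed
    moreover have "?Q x \<le> ?Q (\<lambda>u. ?y u - ennreal c)"
    proof (rule sc_mono[OF sc_sc_hull x])
      show "(\<lambda>u. ?y u - ennreal c) \<in> LX X" by (rule LX_diff[OF y]) simp
      show "x \<le> (\<lambda>u. ?y u - ennreal c)"
      proof (rule le_funI)
        fix u show "x u \<le> ?y u - ennreal c"
        proof (cases "u \<in> topspace X")
          case True
          have "x u + ennreal c \<le> x u + ennreal a" using c by (intro add_left_mono ennreal_leI) simp
          then show ?thesis
            using True e by (simp add: LX_add_def LX_smul_def LX_one_def ennreal_le_minus_iff)
        next
          case False
          then show ?thesis using LX_outside[OF x] by simp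
        qed
      qed
    qed
    ultimately show ?thesis by (auto intro: order_trans[OF add_right_mono])
  qed
  show "?Q x + ennreal a \<le> ?Q ?y"
  proof (cases "a = 0")
    case False
    show ?thesis
    proof (rule ennreal_le_epsilon)
      fix d :: real assume "0 < d"
      define c where "c = max 0 (a - d)"
      have c: "0 \<le> c" "c < a" "a \<le> c + d" using a False \<open>0 < d\<close> by (auto simp: c_def)
      have "?Q x + ennreal a \<le> (?Q x + ennreal c) + ennreal d"
        using c \<open>0 < d\<close> by (simp add: add.assoc add_left_mono ennreal_leI flip: ennreal_plus)
      also have "\<dots> \<le> ?Q ?y + ennreal d" by (intro add_right_mono step c)
      finally show "?Q x + ennreal a \<le> ?Q ?y + ennreal d" .
    qed
  qed simp
qed

lemma representable_Norm_compact:
  assumes X: "compact_space X" and lc: "LX_locally_convex X"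
  shows "representable Norm X"
proof (rule representableI)
  fix F h assume F: "F \<in> PAP Norm X" and h: "h \<in> LX X" "1 < F h"
  then have FH: "sublin X F" "sc X F" by (auto simp: PAP_def hoare_prevision_iff)
  obtain G where G: "linear_prevision X G" "G \<le> F" "1 \<le> G h" "shifts X {LX_one X} G"
    using linear_below_of_nbhd[OF FH(1) lc FH(2) h _ PAP_Norm_shifts[OF F] shifts_sc_hull[OF X]] LX_one[of X]
    by blast
  have "G (\<lambda>_. 0) + ennreal 1 \<le> G ((\<lambda>_. 0) \<oplus> 1 \<odot> LX_one X)"
    by (rule G(4)[unfolded shifts_def, rule_format]) auto
  then have "1 \<le> G (LX_one X)" using sublin_zero[OF linear_sublin[OF G(1)]] by simp
  moreover have "G (LX_one X) \<le> 1" using G(2) Norm_one[OF F] by (metis le_fun_def)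
  ultimately have "G \<in> PP Norm X" by (intro PP_NormI G antisym)
  with G show "\<exists>G\<in>PP Norm X. G \<le> F \<and> 1 \<le> G h" by blast
qed

section \<open>Convex compact sets of maps\<close>

text \<open>The Scott topology on the half-line is coarser than the euclidean one, so the compact
  euclidean interval can parametrize scalars.\<close>

lemma openin_Rplus_scott_imp:
  assumes U: "openin Rplus_scott U"
  shows "openin (top_of_set {0..}) U"
proof -
  have so: "U \<subseteq> {0..}" "\<And>x y. x \<in> U \<Longrightarrow> x \<le> y \<Longrightarrow> 0 \<le> y \<Longrightarrow> y \<in> U"
    "\<And>D s. directed_in {0..} D \<Longrightarrow> is_lub_in {0..} D s \<Longrightarrow> s \<in> U \<Longrightarrow> D \<inter> U \<noteq> {}"
    using U unfolding Rplus_scott_def openin_scott_topology scott_open_def by auto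
  have "\<exists>V. open V \<and> x \<in> V \<and> {0..} \<inter> V \<subseteq> U" if x: "x \<in> U" for x
  proof (cases "x = 0")
    case True
    with so(2)[OF x] show ?thesis by (intro exI[of _ UNIV]) auto
  next
    case False
    with so(1) x have pos: "0 < x" by fastforce
    have "directed_in {0..} {0..<x}"
      unfolding directed_in_def
    proof (intro conjI ballI)
      fix a b assume "a \<in> {0..<x}" "b \<in> {0..<x}"
      then show "\<exists>z\<in>{0..<x}. a \<le> z \<and> b \<le> z" by (intro bexI[of _ "max a b"]) auto
    qed (use pos in auto)
    moreover have "is_lub_in {0..} {0..<x} x"
      unfolding is_lub_in_def
    proof (intro conjI ballI impI)
      fix u :: real assume u: "u \<in> {0..}" "\<forall>d\<in>{0..<x}. d \<le> u"
      show "x \<le> u"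
      proof (rule ccontr)
        assume "\<not> x \<le> u"
        with u(1) have "(u + x) / 2 \<in> {0..<x}" "u < (u + x) / 2" by auto
        with u(2) have "(u + x) / 2 \<le> u" by blast
        with \<open>u < (u + x) / 2\<close> show False by simp
      qed
    qed (use pos in auto)
    ultimately have "{0..<x} \<inter> U \<noteq> {}" using x by (rule so(3))
    then obtain y where y: "0 \<le> y" "y < x" "y \<in> U" by auto
    have "{0..} \<inter> {y<..} \<subseteq> U" using so(2)[OF y(3)] by auto
    with y(2) show ?thesis by (intro exI[of _ "{y<..}"]) auto
  qed
  then obtain V where V: "\<And>x. x \<in> U \<Longrightarrow> open (V x) \<and> x \<in> V x \<and> {0..} \<inter> V x \<subseteq> U" by metis
  have "U = {0..} \<inter> (\<Union>x\<in>U. V x)" using V so(1) by blast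
  moreover have "open (\<Union>x\<in>U. V x)" using V by blast
  ultimately show ?thesis by (metis openin_open)
qed

lemma continuous_map_into_Rplus_scott:
  assumes "continuous_map T euclideanreal f" "\<And>x. x \<in> topspace T \<Longrightarrow> 0 \<le> f x"
  shows "continuous_map T Rplus_scott f"
  unfolding continuous_map_def
proof (intro conjI allI impI)
  show "f \<in> topspace T \<rightarrow> topspace Rplus_scott" using assms(2) by (auto simp: Rplus_scott_def)
  have "continuous_map T (top_of_set {0..}) f"
    using assms by (auto simp: continuous_map_in_subtopology)
  then show "openin T {x \<in> topspace T. f x \<in> U}" if "openin Rplus_scott U" for U
    using openin_Rplus_scott_imp[OF that] by (rule openin_continuous_map_preimage)
qed

definition cvx_compact :: "'a topology \<Rightarrow> ('a \<Rightarrow> ennreal) set \<Rightarrow> bool" where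
  "cvx_compact X K \<longleftrightarrow> compactin (LX_scott X) K \<and> LX_convex X K \<and> K \<noteq> {}"

text \<open>For nonempty convex \<open>K\<close> and \<open>K'\<close> this is the convex hull of
  their union, presented as the image of a product with the unit interval.\<close>

definition hull2 :: "('a \<Rightarrow> ennreal) set \<Rightarrow> ('a \<Rightarrow> ennreal) set \<Rightarrow> ('a \<Rightarrow> ennreal) set" where
  "hull2 K K' = {a \<odot> k \<oplus> (1 - a) \<odot> k' | a k k'. 0 \<le> a \<and> a \<le> 1 \<and> k \<in> K \<and> k' \<in> K'}"

lemma hull2_superset:
  assumes "K \<noteq> {}" "K' \<noteq> {}"
  shows "K \<subseteq> hull2 K K'" "K' \<subseteq> hull2 K K'"
proof -
  obtain k0 k0' where "k0 \<in> K" "k0' \<in> K'" using assms by blast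
  then show "K \<subseteq> hull2 K K'"
    unfolding hull2_def by (intro subsetI CollectI) (rule exI[of _ 1], auto)
  show "K' \<subseteq> hull2 K K'"
    using \<open>k0 \<in> K\<close> unfolding hull2_def by (intro subsetI CollectI) (rule exI[of _ 0], auto)
qed

lemma hull2_subset:
  assumes "LX_convex X W" "K \<subseteq> W" "K' \<subseteq> W"
  shows "hull2 K K' \<subseteq> W"
  using assms unfolding hull2_def cone_convex_def by blast

text \<open>The four terms of a combination are regrouped by the set they come from and combined
  inside \<open>K\<close> and inside \<open>K'\<close>.\<close>

lemma cone_convex_hull2:
  assumes K: "LX_convex X K" "LX_convex X K'"
  shows "LX_convex X (hull2 K K')"
  unfolding cone_convex_def
proof (intro conjI ballI allI impI)
  show "hull2 K K' \<subseteq> topspace (LX_scott X)"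
    using K unfolding hull2_def cone_convex_def by (auto intro!: LX_add LX_smul)
  fix x y and t :: real assume x: "x \<in> hull2 K K'" and y: "y \<in> hull2 K K'" and t: "0 \<le> t \<and> t \<le> 1"
  obtain a k k' where x: "x = a \<odot> k \<oplus> (1 - a) \<odot> k'" "0 \<le> a" "a \<le> 1" "k \<in> K" "k' \<in> K'"
    using x unfolding hull2_def by blast
  obtain b l l' where y: "y = b \<odot> l \<oplus> (1 - b) \<odot> l'" "0 \<le> b" "b \<le> 1" "l \<in> K" "l' \<in> K'"
    using y unfolding hull2_def by blast
  define c where "c = t * a + (1 - t) * b"
  have c1: "1 - c = t * (1 - a) + (1 - t) * (1 - b)" by (simp add: c_def algebra_simps)
  obtain m where m: "m \<in> K" "(t * a) \<odot> k \<oplus> ((1 - t) * b) \<odot> l = c \<odot> m"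
    using cone_convex_combine[OF K(1) x(4) y(4), of "t * a" "(1 - t) * b"] x y t unfolding c_def by auto
  obtain m' where m': "m' \<in> K'" "(t * (1 - a)) \<odot> k' \<oplus> ((1 - t) * (1 - b)) \<odot> l' = (1 - c) \<odot> m'"
    using cone_convex_combine[OF K(2) x(5) y(5), of "t * (1 - a)" "(1 - t) * (1 - b)"] x y t unfolding c1 by auto
  have "t \<odot> x \<oplus> (1 - t) \<odot> y = ((t * a) \<odot> k \<oplus> ((1 - t) * b) \<odot> l) \<oplus> ((t * (1 - a)) \<odot> k' \<oplus> ((1 - t) * (1 - b)) \<odot> l')"
    using t by (simp add: x(1) y(1) LX_smul_add LX_smul_smul LX_add_ac)
  also have "\<dots> = c \<odot> m \<oplus> (1 - c) \<odot> m'" by (simp add: m m')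
  finally have "t \<odot> x \<oplus> (1 - t) \<odot> y = c \<odot> m \<oplus> (1 - c) \<odot> m'" .
  moreover have "0 \<le> c" unfolding c_def using x y t by simp
  moreover have "0 \<le> 1 - c" unfolding c1 using x y t by simp
  ultimately show "t \<odot> x \<oplus> (1 - t) \<odot> y \<in> hull2 K K'"
    unfolding hull2_def using m m' by auto
qed

text \<open>The weight \<open>1 - a\<close> decreases in \<open>a\<close> and so is not
  Scott-continuous in it; the parameter therefore carries the euclidean topology, and only the
  resulting scalars are read in the Scott topology.\<close>

lemma compactin_hull2:
  assumes tc: "LX_topological_cone X"
    and K: "compactin (LX_scott X) K" "compactin (LX_scott X) K'"
  shows "compactin (LX_scott X) (hull2 K K')"
proof -
  let ?T = "LX_scott X" and ?I = "top_of_set {0..1::real}"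
  let ?P = "prod_topology ?I (prod_topology ?T ?T)"
  have add: "continuous_map (prod_topology ?T ?T) ?T (\<lambda>(x, y). x \<oplus> y)"
    and smul: "continuous_map (prod_topology Rplus_scott ?T) ?T (\<lambda>(a, x). a \<odot> x)"
    using tc by (auto simp: topological_cone_def)
  have fst: "continuous_map ?P euclideanreal fst"
    using continuous_map_fst[of ?I] continuous_map_into_fulltopology by blast
  have s: "continuous_map ?P ?T (\<lambda>z. f z \<odot> g (snd z))"
    if f: "continuous_map ?P euclideanreal f" "\<And>z. z \<in> topspace ?P \<Longrightarrow> 0 \<le> f z"
      and g: "continuous_map (prod_topology ?T ?T) ?T g" for f g
  proof -
    have "continuous_map ?P (prod_topology Rplus_scott ?T) (\<lambda>z. (f z, g (snd z)))"
      using continuous_map_into_Rplus_scott[OF f] continuous_map_compose[OF continuous_map_snd g]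
      by (auto simp: continuous_map_pairwise o_def)
    from continuous_map_compose[OF this smul] show ?thesis by (simp add: o_def)
  qed
  have "continuous_map ?P (prod_topology ?T ?T) (\<lambda>z. (fst z \<odot> fst (snd z), (1 - fst z) \<odot> snd (snd z)))"
    unfolding continuous_map_pairwise o_def fst_conv snd_conv
    by (intro conjI s continuous_map_diff fst continuous_map_fst continuous_map_snd) auto
  from continuous_map_compose[OF this add]
  have cont: "continuous_map ?P ?T (\<lambda>z. fst z \<odot> fst (snd z) \<oplus> (1 - fst z) \<odot> snd (snd z))"
    by (simp add: o_def)
  have "compactin ?P ({0..1} \<times> (K \<times> K'))"
    using K by (auto simp: compactin_Times compactin_subtopology)
  from image_compactin[OF this cont]
  have "compactin ?T ((\<lambda>z. fst z \<odot> fst (snd z) \<oplus> (1 - fst z) \<odot> snd (snd z)) ` ({0..1} \<times> (K \<times> K')))" .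
  also have "(\<lambda>z. fst z \<odot> fst (snd z) \<oplus> (1 - fst z) \<odot> snd (snd z)) ` ({0..1} \<times> (K \<times> K')) = hull2 K K'"
    unfolding hull2_def by force
  finally show ?thesis .
qed

lemma cvx_compact_hull2:
  assumes "LX_topological_cone X" "cvx_compact X K" "cvx_compact X K'"
  shows "cvx_compact X (hull2 K K')"
  using assms compactin_hull2[OF assms(1)] cone_convex_hull2[of X K K'] hull2_superset[of K K']
  unfolding cvx_compact_def by blast

lemma cvx_compact_finite_hull:
  assumes tc: "LX_topological_cone X"
    and W: "LX_convex X W"
    and "finite \<Q>" "\<Q> \<noteq> {}" "\<And>Q. Q \<in> \<Q> \<Longrightarrow> cvx_compact X Q \<and> Q \<subseteq> W"
  shows "\<exists>K. cvx_compact X K \<and> \<Union>\<Q> \<subseteq> K \<and> K \<subseteq> W"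
  using assms(3-)
proof (induction \<Q> rule: finite_ne_induct)
  case (singleton Q)
  then show ?case by auto
next
  case (insert Q \<Q>)
  then obtain K where K: "cvx_compact X K" "\<Union>\<Q> \<subseteq> K" "K \<subseteq> W" by auto
  have Q: "cvx_compact X Q" "Q \<subseteq> W" using insert.prems by auto
  have "Q \<subseteq> hull2 Q K" "K \<subseteq> hull2 Q K"
    using hull2_superset[of Q K] K Q by (auto simp: cvx_compact_def)
  with K Q hull2_subset[OF W Q(2) K(3)] cvx_compact_hull2[OF tc Q(1) K(1)] show ?case
    by (intro exI[of _ "hull2 Q K"]) auto
qed

text \<open>Finitely many convex compact neighbourhoods inside \<open>W\<close> cover
  \<open>K\<close> with their interiors; as \<open>W\<close> is convex, the hull of their union
  stays in \<open>W\<close>.\<close>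

lemma cvx_compact_nbhd:
  assumes tc: "LX_topological_cone X"
    and lcc: "LX_locally_convex_compact X"
    and W: "openin (LX_scott X) W" "LX_convex X W"
    and K: "compactin (LX_scott X) K" "K \<noteq> {}" "K \<subseteq> W"
  shows "\<exists>K'. cvx_compact X K' \<and> K' \<subseteq> W \<and> K \<subseteq> LX_scott X interior_of K'"
proof -
  let ?T = "LX_scott X"
  have "\<exists>Q. cvx_compact X Q \<and> x \<in> ?T interior_of Q \<and> Q \<subseteq> W" if "x \<in> K" for x
  proof -
    have "x \<in> topspace ?T" "openin ?T W \<and> x \<in> W" using that K(3) W(1) openin_subset[OF W(1)] by auto
    with lcc obtain Q where Q: "compactin ?T Q" "cone_convex ?T LX_add LX_smul Q" "x \<in> ?T interior_of Q" "Q \<subseteq> W"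
      unfolding locally_convex_compact_cone_def by meson
    moreover have "Q \<noteq> {}" using Q(3) interior_of_subset[of ?T Q] by blast
    ultimately show ?thesis unfolding cvx_compact_def by blast
  qed
  then obtain Q where Q: "\<And>x. x \<in> K \<Longrightarrow> cvx_compact X (Q x) \<and> x \<in> ?T interior_of Q x \<and> Q x \<subseteq> W" by metis
  have "\<exists>\<F>. finite \<F> \<and> \<F> \<subseteq> (\<lambda>x. ?T interior_of Q x) ` K \<and> K \<subseteq> \<Union>\<F>"
    using Q by (intro compactinD[OF K(1)]) auto
  then obtain A where A: "finite A" "A \<subseteq> K" "K \<subseteq> (\<Union>x\<in>A. ?T interior_of Q x)"
    by (metis finite_subset_image)
  with K(2) have "A \<noteq> {}" by auto
  have QA: "finite (Q ` A)" "Q ` A \<noteq> {}" using A(1) \<open>A \<noteq> {}\<close> by simp_all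
  have "cvx_compact X P \<and> P \<subseteq> W" if "P \<in> Q ` A" for P using that A(2) Q by auto
  from cvx_compact_finite_hull[OF tc W(2) QA this]
  obtain K' where K': "cvx_compact X K'" "\<Union>(Q ` A) \<subseteq> K'" "K' \<subseteq> W" by blast
  have "?T interior_of Q x \<subseteq> ?T interior_of K'" if "x \<in> A" for x
    using K'(2) that by (intro interior_of_mono) auto
  then have "(\<Union>x\<in>A. ?T interior_of Q x) \<subseteq> ?T interior_of K'" by (rule UN_least)
  with A(3) have "K \<subseteq> ?T interior_of K'" by (rule order_trans)
  with K'(1,3) show ?thesis by blast
qed

text \<open>Each point of \<open>K\<close> has its own linear prevision exceeding 1 there. Finitely
  many serve all of \<open>K\<close>, and convexity of \<open>K\<close> lets
  \<open>minimax_ge\<close> average them into a single one that exceeds 1 throughout.\<close>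

lemma linear_above_on_cvx_compact:
  assumes F: "hoare_prevision X F" and lc: "LX_locally_convex X"
    and K: "cvx_compact X K" and KF: "\<And>k. k \<in> K \<Longrightarrow> 1 < F k"
  shows "\<exists>G. linear_prevision X G \<and> G \<le> F \<and> (\<forall>k\<in>K. 1 < G k)"
proof -
  let ?T = "LX_scott X"
  have KL: "K \<subseteq> LX X" using K compactin_subset_topspace[of ?T K] by (simp add: cvx_compact_def)
  have Fs: "sublin X F" using F by (simp add: hoare_prevision_iff)
  have "\<exists>G s. linear_prevision X G \<and> G \<le> F \<and> 1 < s \<and> ennreal s < G x" if xK: "x \<in> K" for x
  proof -
    obtain q where q: "1 < q" "q < F x" using dense[OF KF[OF xK]] by blast
    have xL: "x \<in> LX X" using KL xK by blast
    from scale_to_one[OF Fs xL q(2)] obtain p where p: "p \<odot> x \<in> LX X" "1 < F (p \<odot> x)"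
      "\<forall>G. sublin X G \<longrightarrow> 1 \<le> G (p \<odot> x) \<longrightarrow> q < G x" by blast
    obtain G where G: "linear_prevision X G" "G \<le> F" "1 \<le> G (p \<odot> x)"
      using linear_below[OF F lc p(1,2)] by blast
    have "q < G x" using p(3) G linear_sublin by blast
    moreover obtain s where "q = ennreal s" "0 \<le> s" using q by (cases q) (auto simp: top_unique less_top[symmetric])
    moreover from this have "1 < s" using q(1) ennreal_less_iff[of 1 s] by simp
    ultimately show ?thesis using G by blast
  qed
  then obtain G s where G: "\<And>x. x \<in> K \<Longrightarrow> linear_prevision X (G x) \<and> G x \<le> F \<and> 1 < s x \<and> ennreal (s x) < G x x"
    by metis
  define N where "N x = {y \<in> LX X. ennreal (s x) < G x y}" for x
  have "compactin ?T K" using K by (simp add: cvx_compact_def)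
  moreover have "openin ?T U" if "U \<in> N ` K" for U
    using that G linear_sc unfolding sc_iff_openin N_def by blast
  moreover have "K \<subseteq> \<Union>(N ` K)"
    using G KL by (auto simp: N_def)
  ultimately obtain \<F> where \<F>: "finite \<F>" "\<F> \<subseteq> N ` K" "K \<subseteq> \<Union>\<F>"
    by (metis compactinD)
  obtain A where A: "A \<subseteq> K" "finite A" "\<F> = N ` A"
    using finite_subset_image[OF \<F>(1,2)] by blast
  with \<F>(3) have A: "finite A" "A \<subseteq> K" "K \<subseteq> (\<Union>x\<in>A. {y \<in> LX X. ennreal (s x) < G x y})"
    by (simp_all add: N_def)
  have ne: "A \<noteq> {}" using A(3) K by (auto simp: cvx_compact_def)
  define m where "m = Min (s ` A)"
  have m: "1 < m" "\<And>x. x \<in> A \<Longrightarrow> m \<le> s x"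
  proof -
    have "\<forall>z\<in>s ` A. 1 < z" using G A(2) by blast
    then show "1 < m" unfolding m_def using A(1) ne by (simp add: Min_gr_iff)
    show "m \<le> s x" if "x \<in> A" for x unfolding m_def using A(1) that by simp
  qed
  \<comment> \<open>Indices outside \<open>A\<close> get the value 0, so that the vectors of values
    form a convex set of functions on the whole index type.\<close>
  let ?v = "\<lambda>y x. if x \<in> A then G x y else 0"
  have conv: "fconv (?v ` K)"
    unfolding fconv_def
  proof (intro ballI allI impI)
    fix f g and t :: real assume fg: "f \<in> ?v ` K" "g \<in> ?v ` K" and t: "0 \<le> t \<and> t \<le> 1"
    obtain y z where yz: "y \<in> K" "z \<in> K" "f = ?v y" "g = ?v z" using fg by blast
    have w: "t \<odot> y \<oplus> (1 - t) \<odot> z \<in> K"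
      using K yz t by (intro cone_convexD[of X K]) (auto simp: cvx_compact_def)
    have "G x (t \<odot> y \<oplus> (1 - t) \<odot> z) = ennreal t * G x y + ennreal (1 - t) * G x z" if "x \<in> A" for x
    proof -
      have lin: "linear_prevision X (G x)" using G A(2) that by blast
      have L: "y \<in> LX X" "z \<in> LX X" using KL yz by auto
      have "G x (t \<odot> y \<oplus> (1 - t) \<odot> z) = G x (t \<odot> y) + G x ((1 - t) \<odot> z)"
        by (intro linear_add[OF lin] LX_smul L)
      then show ?thesis using t L by (simp add: sublin_smul[OF linear_sublin[OF lin]])
    qed
    then have "(\<lambda>i. ennreal t * f i + ennreal (1 - t) * g i) = ?v (t \<odot> y \<oplus> (1 - t) \<odot> z)"
      using yz by (auto simp: fun_eq_iff)
    with w show "(\<lambda>i. ennreal t * f i + ennreal (1 - t) * g i) \<in> ?v ` K" by blast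
  qed
  have ge: "\<exists>i\<in>A. ennreal m \<le> f i" if f: "f \<in> ?v ` K" for f
  proof -
    obtain y where y: "y \<in> K" "f = ?v y" using f by blast
    then obtain x where x: "x \<in> A" "ennreal (s x) < G x y" using A(3) by blast
    have "ennreal m \<le> ennreal (s x)" by (intro ennreal_leI m x)
    with x y show ?thesis by (intro bexI[of _ x]) auto
  qed
  \<comment> \<open>\<open>minimax_ge\<close> allows any loss below \<open>m\<close>; the midpoint
    between 1 and \<open>m\<close> still exceeds 1.\<close>
  have "0 < (1 + m) / 2" "(1 + m) / 2 < m" using m(1) by simp_all
  from minimax_ge[OF A(1) ne conv ge this] obtain c where c: "\<forall>i\<in>A. 0 \<le> c i" "sum c A = 1"
    "\<forall>f\<in>?v ` K. ennreal ((1 + m) / 2) \<le> (\<Sum>i\<in>A. ennreal (c i) * f i)" by blast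
  define L where "L = (\<lambda>y. \<Sum>x\<in>A. ennreal (c x) * G x y)"
  have "linear_prevision X L"
    unfolding L_def using A G by (intro linear_sum) auto
  moreover have "L \<le> F"
  proof (rule le_funI)
    fix y
    have "L y \<le> (\<Sum>x\<in>A. ennreal (c x) * F y)"
      unfolding L_def using A G by (intro sum_mono mult_left_mono) (auto simp: le_fun_def)
    also have "\<dots> = (\<Sum>x\<in>A. ennreal (c x)) * F y" by (simp add: sum_distrib_right)
    also have "(\<Sum>x\<in>A. ennreal (c x)) = 1" using c by (simp add: sum_ennreal)
    finally show "L y \<le> F y" by simp
  qed
  moreover have "1 < L y" if "y \<in> K" for y
  proof -
    have "(\<Sum>i\<in>A. ennreal (c i) * ?v y i) = L y" unfolding L_def by (intro sum.cong) auto
    with c(3) that have "ennreal ((1 + m) / 2) \<le> L y" by auto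
    moreover have "1 < ennreal ((1 + m) / 2)"
      using m(1) ennreal_less_iff[of 1 "(1 + m) / 2"] by simp
    ultimately show ?thesis by order
  qed
  ultimately show ?thesis by blast
qed

section \<open>Convex open sets built from convex compact sets\<close>

lemma cone_convex_gt_linear:
  assumes L: "linear_prevision X L"
  shows "LX_convex X {y \<in> LX X. r < L y}"
  unfolding cone_convex_def topspace_LX_scott
proof (intro conjI ballI allI impI)
  fix x y and a :: real assume x: "x \<in> {y \<in> LX X. r < L y}" and y: "y \<in> {y \<in> LX X. r < L y}" and a: "0 \<le> a \<and> a \<le> 1"
  have "L (a \<odot> x \<oplus> (1 - a) \<odot> y) = L (a \<odot> x) + L ((1 - a) \<odot> y)"
    using x y by (intro linear_add[OF L] LX_smul) auto
  also have "\<dots> = ennreal a * L x + ennreal (1 - a) * L y"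
    using x y a by (simp add: sublin_smul[OF linear_sublin[OF L]])
  finally have "r < L (a \<odot> x \<oplus> (1 - a) \<odot> y)" using x y a by (simp add: ennreal_convex_gt)
  moreover have "a \<odot> x \<oplus> (1 - a) \<odot> y \<in> LX X" using x y by (intro LX_add LX_smul) auto
  ultimately show "a \<odot> x \<oplus> (1 - a) \<odot> y \<in> {y \<in> LX X. r < L y}" by blast
qed auto

lemma cvx_compact_point:
  assumes "x \<in> LX X"
  shows "cvx_compact X {x}"
proof -
  have "a \<odot> x \<oplus> (1 - a) \<odot> x = x" if "0 \<le> a" "a \<le> 1" for a
    using that LX_add_smul[of a "1 - a" x] by simp
  with assms show ?thesis by (simp add: cvx_compact_def cone_convex_def)
qed

text \<open>Sublinearity alone does not keep convex combinations in the set \<open>F > 1\<close>.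
  Along \<open>e\<close> the shift condition replaces additivity: it bounds \<open>F\<close> below
  by a convex combination of \<open>F k\<close> and \<open>1 + d\<close>.\<close>

lemma hull2_above_one:
  assumes F: "sublin X F" and e: "e \<in> LX X" "shifts X {e} F" and d: "0 < d"
    and K: "K \<subseteq> {y \<in> LX X. 1 < F y}" and y: "y \<in> hull2 K {(1 + d) \<odot> e}"
  shows "1 < F y"
proof -
  obtain a k where y: "y = a \<odot> k \<oplus> (1 - a) \<odot> (1 + d) \<odot> e" "0 \<le> a" "a \<le> 1" "k \<in> K"
    using y unfolding hull2_def by blast
  have k: "k \<in> LX X" "1 < F k" using y(4) K by auto
  have "1 < ennreal (1 + d)"
    using d ennreal_less_iff[of 1 "1 + d"] by (simp del: ennreal_plus)
  then have "1 < ennreal a * F k + ennreal (1 - a) * ennreal (1 + d)"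
    using k y by (intro ennreal_convex_gt) auto
  also have "\<dots> = F (a \<odot> k) + ennreal ((1 - a) * (1 + d))"
    using y k d by (simp add: sublin_smul[OF F] ennreal_mult del: ennreal_plus)
  also have "\<dots> \<le> F (a \<odot> k \<oplus> ((1 - a) * (1 + d)) \<odot> e)"
    using e(2) LX_smul[OF k(1)] y(2,3) d unfolding shifts_def by simp
  also have "a \<odot> k \<oplus> ((1 - a) * (1 + d)) \<odot> e = y" using y by (simp add: LX_smul_smul)
  finally show ?thesis .
qed

text \<open>The set \<open>L > 1\<close> is convex and open and lies between \<open>?J\<close> and
  the set \<open>F > 1\<close>, which need not be convex; the next compact set is chosen inside
  it.\<close>

lemma masses_step:
  assumes tc: "LX_topological_cone X"
    and lcc: "LX_locally_convex_compact X"
    and lc: "LX_locally_convex X"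
    and F: "hoare_prevision X F" and e: "e \<in> LX X" "shifts X {e} F" and d: "0 < d"
    and K: "cvx_compact X K" "K \<subseteq> {y \<in> LX X. 1 < F y}"
  shows "\<exists>K'. cvx_compact X K' \<and> K' \<subseteq> {y \<in> LX X. 1 < F y} \<and>
    insert ((1 + d) \<odot> e) K \<subseteq> LX_scott X interior_of K'"
proof -
  let ?T = "LX_scott X"
  have Fs: "sublin X F" using F by (simp add: hoare_prevision_iff)
  let ?J = "hull2 K {(1 + d) \<odot> e}"
  have J: "cvx_compact X ?J" by (intro cvx_compact_hull2[OF tc] K cvx_compact_point LX_smul e)
  from linear_above_on_cvx_compact[OF F lc J hull2_above_one[OF Fs e d K(2)]]
  obtain L where L: "linear_prevision X L" "L \<le> F" "\<forall>k\<in>?J. 1 < L k" by blast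
  let ?W = "{y \<in> LX X. 1 < L y}"
  have W: "openin ?T ?W" using linear_sc[OF L(1)] by (simp add: sc_iff_openin)
  have J': "compactin ?T ?J" "?J \<noteq> {}" using J by (simp_all add: cvx_compact_def)
  have "?J \<subseteq> ?W"
    using L(3) compactin_subset_topspace[OF J'(1)] by auto
  from cvx_compact_nbhd[OF tc lcc W cone_convex_gt_linear[OF L(1)] J' this]
  obtain K' where K': "cvx_compact X K'" "K' \<subseteq> ?W" "?J \<subseteq> ?T interior_of K'" by blast
  have "K \<noteq> {}" using K(1) by (simp add: cvx_compact_def)
  then have "insert ((1 + d) \<odot> e) K \<subseteq> ?J"
    using hull2_superset[of K "{(1 + d) \<odot> e}"] by simp
  with K'(3) have "insert ((1 + d) \<odot> e) K \<subseteq> ?T interior_of K'" by (rule order_trans[rotated])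
  moreover have "K' \<subseteq> {y \<in> LX X. 1 < F y}"
    using K'(2) L(2) by (auto simp: le_fun_def intro: less_le_trans)
  ultimately show ?thesis using K'(1) by blast
qed

(* The convex open set fed to the separation theorem is the union of an increasing sequence of
   convex compact sets, each in the interior of the next one. *)
lemma linear_below_with_masses:
  fixes e :: "nat \<Rightarrow> 'a \<Rightarrow> ennreal"
  assumes tc: "LX_topological_cone X"
    and lcc: "LX_locally_convex_compact X"
    and lc: "LX_locally_convex X"
    and F: "hoare_prevision X F" and e: "range e \<subseteq> LX X" "shifts X (range e) F"
    and h: "h \<in> LX X" "1 < F h"
  shows "\<exists>G. linear_prevision X G \<and> G \<le> F \<and> 1 \<le> G h \<and> (\<forall>n. 1 \<le> G ((1 + 1 / Suc n) \<odot> e n))"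
proof -
  let ?T = "LX_scott X" and ?O = "{y \<in> LX X. 1 < F y}"
  have Fs: "sublin X F" "sc X F" using F by (simp_all add: hoare_prevision_iff)
  define e' where "e' n = (1 + 1 / Suc n) \<odot> e n" for n
  have "\<exists>K. \<forall>n. (cvx_compact X (K n) \<and> K n \<subseteq> ?O \<and> h \<in> K n) \<and>
      (insert (e' n) (K n) \<subseteq> ?T interior_of K (Suc n))"
  proof (rule dependent_nat_choice)
    show "\<exists>K. cvx_compact X K \<and> K \<subseteq> ?O \<and> h \<in> K"
      using cvx_compact_point[OF h(1)] h by (intro exI[of _ "{h}"]) auto
  next
    fix K n assume K: "cvx_compact X K \<and> K \<subseteq> ?O \<and> h \<in> K"
    have en: "e n \<in> LX X" "shifts X {e n} F" using e by (auto simp: shifts_def)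
    obtain K' where K': "cvx_compact X K'" "K' \<subseteq> ?O" "insert (e' n) K \<subseteq> ?T interior_of K'"
      using masses_step[OF tc lcc lc F en, of "1 / Suc n" K] K unfolding e'_def by auto
    have "h \<in> ?T interior_of K'" using K K'(3) by blast
    then have "h \<in> K'" using interior_of_subset[of ?T K'] by blast
    with K' show "\<exists>K'. (cvx_compact X K' \<and> K' \<subseteq> ?O \<and> h \<in> K') \<and> insert (e' n) K \<subseteq> ?T interior_of K'"
      by blast
  qed
  then obtain K where K: "\<And>n. cvx_compact X (K n)" "\<And>n. K n \<subseteq> ?O" "\<And>n. h \<in> K n"
    "\<And>n. insert (e' n) (K n) \<subseteq> ?T interior_of K (Suc n)" by blast
  have int: "?T interior_of K n \<subseteq> K n" for n by (rule interior_of_subset)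
  have mono: "K m \<subseteq> K n" if "m \<le> n" for m n
    using that
  proof (rule lift_Suc_mono_le[rotated])
    show "K n \<subseteq> K (Suc n)" for n
      using K(4)[of n] int[of "Suc n"] by blast
  qed
  let ?U = "\<Union>n. K n"
  have opU: "openin ?T ?U"
  proof (subst openin_subopen, intro ballI)
    fix x assume "x \<in> ?U"
    then obtain n where "x \<in> K n" by blast
    then have "x \<in> ?T interior_of K (Suc n)" using K(4)[of n] by blast
    moreover have "?T interior_of K (Suc n) \<subseteq> ?U" using int[of "Suc n"] by blast
    ultimately show "\<exists>T. openin ?T T \<and> x \<in> T \<and> T \<subseteq> ?U"
      by (intro exI[of _ "?T interior_of K (Suc n)"] conjI openin_interior_of)
  qed
  have cvU: "cone_convex ?T LX_add LX_smul ?U"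
    unfolding cone_convex_def
  proof (intro conjI ballI allI impI)
    show "?U \<subseteq> topspace ?T" using K(2) by auto
    fix x y and a :: real assume xy: "x \<in> ?U" "y \<in> ?U" and a: "0 \<le> a \<and> a \<le> 1"
    obtain m n where "x \<in> K m" "y \<in> K n" using xy by blast
    then have "x \<in> K (max m n)" "y \<in> K (max m n)" using mono[of m "max m n"] mono[of n "max m n"] by auto
    then have "a \<odot> x \<oplus> (1 - a) \<odot> y \<in> K (max m n)"
      using K(1)[of "max m n"] a by (intro cone_convexD[of X]) (auto simp: cvx_compact_def)
    then show "a \<odot> x \<oplus> (1 - a) \<odot> y \<in> ?U" by blast
  qed
  have neU: "?U \<noteq> {}" using K(3) by blast
  have FU: "1 \<le> F u" if "u \<in> ?U" for u using that K(2) by (auto intro: less_imp_le)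
  \<comment> \<open>The masses are secured by membership in \<open>?U\<close>, so separation runs
    with no shift condition, and the hull has none to preserve.\<close>
  have no: "shifts X {} P" for P by (simp add: shifts_def)
  have e'U: "e' n \<in> ?U" for n using K(4)[of n] int[of "Suc n"] by blast
  show ?thesis
  proof (rule separation[OF Fs(1) opU cvU neU FU empty_subsetI no no])
    fix G assume G: "linear_prevision X G" "G \<le> F" and GU: "\<And>u. u \<in> ?U \<Longrightarrow> 1 \<le> G u"
    have "1 \<le> G h" using K(3) by (intro GU) blast
    moreover have "1 \<le> G ((1 + 1 / Suc n) \<odot> e n)" for n
      using GU[OF e'U[of n]] by (simp only: e'_def)
    ultimately show ?thesis using G by blast
  qed
qed

lemma mass_ge_one:
  assumes G: "sublin X G" and e: "e \<in> LX X" and ge: "\<And>n::nat. 1 \<le> G ((1 + 1 / Suc n) \<odot> e)"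
  shows "1 \<le> G e"
proof (cases "G e")
  case (real x)
  have "1 \<le> (1 + 1 / Suc n) * x" for n :: nat
  proof -
    have "1 \<le> ennreal (1 + 1 / Suc n) * ennreal x"
      using ge[of n] sublin_smul[OF G _ e, of "1 + 1 / Suc n"] real by (simp del: ennreal_plus)
    then show ?thesis using real(1) by (simp add: ennreal_mult[symmetric] del: ennreal_plus)
  qed
  then have le: "1 \<le> x + x / Suc n" for n :: nat by (simp add: algebra_simps)
  have "(\<lambda>n. x + x / Suc n) \<longlonglongrightarrow> x + 0"
    by (intro tendsto_intros LIMSEQ_Suc[OF lim_const_over_n])
  then have "1 \<le> x + 0" by (rule LIMSEQ_le_const) (use le in auto)
  with real show ?thesis by simp
qed simp

lemma representable_Norm_convex_compact:
  assumes tc: "LX_topological_cone X"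
    and lcc: "LX_locally_convex_compact X"
    and lc: "LX_locally_convex X"
  shows "representable Norm X"
proof (rule representableI)
  fix F h assume F: "F \<in> PAP Norm X" and h: "h \<in> LX X" "1 < F h"
  have FH: "hoare_prevision X F" using F by (simp add: PAP_def)
  have e: "range (\<lambda>_::nat. LX_one X) \<subseteq> LX X" "shifts X (range (\<lambda>_::nat. LX_one X)) F"
    using PAP_Norm_shifts[OF F] by (auto simp: LX_one)
  obtain G where G: "linear_prevision X G" "G \<le> F" "1 \<le> G h"
    "\<And>n::nat. 1 \<le> G ((1 + 1 / Suc n) \<odot> LX_one X)"
    using linear_below_with_masses[OF tc lcc lc FH e h] by blast
  have "1 \<le> G (LX_one X)" by (rule mass_ge_one[OF linear_sublin[OF G(1)] LX_one G(4)])
  moreover have "G (LX_one X) \<le> 1" using G(2) Norm_one[OF F] by (metis le_fun_def)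
  ultimately have "G \<in> PP Norm X" by (intro PP_NormI G antisym)
  with G show "\<exists>G\<in>PP Norm X. G \<le> F \<and> 1 \<le> G h" by blast
qed

section \<open>Locally compact spaces\<close>

lemma cone_convex_above: "LX_convex X {l \<in> LX X. k \<le> l}"
  unfolding cone_convex_def topspace_LX_scott
proof (intro conjI ballI allI impI CollectI)
  fix x y and a :: real assume x: "x \<in> {l \<in> LX X. k \<le> l}" and y: "y \<in> {l \<in> LX X. k \<le> l}" and a: "0 \<le> a \<and> a \<le> 1"
  then show "a \<odot> x \<oplus> (1 - a) \<odot> y \<in> LX X" by (auto intro: LX_add LX_smul)
  have "a \<odot> k \<oplus> (1 - a) \<odot> k = k" using a LX_add_smul[of a "1 - a" k] by simp
  moreover have "a \<odot> k \<oplus> (1 - a) \<odot> k \<le> a \<odot> x \<oplus> (1 - a) \<odot> y"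
    using x y by (intro LX_add_mono LX_smul_mono) auto
  ultimately show "k \<le> a \<odot> x \<oplus> (1 - a) \<odot> y" by simp
qed auto

lemma cone_convex_gt_on: "LX_convex X {l \<in> LX X. \<forall>x\<in>Q. r < l x}"
  unfolding cone_convex_def topspace_LX_scott
proof (intro conjI ballI allI impI CollectI)
  fix x y and a :: real assume x: "x \<in> {l \<in> LX X. \<forall>x\<in>Q. r < l x}" and y: "y \<in> {l \<in> LX X. \<forall>x\<in>Q. r < l x}" and a: "0 \<le> a \<and> a \<le> 1"
  then show "a \<odot> x \<oplus> (1 - a) \<odot> y \<in> LX X" by (auto intro: LX_add LX_smul)
  fix z assume "z \<in> Q"
  with x y a show "r < (a \<odot> x \<oplus> (1 - a) \<odot> y) z"
    unfolding LX_add_def LX_smul_def by (intro ennreal_convex_gt) auto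
qed auto

lemma cone_convex_Int:
  "cone_convex T add smul A \<Longrightarrow> cone_convex T add smul B \<Longrightarrow> cone_convex T add smul (A \<inter> B)"
  unfolding cone_convex_def by blast

text \<open>Membership implies that \<open>k\<close> is way below \<open>g\<close>. Making the
  neighbourhood explicit allows it to be required convex, which yields local convexity of the
  cone.\<close>

definition approximants :: "'a topology \<Rightarrow> ('a \<Rightarrow> ennreal) \<Rightarrow> ('a \<Rightarrow> ennreal) set" where
  "approximants X g = {k \<in> LX X. \<exists>N. openin (LX_scott X) N \<and>
     LX_convex X N \<and> g \<in> N \<and> (\<forall>l\<in>N. k \<le> l)}"

lemma directed_approximants:
  assumes g: "g \<in> LX X"
  shows "directed_in (LX X) (approximants X g)"
  unfolding directed_in_def
proof (intro conjI ballI)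
  show "approximants X g \<subseteq> LX X" by (auto simp: approximants_def)
  have "openin (LX_scott X) {l \<in> LX X. (\<lambda>_. 0) \<le> l}"
    using openin_topspace[of "LX_scott X"] by (simp add: le_fun_def)
  with g cone_convex_above[of X "\<lambda>_. 0"] have "(\<lambda>_. 0) \<in> approximants X g"
    unfolding approximants_def by (intro CollectI conjI LX_zero exI[of _ "{l \<in> LX X. (\<lambda>_. 0) \<le> l}"]) (auto simp: le_fun_def)
  then show "approximants X g \<noteq> {}" by blast
  fix k k' assume "k \<in> approximants X g" "k' \<in> approximants X g"
  then obtain N N' where N: "k \<in> LX X" "openin (LX_scott X) N" "LX_convex X N" "g \<in> N" "\<forall>l\<in>N. k \<le> l"
    and N': "k' \<in> LX X" "openin (LX_scott X) N'" "LX_convex X N'" "g \<in> N'" "\<forall>l\<in>N'. k' \<le> l"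
    unfolding approximants_def by blast
  then have "sup k k' \<in> approximants X g"
    unfolding approximants_def
    by (intro CollectI conjI LX_sup exI[of _ "N \<inter> N'"] openin_Int cone_convex_Int) auto
  then show "\<exists>z\<in>approximants X g. k \<le> z \<and> k' \<le> z" by (intro bexI[of _ "sup k k'"]) auto
qed

text \<open>Maps equal to \<open>r\<close> on \<open>V\<close> and 0 elsewhere suffice, where
  \<open>V\<close> lies in a compact \<open>Q\<close> on which \<open>g\<close> exceeds
  \<open>r\<close>: the maps exceeding \<open>r\<close> on \<open>Q\<close> form a convex Scott-open
  neighbourhood of \<open>g\<close> above them.\<close>

lemma Sup_approximants:
  assumes Y: "locally_compact_base Y" and g: "g \<in> LX Y"
  shows "Sup (approximants Y g) = g"
proof (rule antisym)
  show "Sup (approximants Y g) \<le> g" by (rule Sup_least) (auto simp: approximants_def)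
  show "g \<le> Sup (approximants Y g)"
  proof (rule le_funI)
    fix y show "g y \<le> Sup (approximants Y g) y"
    proof (rule dense_le)
      fix r assume r: "r < g y"
      have op: "openin Y {x. r < g x}" using g by (simp add: LX_iff)
      have "y \<in> topspace Y" using r openin_subset[OF op] by blast
      with Y op r obtain V Q where VQ: "openin Y V" "compactin Y Q" "y \<in> V" "V \<subseteq> Q" "Q \<subseteq> {x. r < g x}"
        unfolding locally_compact_base_def by (metis (no_types, lifting) mem_Collect_eq)
      define k where "k x = (if x \<in> V then r else 0)" for x
      have "{x. s < k x} = (if s < r then V else {})" for s by (auto simp: k_def)
      then have "k \<in> LX Y" using VQ(1) by (simp add: LX_iff)
      moreover have "\<forall>l\<in>{l \<in> LX Y. \<forall>x\<in>Q. r < l x}. k \<le> l"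
        using VQ(4) by (auto simp: k_def le_fun_def intro: less_imp_le)
      moreover have "g \<in> {l \<in> LX Y. \<forall>x\<in>Q. r < l x}" using g VQ(5) by auto
      ultimately have "k \<in> approximants Y g"
        using open_gt_on_compact[OF VQ(2), of r] cone_convex_gt_on[of Y Q r] unfolding approximants_def by blast
      then have "k y \<le> Sup (approximants Y g) y" unfolding Sup_apply by (rule SUP_upper)
      then show "r \<le> Sup (approximants Y g) y" using VQ(3) by (simp add: k_def)
    qed
  qed
qed

text \<open>\<open>g\<close> is the supremum of its directed approximants, so \<open>W\<close>
  contains one of them; \<open>W\<close> is an upper set, so the neighbourhood above that
  approximant lies in \<open>W\<close>.\<close>

lemma approximant_in_open:
  assumes Y: "locally_compact_base Y" and W: "openin (LX_scott Y) W" "g \<in> W"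
  obtains k N where "k \<in> W" "openin (LX_scott Y) N" "LX_convex Y N" "g \<in> N"
    "\<And>l. l \<in> N \<Longrightarrow> k \<le> l" "N \<subseteq> W"
proof -
  have g: "g \<in> LX Y" using W openin_subset by fastforce
  have "Sup (approximants Y g) \<in> W" by (simp only: Sup_approximants[OF Y g] W(2))
  then obtain k where k: "k \<in> approximants Y g" "k \<in> W"
    using W(1) directed_approximants[OF g] unfolding openin_LX_scott by blast
  obtain N where N: "openin (LX_scott Y) N" "LX_convex Y N" "g \<in> N" "\<forall>l\<in>N. k \<le> l"
    using k(1) unfolding approximants_def by blast
  have "N \<subseteq> LX Y" using openin_subset[OF N(1)] by simp
  then have "N \<subseteq> W" using N(4) k(2) W(1) unfolding openin_LX_scott by blast
  with that N k show thesis by blast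
qed

lemma locally_convex_LX_locally_compact:
  assumes Y: "locally_compact_base Y"
  shows "LX_locally_convex Y"
  unfolding locally_convex_cone_def
proof (intro ballI allI impI)
  fix x W assume "x \<in> topspace (LX_scott Y)" "openin (LX_scott Y) W \<and> x \<in> W"
  then show "\<exists>V. openin (LX_scott Y) V \<and> LX_convex Y V \<and> x \<in> V \<and> V \<subseteq> W"
    by (metis approximant_in_open[OF Y])
qed

lemma locally_convex_compact_LX_locally_compact:
  assumes Y: "locally_compact_base Y"
  shows "LX_locally_convex_compact Y"
  unfolding locally_convex_compact_cone_def
proof (intro ballI allI impI)
  let ?T = "LX_scott Y"
  fix x W assume "x \<in> topspace ?T" and W: "openin ?T W \<and> x \<in> W"
  then obtain k N where N: "k \<in> W" "openin ?T N" "x \<in> N" "\<And>l. l \<in> N \<Longrightarrow> k \<le> l"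
    by (metis approximant_in_open[OF Y])
  \<comment> \<open>The upper set of \<open>k\<close> is compact because an open set containing
    \<open>k\<close> contains all of it.\<close>
  let ?Q = "{l \<in> LX Y. k \<le> l}"
  have WL: "W \<subseteq> LX Y" and up: "\<And>x y. x \<in> W \<Longrightarrow> y \<in> LX Y \<Longrightarrow> x \<le> y \<Longrightarrow> y \<in> W"
    using W unfolding openin_LX_scott by auto
  have kL: "k \<in> LX Y" using N(1) WL by blast
  have "compactin ?T ?Q"
    unfolding compactin_def
  proof (intro conjI allI impI)
    fix \<U> assume \<U>: "(\<forall>U\<in>\<U>. openin ?T U) \<and> ?Q \<subseteq> \<Union>\<U>"
    with kL obtain U where U: "U \<in> \<U>" "k \<in> U" by blast
    then have "openin ?T U" using \<U> by blast
    then have "?Q \<subseteq> U" using U(2) unfolding openin_LX_scott by blast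
    with U show "\<exists>\<F>. finite \<F> \<and> \<F> \<subseteq> \<U> \<and> ?Q \<subseteq> \<Union>\<F>" by (intro exI[of _ "{U}"]) auto
  qed auto
  moreover have "N \<subseteq> ?Q" using N(4) openin_subset[OF N(2)] by auto
  then have "x \<in> ?T interior_of ?Q" using N(2,3) interior_of_maximal by blast
  moreover have "?Q \<subseteq> W" using up[OF N(1)] by blast
  ultimately show "\<exists>Q. compactin ?T Q \<and> cone_convex ?T LX_add LX_smul Q \<and> x \<in> ?T interior_of Q \<and> Q \<subseteq> W"
    using cone_convex_above by blast
qed

section \<open>Joint continuity of the cone operations\<close>

lemma t0_space_LX_scott: "t0_space (LX_scott X)"
proof -
  have op: "openin (LX_scott X) {l \<in> LX X. \<not> l \<le> y}" for y
    unfolding openin_LX_scott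
  proof (intro conjI ballI allI impI)
    fix D assume D: "directed_in (LX X) D" "Sup D \<in> {l \<in> LX X. \<not> l \<le> y}"
    then have "\<not> Sup D \<le> y" by simp
    then obtain d where "d \<in> D" "\<not> d \<le> y" by (meson Sup_least)
    with D(1) show "\<exists>d\<in>D. d \<in> {l \<in> LX X. \<not> l \<le> y}" by (auto simp: directed_in_def)
  qed (auto intro: order_trans)
  show ?thesis
    unfolding t0_space_def topspace_LX_scott
  proof (intro ballI impI)
    fix x y assume xy: "x \<in> LX X" "y \<in> LX X" "x \<noteq> y"
    then consider "\<not> x \<le> y" | "\<not> y \<le> x" by (meson antisym)
    then show "\<exists>U. openin (LX_scott X) U \<and> (x \<notin> U) = (y \<in> U)"
    proof cases
      case 1
      with xy op[of y] show ?thesis by (intro exI[of _ "{l \<in> LX X. \<not> l \<le> y}"]) auto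
    next
      case 2
      with xy op[of x] show ?thesis by (intro exI[of _ "{l \<in> LX X. \<not> l \<le> x}"]) auto
    qed
  qed
qed

lemma open_translate_preimage:
  assumes "openin (LX_scott X) W" "y \<in> LX X"
  shows "openin (LX_scott X) {x \<in> LX X. x \<oplus> y \<in> W}"
proof -
  have "openin (LX_scott X) {x \<in> LX X. 0 < chi W (x \<oplus> y)}"
    using sc_translate[OF sc_chi[OF assms(1)] assms(2)] by (simp add: sc_iff_openin)
  moreover have "{x \<in> LX X. 0 < chi W (x \<oplus> y)} = {x \<in> LX X. x \<oplus> y \<in> W}" by (auto simp: chi_def)
  ultimately show ?thesis by simp
qed

lemma open_scale_preimage:
  assumes "openin (LX_scott X) W"
  shows "openin (LX_scott X) {x \<in> LX X. a \<odot> x \<in> W}"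
proof -
  have "openin (LX_scott X) {x \<in> LX X. 0 < chi W (a \<odot> x)}"
    using sc_scale[OF sc_chi[OF assms]] by (simp add: sc_iff_openin)
  moreover have "{x \<in> LX X. 0 < chi W (a \<odot> x)} = {x \<in> LX X. a \<odot> x \<in> W}" by (auto simp: chi_def)
  ultimately show ?thesis by simp
qed

lemma SUP_ennreal_lub:
  assumes D: "directed_in {0..} D" and s: "is_lub_in {0..} D s"
  shows "(SUP d\<in>D. ennreal d) = ennreal s"
proof (rule antisym)
  have ds: "\<And>d. d \<in> D \<Longrightarrow> d \<le> s" and least: "\<And>u. 0 \<le> u \<Longrightarrow> (\<And>d. d \<in> D \<Longrightarrow> d \<le> u) \<Longrightarrow> s \<le> u" and s0: "0 \<le> s"
    using s by (auto simp: is_lub_in_def)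
  have D0: "0 \<le> d" if "d \<in> D" for d using D that by (auto simp: directed_in_def)
  show "(SUP d\<in>D. ennreal d) \<le> ennreal s" by (intro SUP_least ennreal_leI ds)
  then obtain u where u: "(SUP d\<in>D. ennreal d) = ennreal u" "0 \<le> u"
    by (cases "SUP d\<in>D. ennreal d") (auto simp: top_unique)
  have "d \<le> u" if "d \<in> D" for d
    using SUP_upper[OF that, of ennreal] u by (simp add: ennreal_le_iff)
  then have "s \<le> u" using u(2) by (intro least)
  then show "ennreal s \<le> (SUP d\<in>D. ennreal d)" unfolding u(1) by (rule ennreal_leI)
qed

lemma open_ray_preimage:
  assumes W: "openin (LX_scott X) W" and k: "k \<in> LX X"
  shows "openin Rplus_scott {b. 0 \<le> b \<and> b \<odot> k \<in> W}"
  unfolding Rplus_scott_def openin_scott_topology scott_open_def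
proof (intro conjI ballI allI impI)
  have up: "\<And>x y. x \<in> W \<Longrightarrow> y \<in> LX X \<Longrightarrow> x \<le> y \<Longrightarrow> y \<in> W"
    and dir: "\<And>D. directed_in (LX X) D \<Longrightarrow> Sup D \<in> W \<Longrightarrow> \<exists>d\<in>D. d \<in> W"
    using W unfolding openin_LX_scott by auto
  show "y \<in> {b. 0 \<le> b \<and> b \<odot> k \<in> W}" if "x \<in> {b. 0 \<le> b \<and> b \<odot> k \<in> W}" "y \<in> {0..}" "x \<le> y" for x y
    using that up[of "x \<odot> k" "y \<odot> k"] LX_smul[OF k] LX_smul_mono_left[of x y k] by auto
  fix D s assume D: "directed_in {0..} D" and s: "is_lub_in {0..} D s" "s \<in> {b. 0 \<le> b \<and> b \<odot> k \<in> W}"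
  have "(SUP d\<in>D. d \<odot> k) = s \<odot> k"
  proof
    fix x
    have "(SUP d\<in>D. ennreal d * k x) = ennreal s * k x"
      by (simp only: SUP_mult_right_ennreal[symmetric] SUP_ennreal_lub[OF D s(1)])
    then show "(SUP d\<in>D. d \<odot> k) x = (s \<odot> k) x" by (simp add: LX_smul_def image_image)
  qed
  moreover have "directed_in (LX X) ((\<lambda>d. d \<odot> k) ` D)"
    unfolding directed_in_def
  proof (intro conjI ballI)
    fix a b assume "a \<in> (\<lambda>d. d \<odot> k) ` D" "b \<in> (\<lambda>d. d \<odot> k) ` D"
    then obtain d e where de: "d \<in> D" "e \<in> D" "a = d \<odot> k" "b = e \<odot> k" by blast
    then obtain c where "c \<in> D" "d \<le> c" "e \<le> c" using D unfolding directed_in_def by blast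
    with de show "\<exists>z\<in>(\<lambda>d. d \<odot> k) ` D. a \<le> z \<and> b \<le> z" by (auto intro: LX_smul_mono_left)
  qed (use D k in \<open>auto simp: directed_in_def LX_smul\<close>)
  ultimately obtain d where "d \<in> D" "d \<odot> k \<in> W" using dir s(2) by force
  with D show "D \<inter> {b. 0 \<le> b \<and> b \<odot> k \<in> W} \<noteq> {}" by (auto simp: directed_in_def)
qed auto

text \<open>Separate continuity becomes joint through approximants: with one argument fixed, the
  other is replaced by an approximant still in the preimage, and then the first is treated with this
  approximant fixed. Everything in the two neighbourhoods dominates the resulting value in
  \<open>W\<close>.\<close>

lemma topological_cone_LX_locally_compact:
  assumes Y: "locally_compact_base Y"
  shows "LX_topological_cone Y"
  unfolding topological_cone_def
proof (intro conjI t0_space_LX_scott)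
  let ?T = "LX_scott Y"
  show "continuous_map (prod_topology ?T ?T) ?T (\<lambda>(x, y). x \<oplus> y)"
    unfolding continuous_map_def
  proof (intro conjI allI impI)
    show "(\<lambda>(x, y). x \<oplus> y) \<in> topspace (prod_topology ?T ?T) \<rightarrow> topspace ?T" by (auto intro: LX_add)
    fix W assume W: "openin ?T W"
    have up: "\<And>x y. x \<in> W \<Longrightarrow> y \<in> LX Y \<Longrightarrow> x \<le> y \<Longrightarrow> y \<in> W" using W unfolding openin_LX_scott by blast
    show "openin (prod_topology ?T ?T) {z \<in> topspace (prod_topology ?T ?T). (case z of (x, y) \<Rightarrow> x \<oplus> y) \<in> W}"
      unfolding openin_prod_topology_alt
    proof (intro allI impI)
      fix x y assume "(x, y) \<in> {z \<in> topspace (prod_topology ?T ?T). (case z of (x, y) \<Rightarrow> x \<oplus> y) \<in> W}"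
      then have xy: "x \<in> LX Y" "y \<in> LX Y" "x \<oplus> y \<in> W" by auto
      have "x \<in> {x \<in> LX Y. x \<oplus> y \<in> W}" using xy by simp
      from approximant_in_open[OF Y open_translate_preimage[OF W xy(2)] this] obtain k N where
        N: "k \<in> LX Y" "k \<oplus> y \<in> W" "openin ?T N" "x \<in> N" "\<And>l. l \<in> N \<Longrightarrow> k \<le> l"
        by (metis (no_types, lifting) mem_Collect_eq)
      have "y \<in> {y \<in> LX Y. y \<oplus> k \<in> W}" using xy N by (simp add: LX_add_commute)
      from approximant_in_open[OF Y open_translate_preimage[OF W N(1)] this] obtain k' N' where
        N': "k' \<in> LX Y" "k' \<oplus> k \<in> W" "openin ?T N'" "y \<in> N'" "\<And>l. l \<in> N' \<Longrightarrow> k' \<le> l"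
        by (metis (no_types, lifting) mem_Collect_eq)
      have sub: "N \<subseteq> LX Y" "N' \<subseteq> LX Y" using N(3) N'(3) unfolding openin_LX_scott by auto
      have "l \<oplus> l' \<in> W" if "l \<in> N" "l' \<in> N'" for l l'
      proof (rule up[OF N'(2)])
        show "l \<oplus> l' \<in> LX Y" using that sub by (intro LX_add) auto
        show "k' \<oplus> k \<le> l \<oplus> l'" unfolding LX_add_commute[of k' k] by (intro LX_add_mono N N' that)
      qed
      with N N' sub show "\<exists>U V. openin ?T U \<and> openin ?T V \<and> x \<in> U \<and> y \<in> V \<and>
          U \<times> V \<subseteq> {z \<in> topspace (prod_topology ?T ?T). (case z of (x, y) \<Rightarrow> x \<oplus> y) \<in> W}"
        by (intro exI[of _ N] exI[of _ N']) auto
    qed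
  qed
  show "continuous_map (prod_topology Rplus_scott ?T) ?T (\<lambda>(a, x). a \<odot> x)"
    unfolding continuous_map_def
  proof (intro conjI allI impI)
    have topR: "topspace Rplus_scott = {0..}" by (simp add: Rplus_scott_def)
    show "(\<lambda>(a, x). a \<odot> x) \<in> topspace (prod_topology Rplus_scott ?T) \<rightarrow> topspace ?T" by (auto intro: LX_smul)
    fix W assume W: "openin ?T W"
    have up: "\<And>x y. x \<in> W \<Longrightarrow> y \<in> LX Y \<Longrightarrow> x \<le> y \<Longrightarrow> y \<in> W" using W unfolding openin_LX_scott by blast
    show "openin (prod_topology Rplus_scott ?T) {z \<in> topspace (prod_topology Rplus_scott ?T). (case z of (a, x) \<Rightarrow> a \<odot> x) \<in> W}"
      unfolding openin_prod_topology_alt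
    proof (intro allI impI)
      fix a x assume "(a, x) \<in> {z \<in> topspace (prod_topology Rplus_scott ?T). (case z of (a, x) \<Rightarrow> a \<odot> x) \<in> W}"
      then have ax: "0 \<le> a" "x \<in> LX Y" "a \<odot> x \<in> W" by (auto simp: topR)
      have "x \<in> {x \<in> LX Y. a \<odot> x \<in> W}" using ax by simp
      from approximant_in_open[OF Y open_scale_preimage[OF W] this] obtain k N where
        N: "k \<in> LX Y" "a \<odot> k \<in> W" "openin ?T N" "x \<in> N" "\<And>l. l \<in> N \<Longrightarrow> k \<le> l"
        by (metis (no_types, lifting) mem_Collect_eq)
      have sub: "N \<subseteq> LX Y" using N(3) unfolding openin_LX_scott by auto
      have "b \<odot> l \<in> W" if "b \<odot> k \<in> W" "l \<in> N" for b l
        using that sub by (intro up[OF that(1)] LX_smul LX_smul_mono N) auto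
      with N ax sub show "\<exists>U V. openin Rplus_scott U \<and> openin ?T V \<and> a \<in> U \<and> x \<in> V \<and>
          U \<times> V \<subseteq> {z \<in> topspace (prod_topology Rplus_scott ?T). (case z of (a, x) \<Rightarrow> a \<odot> x) \<in> W}"
        by (intro exI[of _ "{b. 0 \<le> b \<and> b \<odot> k \<in> W}"] exI[of _ N] conjI open_ray_preimage[OF W])
          (auto simp: topR)
    qed
  qed
qed

section \<open>LCS-complete spaces\<close>

(* If no V n lies in U, a closed set minimal among those missing U and meeting every V n is
   irreducible, and its generic point lies in every V n but not in U. *)
lemma sober_interleaved_compact:
  assumes Y: "sober_space Y" and V: "\<And>n. openin Y (V n)" and Q: "\<And>n. compactin Y (Q n)"
    and VQ: "\<And>n. V (Suc n) \<subseteq> Q n" "\<And>n. Q n \<subseteq> V n"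
    and U: "openin Y U" "(\<Inter>n. V n) \<subseteq> U"
  shows "\<exists>n. V n \<subseteq> U"
proof (rule ccontr)
  assume "\<nexists>n. V n \<subseteq> U"
  then have notsub: "\<not> V n \<subseteq> U" for n by blast
  have decr: "V n \<subseteq> V m" if "m \<le> n" for m n
  proof -
    have "V (Suc n) \<subseteq> V n" for n using VQ(1)[of n] VQ(2)[of n] by (rule order_trans)
    then show ?thesis using that by (rule lift_Suc_antimono_le)
  qed
  define \<C> where "\<C> = {C. closedin Y C \<and> C \<inter> U = {} \<and> (\<forall>n. C \<inter> V n \<noteq> {})}"
  have "\<exists>C\<in>\<C>. \<forall>C'\<in>\<C>. C' \<subseteq> C \<longrightarrow> C' = C"
  proof (rule predicate_Zorn)
    show "partial_order_on \<C> (relation_of (\<lambda>a b. b \<subseteq> a) \<C>)"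
      by (rule partial_order_on_relation_ofI) auto
  next
    fix \<K> assume "\<K> \<in> Chains (relation_of (\<lambda>a b. b \<subseteq> a) \<C>)"
    then have \<K>: "\<K> \<subseteq> \<C>" and tot: "\<And>A B. A \<in> \<K> \<Longrightarrow> B \<in> \<K> \<Longrightarrow> A \<subseteq> B \<or> B \<subseteq> A"
      unfolding Chains_def relation_of_def by blast+
    show "\<exists>u\<in>\<C>. \<forall>a\<in>\<K>. u \<subseteq> a"
    proof (cases "\<K> = {}")
      case True
      have "topspace Y - U \<in> \<C>"
        unfolding \<C>_def
      proof (intro CollectI conjI allI)
        show "closedin Y (topspace Y - U)" using U(1) by blast
        show "(topspace Y - U) \<inter> V n \<noteq> {}" for n
          using notsub[of n] openin_subset[OF V[of n]] by blast
      qed blast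
      with True show ?thesis by blast
    next
      case False
      have fin: "\<exists>A\<in>\<K>. A \<subseteq> \<Inter>\<F>" if "finite \<F>" "\<F> \<subseteq> \<K>" for \<F>
        using that
      proof (induction \<F> rule: finite_induct)
        case empty
        then show ?case using False by auto
      next
        case (insert B \<F>)
        then obtain A where A: "A \<in> \<K>" "A \<subseteq> \<Inter>\<F>" by blast
        have B: "B \<in> \<K>" using insert.prems by blast
        from tot[OF A(1) B] show ?case
        proof
          assume "A \<subseteq> B"
          with A show ?thesis by (intro bexI[of _ A]) auto
        next
          assume "B \<subseteq> A"
          with A B show ?thesis by (intro bexI[of _ B]) auto
        qed
      qed
      \<comment> \<open>Members of the chain meet \<open>V (Suc n)\<close>, hence the compact
        \<open>Q n\<close>, so all of them share a point of \<open>Q n\<close>, which lies in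
        \<open>V n\<close>.\<close>
      have "Q n \<inter> \<Inter>\<K> \<noteq> {}" for n
      proof -
        have "Q n \<inter> \<Inter>\<F> \<noteq> {}" if "finite \<F>" "\<F> \<subseteq> \<K>" for \<F>
        proof -
          from fin[OF that] obtain A where "A \<in> \<K>" "A \<subseteq> \<Inter>\<F>" by blast
          moreover from this \<K> have "A \<inter> V (Suc n) \<noteq> {}" by (auto simp: \<C>_def)
          ultimately show ?thesis using VQ(1)[of n] by blast
        qed
        moreover have "\<forall>C\<in>\<K>. closedin Y C" using \<K> by (auto simp: \<C>_def)
        ultimately show ?thesis using Q[of n] unfolding compactin_fip by blast
      qed
      then have "\<Inter>\<K> \<inter> V n \<noteq> {}" for n using VQ(2)[of n] by blast
      moreover have "closedin Y (\<Inter>\<K>)" using \<K> False by (intro closedin_Inter) (auto simp: \<C>_def)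
      moreover have "\<Inter>\<K> \<inter> U = {}" using \<K> False by (auto simp: \<C>_def)
      ultimately have "\<Inter>\<K> \<in> \<C>" by (simp add: \<C>_def)
      then show ?thesis by blast
    qed
  qed
  then obtain C where C: "C \<in> \<C>" and min: "\<And>C'. C' \<in> \<C> \<Longrightarrow> C' \<subseteq> C \<Longrightarrow> C' = C" by blast
  have Cc: "closedin Y C" "C \<inter> U = {}" "\<And>n. C \<inter> V n \<noteq> {}" using C by (auto simp: \<C>_def)
  \<comment> \<open>By minimality, the trace of \<open>C\<close> on a closed set not containing it
    misses some \<open>V n\<close>. As the \<open>V n\<close> decrease, two such closed sets cannot
    cover \<open>C\<close>.\<close>
  have miss: "\<exists>n. C \<inter> A \<inter> V n = {}" if "closedin Y A" "\<not> C \<subseteq> A" for A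
  proof (rule ccontr)
    assume "\<nexists>n. C \<inter> A \<inter> V n = {}"
    then have "C \<inter> A \<in> \<C>" using Cc that by (auto simp: \<C>_def)
    then show False using min[of "C \<inter> A"] that by blast
  qed
  have "irreducible_closed Y C"
    unfolding irreducible_closed_def
  proof (intro conjI allI impI)
    show "C \<noteq> {}" using Cc(3) by blast
    fix A B assume AB: "closedin Y A \<and> closedin Y B \<and> C \<subseteq> A \<union> B"
    show "C \<subseteq> A \<or> C \<subseteq> B"
    proof (rule ccontr)
      assume "\<not> (C \<subseteq> A \<or> C \<subseteq> B)"
      then obtain m n where "C \<inter> A \<inter> V m = {}" "C \<inter> B \<inter> V n = {}" using miss AB by meson
      moreover have "V (max m n) \<subseteq> V m" "V (max m n) \<subseteq> V n" by (rule decr; simp)+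
      ultimately have "C \<inter> V (max m n) = {}" using AB by blast
      with Cc(3) show False by blast
    qed
  qed (rule Cc(1))
  then obtain x where x: "x \<in> topspace Y" "Y closure_of {x} = C"
    using Y unfolding sober_space_def by blast
  have "x \<in> V n" for n
  proof -
    obtain y where "y \<in> C" "y \<in> V n" using Cc(3)[of n] by blast
    then show ?thesis using V[of n] unfolding x(2)[symmetric] in_closure_of by blast
  qed
  with U(2) have "x \<in> U" by blast
  moreover have "x \<in> C" using x closure_of_subset[of "{x}" Y] by auto
  ultimately show False using Cc(2) by blast
qed

section \<open>Linear previsions carried by a G-delta set\<close>

lemma chi_modular: "chi U \<oplus> chi V = chi (U \<union> V) \<oplus> chi (U \<inter> V)"
  by (auto simp: chi_def LX_add_def)

lemma chi_mono: "U \<subseteq> V \<Longrightarrow> chi U \<le> chi V"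
  by (auto simp: chi_def le_fun_def)

text \<open>Modularity of indicators passes to \<open>G\<close>; the mass of \<open>V\<close>, at
  least 1, then cancels against that of the union, at most 1.\<close>

lemma chi_Int_mass_one:
  assumes G: "linear_prevision Y G" and UV: "openin Y U" "openin Y V"
    and V1: "1 \<le> G (chi V)" and tot: "G (LX_one Y) \<le> 1"
  shows "G (chi U) \<le> G (chi (U \<inter> V))"
proof -
  have L: "chi U \<in> LX Y" "chi V \<in> LX Y" "chi (U \<union> V) \<in> LX Y" "chi (U \<inter> V) \<in> LX Y"
    using UV by (auto intro: LX_chi)
  have "1 + G (chi U) \<le> G (chi U) + G (chi V)" using V1 by (simp add: add.commute add_left_mono)
  also have "\<dots> = G (chi (U \<union> V)) + G (chi (U \<inter> V))"
    by (simp only: linear_add[OF G L(1,2), symmetric] linear_add[OF G L(3,4), symmetric] chi_modular[of U V])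
  also have "G (chi (U \<union> V)) \<le> G (LX_one Y)"
    using UV L by (intro sublin_mono[OF linear_sublin[OF G]] LX_one) (auto simp: LX_one_eq_chi intro!: chi_mono dest: openin_subset)
  also note tot
  finally have "1 + G (chi U) \<le> 1 + G (chi (U \<inter> V))" by (simp add: add_right_mono)
  then show ?thesis by (simp add: ennreal_add_left_cancel_le)
qed

text \<open>The open sets separated from the complement of \<open>W\<close> by a compact set are
  directed under unions, and local compactness makes \<open>chi W\<close> the supremum of their
  indicators.\<close>

lemma mass_inner_approx:
  assumes Y: "locally_compact_base Y" and G: "linear_prevision Y G" and W: "openin Y W" "r < G (chi W)"
  shows "\<exists>V Q. openin Y V \<and> compactin Y Q \<and> V \<subseteq> Q \<and> Q \<subseteq> W \<and> r < G (chi V)"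
proof -
  let ?V = "{V. openin Y V \<and> (\<exists>Q. compactin Y Q \<and> V \<subseteq> Q \<and> Q \<subseteq> W)}"
  have dir: "directed_in (LX Y) (chi ` ?V)"
    unfolding directed_in_def
  proof (intro conjI ballI)
    show "chi ` ?V \<subseteq> LX Y" by (auto intro: LX_chi)
    have "{} \<in> ?V" by (intro CollectI conjI openin_empty exI[of _ "{}"]) auto
    then show "chi ` ?V \<noteq> {}" by blast
    fix a b assume "a \<in> chi ` ?V" "b \<in> chi ` ?V"
    then obtain V V' Q Q' where V: "openin Y V" "compactin Y Q" "V \<subseteq> Q" "Q \<subseteq> W" "a = chi V"
      "openin Y V'" "compactin Y Q'" "V' \<subseteq> Q'" "Q' \<subseteq> W" "b = chi V'" by blast
    have "openin Y (V \<union> V')" "compactin Y (Q \<union> Q')" "V \<union> V' \<subseteq> Q \<union> Q'" "Q \<union> Q' \<subseteq> W"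
      using V by (auto intro: compactin_Un)
    then have "V \<union> V' \<in> ?V" by blast
    then show "\<exists>z\<in>chi ` ?V. a \<le> z \<and> b \<le> z"
      unfolding V(5,10) by (intro bexI[of _ "chi (V \<union> V')"] conjI chi_mono) auto
  qed
  have "Sup (chi ` ?V) = chi W"
  proof (rule antisym)
    show "Sup (chi ` ?V) \<le> chi W" by (rule Sup_least) (auto intro!: chi_mono)
    show "chi W \<le> Sup (chi ` ?V)"
    proof (rule le_funI)
      fix y show "chi W y \<le> Sup (chi ` ?V) y"
      proof (cases "y \<in> W")
        case True
        have "y \<in> topspace Y" using True openin_subset[OF W(1)] by blast
        with Y W(1) True obtain V Q where V: "openin Y V" "compactin Y Q" "y \<in> V" "V \<subseteq> Q" "Q \<subseteq> W"
          unfolding locally_compact_base_def by metis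
        then have "chi V \<in> chi ` ?V" by blast
        then have "chi V \<le> Sup (chi ` ?V)" by (rule Sup_upper)
        then have "chi V y \<le> Sup (chi ` ?V) y" by (rule le_funD)
        with V(3) True show ?thesis by (simp add: chi_def)
      qed (simp add: chi_def)
    qed
  qed
  with sc_Sup[OF linear_sc[OF G] dir] have "G (chi W) = (SUP d\<in>chi ` ?V. G d)" by simp
  with W(2) obtain d where "d \<in> chi ` ?V" "r < G d" by (auto simp: less_SUP_iff)
  then show ?thesis by blast
qed

text \<open>\<open>U\<close> is shrunk step by step into the \<open>A n\<close> through compact
  sets, keeping mass above \<open>r\<close> because intersecting with \<open>A n\<close> costs
  nothing. The shrinking sets have their intersection in \<open>U'\<close>, so by soberness one of
  them already lies in \<open>U'\<close>.\<close>

lemma mass_on_Gdelta: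
  fixes A :: "nat \<Rightarrow> 'a set"
  assumes Y: "locally_compact_base Y" "sober_space Y" and G: "linear_prevision Y G"
    and A: "\<And>n. openin Y (A n)" "\<And>n. 1 \<le> G (chi (A n))" and tot: "G (LX_one Y) \<le> 1"
    and U: "openin Y U" "openin Y U'" "U \<inter> (\<Inter>n. A n) \<subseteq> U'"
  shows "G (chi U) \<le> G (chi U')"
proof (rule dense_le)
  fix r assume r: "r < G (chi U)"
  have "\<exists>V. \<forall>n. (openin Y (V n) \<and> V n \<subseteq> U \<and> r < G (chi (V n))) \<and>
      (\<exists>Q. compactin Y Q \<and> V (Suc n) \<subseteq> Q \<and> Q \<subseteq> V n \<inter> A n)"
  proof (rule dependent_nat_choice)
    show "\<exists>V. openin Y V \<and> V \<subseteq> U \<and> r < G (chi V)" using U r by blast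
    fix V n assume V: "openin Y V \<and> V \<subseteq> U \<and> r < G (chi V)"
    then have Vo: "openin Y V" and rV: "r < G (chi V)" by simp_all
    have "r < G (chi (V \<inter> A n))"
      using rV chi_Int_mass_one[OF G Vo A(1) A(2) tot] by (rule less_le_trans)
    from mass_inner_approx[OF Y(1) G openin_Int[OF Vo A(1)] this]
    obtain V' Q where V': "openin Y V'" "compactin Y Q" "V' \<subseteq> Q" "Q \<subseteq> V \<inter> A n" "r < G (chi V')"
      by blast
    then have "V' \<subseteq> U" using V by blast
    with V' show "\<exists>V'. (openin Y V' \<and> V' \<subseteq> U \<and> r < G (chi V')) \<and> (\<exists>Q. compactin Y Q \<and> V' \<subseteq> Q \<and> Q \<subseteq> V \<inter> A n)"
      by blast
  qed
  then obtain V where V: "\<And>n. openin Y (V n)" "\<And>n. V n \<subseteq> U" "\<And>n. r < G (chi (V n))"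
    "\<And>n. \<exists>Q. compactin Y Q \<and> V (Suc n) \<subseteq> Q \<and> Q \<subseteq> V n \<inter> A n" by blast
  then obtain Q where Q: "\<And>n. compactin Y (Q n)" "\<And>n. V (Suc n) \<subseteq> Q n" "\<And>n. Q n \<subseteq> V n \<inter> A n" by metis
  have "(\<Inter>n. V n) \<subseteq> A n" for n
  proof -
    have "(\<Inter>n. V n) \<subseteq> V (Suc n)" by (rule INT_lower) simp
    also have "\<dots> \<subseteq> A n" using Q(2)[of n] Q(3)[of n] by blast
    finally show ?thesis .
  qed
  then have "(\<Inter>n. V n) \<subseteq> (\<Inter>n. A n)" by (rule INT_greatest)
  moreover have "(\<Inter>n. V n) \<subseteq> U" by (rule order_trans[OF INT_lower[of 0] V(2)]) simp
  ultimately have "(\<Inter>n. V n) \<subseteq> U \<inter> (\<Inter>n. A n)" by (rule Int_greatest[rotated])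
  then have VU: "(\<Inter>n. V n) \<subseteq> U'" using U(3) by (rule order_trans)
  have QV: "Q n \<subseteq> V n" for n using Q(3)[of n] by simp
  obtain n where "V n \<subseteq> U'"
    using sober_interleaved_compact[of Y V Q U', OF Y(2) V(1) Q(1) Q(2) QV U(2) VU] ..
  then have "G (chi (V n)) \<le> G (chi U')"
    using V(1) U(2) by (intro sublin_mono[OF linear_sublin[OF G]] LX_chi chi_mono)
  then show "r \<le> G (chi U')" using V(3)[of n] by order
qed

text \<open>A layer-cake sum with mesh \<open>1 / N\<close> cut off at height \<open>N\<close>,
  hence \<open>N * N\<close> layers. A linear prevision on it depends only on the masses of
  superlevel sets.\<close>

definition stepfun :: "nat \<Rightarrow> ('a \<Rightarrow> ennreal) \<Rightarrow> 'a \<Rightarrow> ennreal" where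
  "stepfun N k = (\<lambda>x. \<Sum>i\<in>{1..N * N}. ennreal (1 / real N) * chi {x. ennreal (real i / real N) < k x} x)"

definition levels :: "nat \<Rightarrow> ennreal \<Rightarrow> nat set" where
  "levels N y = {i. 1 \<le> i \<and> i \<le> N * N \<and> ennreal (real i / real N) < y}"

lemma finite_levels: "finite (levels N y)"
  by (rule finite_subset[of _ "{1..N * N}"]) (auto simp: levels_def)

lemma stepfun_card: "stepfun N k x = ennreal (real (card (levels N (k x))) / real N)"
proof -
  have "(\<Sum>i\<in>{1..N * N}. ennreal (1 / real N) * chi {x. ennreal (real i / real N) < k x} x) =
      (\<Sum>i\<in>levels N (k x). ennreal (1 / real N))"
  proof (rule sum.mono_neutral_cong_right)
    show "levels N (k x) \<subseteq> {1..N * N}" by (auto simp: levels_def)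
  qed (simp_all add: levels_def chi_def)
  also have "\<dots> = ennreal (\<Sum>i\<in>levels N (k x). 1 / real N)"
    by (rule sum_ennreal) simp
  finally show ?thesis by (simp add: stepfun_def)
qed

lemma stepfun_le: "stepfun N k x \<le> k x"
proof (cases "levels N (k x) = {}")
  case True
  then show ?thesis unfolding stepfun_card by simp
next
  case False
  define m where "m = Max (levels N (k x))"
  have m: "m \<in> levels N (k x)" unfolding m_def by (rule Max_in[OF finite_levels False])
  have "levels N (k x) \<subseteq> {1..m}"
  proof
    fix i assume i: "i \<in> levels N (k x)"
    then have "i \<le> m" unfolding m_def by (rule Max_ge[OF finite_levels])
    with i show "i \<in> {1..m}" by (simp add: levels_def)
  qed
  then have "card (levels N (k x)) \<le> m"
    using card_mono[of "{1..m}" "levels N (k x)"] by simp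
  then have "ennreal (real (card (levels N (k x))) / real N) \<le> ennreal (real m / real N)"
    by (intro ennreal_leI divide_right_mono) auto
  also have "\<dots> \<le> k x" using m by (simp add: levels_def less_imp_le)
  finally show ?thesis unfolding stepfun_card .
qed

text \<open>The active layers form an initial segment. If some layer is inactive, the first such one
  bounds \<open>k x\<close>; if none is, the sum has reached the cut-off \<open>N\<close>.\<close>

lemma stepfun_ge:
  assumes N: "0 < N"
  shows "min (k x) (ennreal (real N)) \<le> stepfun N k x + ennreal (1 / real N)"
proof -
  define c where "c = card (levels N (k x))"
  have eq: "stepfun N k x + ennreal (1 / real N) = ennreal (real (Suc c) / real N)"
    unfolding stepfun_card c_def[symmetric]
    by (simp add: ennreal_plus[symmetric] add_divide_distrib add.commute del: ennreal_plus)
  show ?thesis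
  proof (cases "c < N * N")
    case True
    have "Suc c \<notin> levels N (k x)"
    proof
      assume S: "Suc c \<in> levels N (k x)"
      have "{1..Suc c} \<subseteq> levels N (k x)"
      proof
        fix i assume i: "i \<in> {1..Suc c}"
        then have "ennreal (real i / real N) \<le> ennreal (real (Suc c) / real N)"
          by (intro ennreal_leI divide_right_mono) auto
        also have "\<dots> < k x" using S by (simp add: levels_def)
        finally show "i \<in> levels N (k x)" using i S by (simp add: levels_def)
      qed
      then have "card {1..Suc c} \<le> c" unfolding c_def by (rule card_mono[OF finite_levels])
      then show False by simp
    qed
    with True have "k x \<le> ennreal (real (Suc c) / real N)" by (simp add: levels_def not_less)
    then show ?thesis unfolding eq by (rule min.coboundedI1)
  next
    case False
    then have "real N * real N \<le> real c" by (simp add: not_less flip: of_nat_mult)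
    then have "real N \<le> real (Suc c) / real N" using N by (simp add: pos_le_divide_eq)
    then show ?thesis unfolding eq by (intro min.coboundedI2 ennreal_leI)
  qed
qed

lemma LX_min_const: "k \<in> LX X \<Longrightarrow> (\<lambda>x. min (k x) c) \<in> LX X"
proof -
  assume k: "k \<in> LX X"
  have "{x. r < min (k x) c} = (if r < c then {x. r < k x} else {})" for r by auto
  with k show ?thesis by (simp add: LX_iff)
qed

text \<open>Masses of superlevel sets compare by \<open>mass_on_Gdelta\<close>, hence so do the step
  sums. The mesh costs \<open>1 / N\<close> because the total mass is at most 1, and the cut-off
  disappears by Scott continuity.\<close>

lemma linear_mono_on_Gdelta:
  fixes A :: "nat \<Rightarrow> 'a set"
  assumes Y: "locally_compact_base Y" "sober_space Y" and G: "linear_prevision Y G"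
    and A: "\<And>n. openin Y (A n)" "\<And>n. 1 \<le> G (chi (A n))" and tot: "G (LX_one Y) \<le> 1"
    and k: "k \<in> LX Y" "k' \<in> LX Y" "\<And>y. (\<And>n. y \<in> A n) \<Longrightarrow> k y \<le> k' y"
  shows "G k \<le> G k'"
proof -
  note sub = linear_sublin[OF G]
  have step: "G (\<lambda>x. min (k x) (ennreal (real N))) \<le> G k' + ennreal (1 / real N)" if N: "0 < N" for N :: nat
  proof -
    have L: "chi {x. ennreal (real i / real N) < f x} \<in> LX Y" if "f \<in> LX Y" for f and i :: nat
      using that by (intro LX_chi) (simp add: LX_iff)
    have S: "stepfun N f \<in> LX Y \<and> G (stepfun N f) = (\<Sum>i\<in>{1..N * N}. ennreal (1 / real N) * G (chi {x. ennreal (real i / real N) < f x}))"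
      if "f \<in> LX Y" for f
      unfolding stepfun_def using L[OF that] by (intro conjI linear_sum_arg[OF G] LX_sum_arg) auto
    have "G (\<lambda>x. min (k x) (ennreal (real N))) \<le> G (stepfun N k \<oplus> (1 / real N) \<odot> LX_one Y)"
    proof (rule sublin_mono[OF sub])
      show "(\<lambda>x. min (k x) (ennreal (real N))) \<le> stepfun N k \<oplus> (1 / real N) \<odot> LX_one Y"
      proof (rule le_funI)
        fix x show "min (k x) (ennreal (real N)) \<le> (stepfun N k \<oplus> (1 / real N) \<odot> LX_one Y) x"
          using stepfun_ge[OF N, of k x] LX_outside[OF k(1), of x]
          by (cases "x \<in> topspace Y") (auto simp: LX_add_def LX_smul_def LX_one_def)
      qed
    qed (use k S in \<open>auto intro: LX_min_const LX_add LX_smul LX_one\<close>)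
    also have "\<dots> = G (stepfun N k) + ennreal (1 / real N) * G (LX_one Y)"
      using S[OF k(1)] LX_one[of Y] by (simp add: linear_add[OF G] LX_smul sublin_smul[OF sub])
    also have "\<dots> \<le> G (stepfun N k) + ennreal (1 / real N) * 1"
      by (intro add_left_mono mult_left_mono tot) simp
    also have "G (stepfun N k) \<le> G (stepfun N k')"
    proof -
      have "G (chi {x. t < k x}) \<le> G (chi {x. t < k' x})" for t
      proof (rule mass_on_Gdelta[OF Y G A tot])
        show "openin Y {x. t < k x}" "openin Y {x. t < k' x}" using k by (simp_all add: LX_iff)
        show "{x. t < k x} \<inter> (\<Inter>n. A n) \<subseteq> {x. t < k' x}"
        proof
          fix x assume "x \<in> {x. t < k x} \<inter> (\<Inter>n. A n)"
          then have "t < k x" "k x \<le> k' x" using k(3)[of x] by simp_all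
          then show "x \<in> {x. t < k' x}" by simp
        qed
      qed
      then show ?thesis using S[OF k(1)] S[OF k(2)] by (auto intro!: sum_mono mult_left_mono)
    qed
    also have "G (stepfun N k') \<le> G k'"
      using S[OF k(2)] k(2) stepfun_le by (intro sublin_mono[OF sub]) (auto simp: le_fun_def)
    finally show ?thesis by (simp add: add_right_mono)
  qed
  have bounded: "G (\<lambda>x. min (k x) (ennreal (real N))) \<le> G k'" for N :: nat
  proof (rule ennreal_le_epsilon)
    fix e :: real assume "0 < e"
    then obtain n :: nat where n: "0 < n" "1 / real n < e"
      by (metis nat_approx_posE zero_less_Suc)
    \<comment> \<open>The cut-off \<open>N\<close> is fixed while the mesh error has to vanish;
      raising the cut-off to \<open>M\<close> only enlarges the left-hand side.\<close>
    define M where "M = max N n"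
    have M: "0 < M" "N \<le> M" "n \<le> M" using n by (auto simp: M_def)
    have "1 / real M \<le> 1 / real n" using M n by (simp add: frac_le)
    then have Me: "ennreal (1 / real M) \<le> ennreal e" using n by (intro ennreal_leI) simp
    have "G (\<lambda>x. min (k x) (ennreal (real N))) \<le> G (\<lambda>x. min (k x) (ennreal (real M)))"
      using M(2) by (intro sublin_mono[OF sub] LX_min_const k(1) le_funI min.mono order_refl ennreal_leI) simp
    also have "\<dots> \<le> G k' + ennreal (1 / real M)" by (rule step[OF M(1)])
    also have "\<dots> \<le> G k' + ennreal e" by (intro add_left_mono Me)
    finally show "G (\<lambda>x. min (k x) (ennreal (real N))) \<le> G k' + ennreal e" .
  qed
  let ?D = "range (\<lambda>N::nat. \<lambda>x. min (k x) (ennreal (real N)))"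
  have "directed_in (LX Y) ?D"
    unfolding directed_in_def
  proof (intro conjI ballI)
    fix a b assume "a \<in> ?D" "b \<in> ?D"
    then obtain m n :: nat where mn: "a = (\<lambda>x. min (k x) (ennreal (real m)))" "b = (\<lambda>x. min (k x) (ennreal (real n)))" by blast
    have "ennreal (real m) \<le> ennreal (real (max m n))" "ennreal (real n) \<le> ennreal (real (max m n))" by (intro ennreal_leI; simp)+
    then show "\<exists>z\<in>?D. a \<le> z \<and> b \<le> z"
      unfolding mn by (intro bexI[of _ "\<lambda>x. min (k x) (ennreal (real (max m n)))"] conjI le_funI min.mono) auto
  qed (use k in \<open>auto intro: LX_min_const\<close>)
  moreover have "Sup ?D = k"
  proof (rule antisym)
    show "Sup ?D \<le> k" by (rule Sup_least) (auto simp: le_fun_def)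
    show "k \<le> Sup ?D"
    proof (rule le_funI, rule dense_le)
      fix x r assume r: "r < k x"
      then obtain z where z: "r = ennreal z" "0 \<le> z" by (cases r) auto
      obtain N :: nat where "z \<le> N" using real_arch_simple by blast
      then have "r \<le> min (k x) (ennreal (real N))" using r z by (auto intro: ennreal_leI less_imp_le)
      moreover have "(\<lambda>x. min (k x) (ennreal (real N))) \<le> Sup ?D" by (rule Sup_upper) simp
      then have "min (k x) (ennreal (real N)) \<le> Sup ?D x" by (rule le_funD)
      ultimately show "r \<le> Sup ?D x" by order
    qed
  qed
  ultimately have "G k = (SUP d\<in>?D. G d)" using sc_Sup[OF linear_sc[OF G], of ?D] by simp
  also have "\<dots> \<le> G k'" using bounded by (intro SUP_least) auto
  finally show ?thesis .
qed

section \<open>Transfer between a space and its image in a locally compact sober space\<close>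

definition pull :: "'a topology \<Rightarrow> ('a \<Rightarrow> 'b) \<Rightarrow> ('b \<Rightarrow> ennreal) \<Rightarrow> 'a \<Rightarrow> ennreal" where
  "pull X f k = (\<lambda>x. if x \<in> topspace X then k (f x) else 0)"

(* The largest lower semicontinuous map on Y whose pullback along f lies below h. *)
definition extend :: "'a topology \<Rightarrow> 'b topology \<Rightarrow> ('a \<Rightarrow> 'b) \<Rightarrow> ('a \<Rightarrow> ennreal) \<Rightarrow> 'b \<Rightarrow> ennreal" where
  "extend X Y f h = (\<lambda>y. SUP U\<in>{U. openin Y U \<and> y \<in> U}. INF x\<in>{x \<in> topspace X. f x \<in> U}. h x)"

lemma LX_pull: "continuous_map X Y f \<Longrightarrow> k \<in> LX Y \<Longrightarrow> pull X f k \<in> LX X"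
proof -
  assume f: "continuous_map X Y f" and k: "k \<in> LX Y"
  have "{x. r < pull X f k x} = {x \<in> topspace X. f x \<in> {y. r < k y}}" for r
    by (auto simp: pull_def)
  moreover have "openin X {x \<in> topspace X. f x \<in> {y. r < k y}}" for r
    using k by (intro openin_continuous_map_preimage[OF f]) (simp add: LX_iff)
  ultimately show ?thesis by (simp add: LX_iff)
qed

lemma LX_extend: "extend X Y f h \<in> LX Y"
  unfolding LX_iff
proof (intro allI, subst openin_subopen, intro ballI)
  fix r y assume "y \<in> {y. r < extend X Y f h y}"
  then obtain U where U: "openin Y U" "y \<in> U" "r < (INF x\<in>{x \<in> topspace X. f x \<in> U}. h x)"
    by (auto simp: extend_def less_SUP_iff)
  have "U \<subseteq> {y. r < extend X Y f h y}"
  proof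
    fix z assume "z \<in> U"
    with U(1) have "(INF x\<in>{x \<in> topspace X. f x \<in> U}. h x) \<le> extend X Y f h z"
      unfolding extend_def by (intro SUP_upper) auto
    with U(3) show "z \<in> {y. r < extend X Y f h y}" by (auto intro: less_le_trans)
  qed
  with U show "\<exists>T. openin Y T \<and> y \<in> T \<and> T \<subseteq> {y. r < extend X Y f h y}" by blast
qed

lemma extend_mono: "h \<le> h' \<Longrightarrow> extend X Y f h \<le> extend X Y f h'"
  unfolding extend_def by (intro le_funI SUP_mono' INF_mono') (simp add: le_fun_def)

text \<open>Nothing is lost on the image of \<open>X\<close>: the superlevel set of \<open>h\<close>
  at \<open>r\<close> is the trace of an open \<open>U\<close> of \<open>Y\<close>, and
  \<open>h\<close> is at least \<open>r\<close> on the whole preimage of \<open>U\<close>.\<close>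

lemma extend_at:
  assumes f: "homeomorphic_map X (subtopology Y S) f" and h: "h \<in> LX X" and x: "x \<in> topspace X"
  shows "extend X Y f h (f x) = h x"
proof (rule antisym)
  show "extend X Y f h (f x) \<le> h x"
    unfolding extend_def using x by (intro SUP_least) (auto intro!: INF_lower)
  show "h x \<le> extend X Y f h (f x)"
  proof (rule dense_le)
    fix r assume r: "r < h x"
    let ?V = "{z. r < h z}"
    have V: "openin X ?V" using h by (simp add: LX_iff)
    then have "openin (subtopology Y S) (f ` ?V)"
      using f by (simp add: homeomorphic_map_openness_eq openin_subset)
    then obtain U where U: "openin Y U" "f ` ?V = U \<inter> S" by (auto simp: openin_subtopology)
    have "r \<le> (INF z\<in>{z \<in> topspace X. f z \<in> U}. h z)"
    proof (rule INF_greatest)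
      fix z assume z: "z \<in> {z \<in> topspace X. f z \<in> U}"
      have "f z \<in> S"
        using z homeomorphic_imp_surjective_map[OF f] by (auto simp: topspace_subtopology)
      with z U(2) obtain w where w: "w \<in> ?V" "f z = f w" by blast
      moreover have "w \<in> topspace X" using w(1) openin_subset[OF V] by blast
      ultimately have "z = w"
        using z homeomorphic_imp_injective_map[OF f] by (auto dest: inj_onD)
      with w(1) show "r \<le> h z" by (auto intro: less_imp_le)
    qed
    also have "\<dots> \<le> extend X Y f h (f x)"
      unfolding extend_def using U r by (intro SUP_upper) auto
    finally show "r \<le> extend X Y f h (f x)" .
  qed
qed

text \<open>\<open>F\<close> is moved to \<open>Y\<close> by pulling maps back, and \<open>G\<close>
  is moved to \<open>X\<close> by extending them. Extension need not be additive or preserve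
  suprema, but it is exact on \<open>S\<close>, and \<open>G\<close> sees only the values on
  \<open>S\<close>, so the required laws hold after applying \<open>G\<close>.\<close>

lemma representable_Norm_LCS:
  fixes X :: "'a topology" and Y :: "'b topology"
  assumes Y: "locally_compact_base Y" "sober_space Y" and S: "gdelta_in Y S"
    and hom: "X homeomorphic_space subtopology Y S"
  shows "representable Norm X"
proof (rule representableI)
  fix F h assume F: "F \<in> PAP Norm X" and h: "h \<in> LX X" "1 < F h"
  have Fs: "sublin X F" "sc X F" using F by (auto simp: PAP_def hoare_prevision_iff)
  obtain f where f: "homeomorphic_map X (subtopology Y S) f"
    using hom homeomorphic_space by blast
  obtain A where A: "\<And>n::nat. openin Y (A n)" "\<And>n. A (Suc n) \<subseteq> A n" "\<Inter>(range A) = S"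
    using S unfolding gdelta_in_descending by blast
  have SY: "S \<subseteq> topspace Y" using A(3) openin_subset[OF A(1)] by blast
  have cont: "continuous_map X Y f"
    using homeomorphic_imp_continuous_map[OF f] by (rule continuous_map_into_fulltopology)
  have fS: "f ` topspace X = S"
    using homeomorphic_imp_surjective_map[OF f] SY by auto
  have decr: "A n \<subseteq> A m" if "m \<le> n" for m n
    using that A(2) by (rule lift_Suc_antimono_le[rotated])
  let ?p = "pull X f" and ?e = "extend X Y f"
  have pe: "?p (?e g) = g" if "g \<in> LX X" for g
    using extend_at[OF f that] LX_outside[OF that] by (auto simp: pull_def)
  have padd: "?p (k \<oplus> k') = ?p k \<oplus> ?p k'" for k k' by (auto simp: pull_def LX_add_def)
  have psmul: "?p (a \<odot> k) = a \<odot> ?p k" for a k by (auto simp: pull_def LX_smul_def)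
  have pmono: "?p k \<le> ?p k'" if "k \<le> k'" for k k' using that by (auto simp: pull_def le_fun_def)
  have pL: "?p k \<in> LX X" if "k \<in> LX Y" for k using LX_pull[OF cont that] .
  have pA: "?p (chi (A n)) = LX_one X" for n
  proof -
    have "f x \<in> A n" if "x \<in> topspace X" for x using that fS A(3) by blast
    then show ?thesis by (auto simp: pull_def chi_def LX_one_def)
  qed
  have pone: "?p (LX_one Y) = LX_one X"
    using fS SY by (fastforce simp: pull_def LX_one_def)
  have AL: "chi (A n) \<in> LX Y" for n by (rule LX_chi[OF A(1)])
  define F' where "F' k = (if k \<in> LX Y then F (?p k) else 0)" for k
  have "sublin Y F'"
  proof (rule sublinI)
    show "F' k \<le> F' k'" if "k \<in> LX Y" "k' \<in> LX Y" "k \<le> k'" for k k'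
      using that by (simp add: F'_def sublin_mono[OF Fs(1)] pL pmono)
    show "ennreal a * F' k \<le> F' (a \<odot> k)" if "0 < a" "k \<in> LX Y" for a k
      using that by (simp add: F'_def psmul LX_smul sublin_smul[OF Fs(1)] pL)
    show "F' (k \<oplus> k') \<le> F' k + F' k'" if "k \<in> LX Y" "k' \<in> LX Y" for k k'
      using that by (simp add: F'_def padd LX_add sublin_add[OF Fs(1)] pL)
    have "?p (\<lambda>_. 0) = (\<lambda>_. 0)" by (auto simp: pull_def)
    then show "F' (\<lambda>_. 0) = 0" by (simp add: F'_def sublin_zero[OF Fs(1)])
  qed (simp add: F'_def)
  moreover have "sc Y (\<lambda>k. F (?p k))"
  proof (rule sc_compose[OF Fs(2)])
    show "?p (Sup D) = (SUP d\<in>D. ?p d)" if "directed_in (LX Y) D" for D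
    proof -
      have "D \<noteq> {}" using that by (simp add: directed_in_def)
      then show ?thesis by (auto simp: pull_def fun_eq_iff image_image)
    qed
  qed (use pL pmono in auto)
  then have "sc Y F'" by (rule sc_cong[THEN iffD1, rotated]) (simp add: F'_def)
  ultimately have F'H: "hoare_prevision Y F'" by (simp add: hoare_prevision_iff)
  have sh: "shifts Y (range (\<lambda>n. chi (A n))) F'"
    using PAP_Norm_shifts[OF F] unfolding shifts_def
    by (auto simp: F'_def padd psmul pA LX_add LX_smul AL pL)
  have "?e h \<in> LX Y" "1 < F' (?e h)" using h by (simp_all add: F'_def LX_extend pe)
  moreover have "range (\<lambda>n. chi (A n)) \<subseteq> LX Y" using AL by auto
  ultimately obtain G where G: "linear_prevision Y G" "G \<le> F'" "1 \<le> G (?e h)"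
    "\<And>n. 1 \<le> G ((1 + 1 / Suc n) \<odot> chi (A n))"
    using linear_below_with_masses[OF topological_cone_LX_locally_compact[OF Y(1)]
      locally_convex_compact_LX_locally_compact[OF Y(1)] locally_convex_LX_locally_compact[OF Y(1)] F'H _ sh]
    by blast
  note Gs = linear_sublin[OF G(1)]
  have GA: "1 \<le> G (chi (A n))" for n
  proof (rule mass_ge_one[OF Gs AL])
    fix m
    \<comment> \<open>The factor known for \<open>A n\<close> is tied to \<open>n\<close>. Since the
      \<open>A n\<close> decrease, a later pair bounds the one with \<open>A n\<close> and an
      arbitrary factor index \<open>m\<close>.\<close>
    have "1 \<le> G ((1 + 1 / Suc (max m n)) \<odot> chi (A (max m n)))" by (rule G(4))
    also have "\<dots> \<le> G ((1 + 1 / Suc m) \<odot> chi (A n))"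
    proof (intro sublin_mono[OF Gs] LX_smul AL)
      have "(1 + 1 / Suc (max m n)) \<odot> chi (A (max m n)) \<le> (1 + 1 / Suc m) \<odot> chi (A (max m n))"
        by (intro LX_smul_mono_left add_left_mono frac_le) auto
      also have "\<dots> \<le> (1 + 1 / Suc m) \<odot> chi (A n)"
        by (intro LX_smul_mono chi_mono decr) auto
      finally show "(1 + 1 / Suc (max m n)) \<odot> chi (A (max m n)) \<le> (1 + 1 / Suc m) \<odot> chi (A n)" .
    qed
    finally show "1 \<le> G ((1 + 1 / Suc m) \<odot> chi (A n))" .
  qed
  have tot: "G (LX_one Y) \<le> 1"
    using G(2) Norm_one[OF F] LX_one[of Y] pone by (metis F'_def le_fun_def)
  have le: "G k \<le> G k'" if "k \<in> LX Y" "k' \<in> LX Y" "\<And>x. x \<in> topspace X \<Longrightarrow> k (f x) \<le> k' (f x)" for k k'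
  proof (rule linear_mono_on_Gdelta[OF Y G(1) A(1) GA tot that(1,2)])
    fix y assume "\<And>n. y \<in> A n"
    then have "y \<in> f ` topspace X" using A(3) fS by blast
    with that(3) show "k y \<le> k' y" by blast
  qed
  have eq: "G k = G k'" if "k \<in> LX Y" "k' \<in> LX Y" "\<And>x. x \<in> topspace X \<Longrightarrow> k (f x) = k' (f x)" for k k'
    using that by (intro antisym le) auto
  note at = extend_at[OF f]
  define H where "H g = (if g \<in> LX X then G (?e g) else 0)" for g
  have Hadd: "H (g \<oplus> g') = H g + H g'" if g: "g \<in> LX X" "g' \<in> LX X" for g g'
  proof -
    have "G (?e (g \<oplus> g')) = G (?e g \<oplus> ?e g')"
      using g by (intro eq LX_extend LX_add) (simp add: at LX_add, simp add: LX_add_def at)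
    with g show ?thesis by (simp add: H_def LX_add linear_add[OF G(1)] LX_extend)
  qed
  have Hsub: "sublin X H"
  proof (rule sublinI)
    show "H g \<le> H g'" if "g \<in> LX X" "g' \<in> LX X" "g \<le> g'" for g g'
      using that by (simp add: H_def sublin_mono[OF Gs] LX_extend extend_mono)
    show "ennreal a * H g \<le> H (a \<odot> g)" if a: "0 < a" and g: "g \<in> LX X" for a g
    proof -
      have "G (?e (a \<odot> g)) = G (a \<odot> ?e g)"
        using g by (intro eq LX_extend LX_smul) (simp add: at LX_smul, simp add: LX_smul_def at)
      with a g show ?thesis by (simp add: H_def LX_smul sublin_smul[OF Gs] LX_extend)
    qed
    show "H (g \<oplus> g') \<le> H g + H g'" if "g \<in> LX X" "g' \<in> LX X" for g g'
      using Hadd[OF that] by simp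
    have "G (?e (\<lambda>_. 0)) = G (\<lambda>_. 0)" by (intro eq LX_extend LX_zero) (simp add: at)
    then show "H (\<lambda>_. 0) = 0" by (simp add: H_def sublin_zero[OF Gs])
  qed (simp add: H_def)
  have "sc X H"
    unfolding sc_def
  proof (intro conjI ballI allI impI)
    show "H g \<le> H g'" if "g \<in> LX X" "g' \<in> LX X" "g \<le> g'" for g g' by (rule sublin_mono[OF Hsub that])
    fix D assume D: "directed_in (LX X) D"
    then have DL: "D \<subseteq> LX X" by (simp add: directed_in_def)
    have eD: "directed_in (LX Y) (?e ` D)"
      unfolding directed_in_def
    proof (intro conjI ballI)
      fix a b assume "a \<in> ?e ` D" "b \<in> ?e ` D"
      then obtain c d where cd: "c \<in> D" "d \<in> D" "a = ?e c" "b = ?e d" by blast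
      then obtain z where "z \<in> D" "c \<le> z" "d \<le> z" using D unfolding directed_in_def by blast
      with cd show "\<exists>z\<in>?e ` D. a \<le> z \<and> b \<le> z" by (auto intro: extend_mono)
    qed (use D in \<open>auto simp: directed_in_def LX_extend\<close>)
    \<comment> \<open>The two maps may differ off \<open>S\<close>; by \<open>le\<close> the
      comparison on the image of \<open>X\<close> is enough.\<close>
    have "G (?e (Sup D)) \<le> G (Sup (?e ` D))"
    proof (rule le)
      show "Sup (?e ` D) \<in> LX Y" by (rule LX_Sup) (auto simp: LX_extend)
      fix x assume x: "x \<in> topspace X"
      have "?e (Sup D) (f x) = (SUP d\<in>D. d x)" using at[OF LX_Sup[OF DL] x] by simp
      also have "\<dots> = (SUP d\<in>D. ?e d (f x))" using DL x by (intro SUP_cong refl) (auto simp: at)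
      finally show "?e (Sup D) (f x) \<le> Sup (?e ` D) (f x)" by (simp add: image_image)
    qed (rule LX_extend)
    also have "\<dots> = (SUP d\<in>D. G (?e d))" using sc_Sup[OF linear_sc[OF G(1)] eD] by (simp add: image_image)
    also have "\<dots> = (SUP d\<in>D. H d)" using DL by (intro SUP_cong refl) (auto simp: H_def)
    finally show "H (Sup D) \<le> (SUP d\<in>D. H d)" using LX_Sup[OF DL] by (simp add: H_def)
  qed
  then have Hlin: "linear_prevision X H" using Hsub Hadd by (simp add: linear_prevision_iff)
  moreover have HF: "H \<le> F"
  proof (rule le_funI)
    fix g show "H g \<le> F g"
    proof (cases "g \<in> LX X")
      case True
      have "G (?e g) \<le> F' (?e g)" using G(2) by (rule le_funD)
      with True show ?thesis by (simp add: H_def F'_def LX_extend pe)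
    qed (simp add: H_def)
  qed
  moreover have "H (LX_one X) = 1"
  proof (rule antisym)
    show "H (LX_one X) \<le> 1" using HF Norm_one[OF F] by (metis le_fun_def)
    \<comment> \<open>Any \<open>A n\<close> would serve: each contains the image of
      \<open>X\<close> and has mass at least 1.\<close>
    have "G (chi (A 0)) \<le> G (?e (LX_one X))"
    proof (rule le)
      fix x assume x: "x \<in> topspace X"
      then show "chi (A 0) (f x) \<le> ?e (LX_one X) (f x)"
        unfolding at[OF LX_one x] by (simp add: LX_one_def chi_def)
    qed (auto simp: AL LX_extend)
    with GA[of 0] show "1 \<le> H (LX_one X)" by (simp add: H_def LX_one)
  qed
  moreover have "1 \<le> H h" using G(3) h by (simp add: H_def)
  ultimately show "\<exists>G\<in>PP Norm X. G \<le> F \<and> 1 \<le> G h" using PP_NormI by blast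
qed

lemma friendly_representable:
  fixes X :: "'a topology"
  assumes "friendly TYPE('b) v X"
  shows "representable v X"
proof (cases v)
  case NoCond
  with assms show ?thesis by (simp add: friendly_def AP_friendly_def representable_NoCond)
next
  case SubNorm
  with assms show ?thesis by (simp add: friendly_def AP_friendly_def representable_SubNorm)
next
  case Norm
  with assms consider "compact_space X" "AP_friendly X"
    | "LX_locally_convex_compact X"
      "LX_locally_convex X" "LX_topological_cone X"
    | "lcs_complete TYPE('b) X"
    by (auto simp: friendly_def AP1_friendly_def)
  then have "representable Norm X"
  proof cases
    case 1
    then show ?thesis by (simp add: AP_friendly_def representable_Norm_compact)
  next
    case 2
    then show ?thesis by (intro representable_Norm_convex_compact)
  next
    case 3
    then show ?thesis unfolding lcs_complete_def using representable_Norm_LCS by blast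
  qed
  with Norm show ?thesis by simp
qed

theorem theorem4p11:
  fixes X :: "'a topology" and v :: variant
  assumes "friendly TYPE('b) v X"
  shows "homeomorphic_maps
           (subtopology (lower_vietoris (weak_topology X (PP v X))) (Hcvx v X))
           (weak_topology X (PAP v X)) r_AP (s_AP v X)
       \<and> bij_betw r_AP (Hcvx v X) (PAP v X)
       \<and> (\<forall>F\<in>PAP v X. r_AP (s_AP v X F) = F)
       \<and> (\<forall>E\<in>Hcvx v X. \<forall>E'\<in>Hcvx v X. E \<subseteq> E' \<longleftrightarrow> r_AP E \<le> r_AP E')"
  using representable_imp_homeomorphic[OF friendly_representable[OF assms]] .

end
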